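(* There is an absolute constant $C>0$ such that the following holds. Let $S_1, \dots, S_m \subseteq [n]$ be given sets such that $|S_i| \ge C \log n$ for each $i \in [m]$. Then there is a deterministic parallel algorithm with work $\tilde{O}\big(\sum_{i \in [m]} |S_i|\big)$ and depth $\tilde{O}(1)$ that splits the elements of $[n]$ into three classes YES, NO and MAYBE such that, for every $i \in [m]$, the set $S_i$ contains at least $|S_i|/5$ elements of class YES and at least $|S_i|/5$ elements of class NO.
   Context: $[n] = \{1,\dots,n\}$. Parallel algorithms are measured in the work/depth (PRAM) model: work is the total number of operations and depth is the length of the longest chain of sequentially dependent operations. $\tilde{O}(\cdot)$ hides factors polylogarithmic in $n$; in particular depth $\tilde{O}(1)$ means depth polylogarithmic in $n$.
   Formalization: The number of sets is assumed polynomial, m ≤ n^c for an arbitrary fixed c, with C and the algorithm depending only on c (for unrestricted m the claim is false: take all subsets of size about C log n); n ≥ 2 is assumed; for the empty family the work bound uses 1 instead of 0. *)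

theory Defs
  imports Complex_Main
begin

text \<open>
  The work/depth (PRAM) model, as a fork-join language over a shared memory of natural-number
  cells.  Every processor has private registers.

  Unit-cost arithmetic is addition, truncated subtraction, halving and comparison.  There is
  deliberately no unit-cost multiplication: a cell can then at most double per unit of depth, so
  in polylogarithmic depth all words have polylogarithmically many bits and unbounded integers
  give no extra power up to polylogarithmic factors.
\<close>

type_synonym store = "nat \<Rightarrow> nat"

datatype expr =
    Const nat
  | Reg nat
  | Load expr
  | Add expr expr
  | Sub expr expr
  | Half expr
  | Less expr expr

datatype com =
    Skip
  | Assign nat expr
  | Write expr expr
  | Seq com com
  | If expr com com
  | While expr com
  | ParFor nat expr com

primrec val :: "expr \<Rightarrow> store \<Rightarrow> store \<Rightarrow> nat" where
  "val (Const k) R M = k"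
| "val (Reg x) R M = R x"
| "val (Load e) R M = M (val e R M)"
| "val (Add e f) R M = val e R M + val f R M"
| "val (Sub e f) R M = val e R M - val f R M"
| "val (Half e) R M = val e R M div 2"
| "val (Less e f) R M = (if val e R M < val f R M then 1 else 0)"

primrec reads :: "expr \<Rightarrow> store \<Rightarrow> store \<Rightarrow> nat set" where
  "reads (Const k) R M = {}"
| "reads (Reg x) R M = {}"
| "reads (Load e) R M = insert (val e R M) (reads e R M)"
| "reads (Add e f) R M = reads e R M \<union> reads f R M"
| "reads (Sub e f) R M = reads e R M \<union> reads f R M"
| "reads (Half e) R M = reads e R M"
| "reads (Less e f) R M = reads e R M \<union> reads f R M"

primrec cost :: "expr \<Rightarrow> nat" where
  "cost (Const k) = 1"
| "cost (Reg x) = 1"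
| "cost (Load e) = cost e + 1"
| "cost (Add e f) = cost e + cost f + 1"
| "cost (Sub e f) = cost e + cost f + 1"
| "cost (Half e) = cost e + 1"
| "cost (Less e f) = cost e + cost f + 1"

text \<open>
  \<open>exec c R M R' M' A B w d\<close>: started with registers \<open>R\<close> and shared memory \<open>M\<close>, the command \<open>c\<close>
  terminates with \<open>R'\<close> and \<open>M'\<close>; it has read exactly the shared cells in \<open>A\<close> and written exactly
  those in \<open>B\<close>, with work \<open>w\<close> and depth \<open>d\<close>.

  \<open>ParFor x e c\<close> runs one copy of \<open>c\<close> for each \<open>i\<close> below the value of \<open>e\<close>, with \<open>i\<close> in register
  \<open>x\<close> of a private copy of the registers.  Work adds up over the copies, depth is their maximum.
  The copies must be free of data races (no copy touches a cell written by another one, although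
  concurrent reads are allowed), so that the result does not depend on the scheduling; a racing
  program has no execution.
\<close>

inductive exec ::
  "com \<Rightarrow> store \<Rightarrow> store \<Rightarrow> store \<Rightarrow> store \<Rightarrow> nat set \<Rightarrow> nat set \<Rightarrow> nat \<Rightarrow> nat \<Rightarrow> bool" where
  Skip: "exec Skip R M R M {} {} 1 1"
| Assign: "exec (Assign x e) R M (R(x := val e R M)) M (reads e R M) {} (cost e + 1) (cost e + 1)"
| Write: "exec (Write a e) R M R (M(val a R M := val e R M))
    (reads a R M \<union> reads e R M) {val a R M} (cost a + cost e + 1) (cost a + cost e + 1)"
| Seq: "exec c1 R M R1 M1 A1 B1 w1 d1 \<Longrightarrow> exec c2 R1 M1 R2 M2 A2 B2 w2 d2 \<Longrightarrow>
    exec (Seq c1 c2) R M R2 M2 (A1 \<union> A2) (B1 \<union> B2) (w1 + w2) (d1 + d2)"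
| IfTrue: "val e R M \<noteq> 0 \<Longrightarrow> exec c1 R M R1 M1 A B w d \<Longrightarrow>
    exec (If e c1 c2) R M R1 M1 (reads e R M \<union> A) B (cost e + 1 + w) (cost e + 1 + d)"
| IfFalse: "val e R M = 0 \<Longrightarrow> exec c2 R M R1 M1 A B w d \<Longrightarrow>
    exec (If e c1 c2) R M R1 M1 (reads e R M \<union> A) B (cost e + 1 + w) (cost e + 1 + d)"
| WhileFalse: "val e R M = 0 \<Longrightarrow>
    exec (While e c) R M R M (reads e R M) {} (cost e + 1) (cost e + 1)"
| WhileTrue: "val e R M \<noteq> 0 \<Longrightarrow> exec c R M R1 M1 A1 B1 w1 d1 \<Longrightarrow>
    exec (While e c) R1 M1 R2 M2 A2 B2 w2 d2 \<Longrightarrow>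
    exec (While e c) R M R2 M2 (reads e R M \<union> A1 \<union> A2) (B1 \<union> B2)
      (cost e + 1 + w1 + w2) (cost e + 1 + d1 + d2)"
| ParFor: "p = val e R M \<Longrightarrow>
    (\<forall>i<p. exec c (R(x := i)) M (R1 i) (M1 i) (A i) (B i) (w i) (d i)) \<Longrightarrow>
    (\<forall>i<p. \<forall>j<p. i \<noteq> j \<longrightarrow> B i \<inter> (A j \<union> B j) = {}) \<Longrightarrow>
    (\<forall>i<p. \<forall>a\<in>B i. M' a = M1 i a) \<Longrightarrow>
    (\<forall>a. a \<notin> (\<Union>i<p. B i) \<longrightarrow> M' a = M a) \<Longrightarrow>
    exec (ParFor x e c) R M R M' (reads e R M \<union> (\<Union>i<p. A i)) (\<Union>i<p. B i)
      (cost e + 1 + (\<Sum>i<p. w i)) (cost e + 1 + Max (insert 0 (d ` {..<p})))"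

lemma exec_deterministic:
  assumes "exec c R M R' M' A B w d" and "exec c R M R'' M'' A' B' w' d'"
  shows "R' = R'' \<and> M' = M'' \<and> A = A' \<and> B = B' \<and> w = w' \<and> d = d'"
  using assms
proof (induction arbitrary: R'' M'' A' B' w' d' rule: exec.induct)
  case (Skip R M)
  then show ?case by (auto elim: exec.cases)
next
  case (Assign x e R M)
  then show ?case by (auto elim: exec.cases)
next
  case (Write a e R M)
  then show ?case by (auto elim: exec.cases)
next
  case (Seq c1 R M R1 M1 A1 B1 w1 d1 c2 R2 M2 A2 B2 w2 d2)
  from Seq.prems show ?case
    by (cases rule: exec.cases) (use Seq.IH in blast)
next
  case (IfTrue e R M c1 R1 M1 A B w d c2)
  from IfTrue.prems show ?case
    by (cases rule: exec.cases) (use IfTrue.IH IfTrue.hyps in blast)+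
next
  case (IfFalse e R M c2 R1 M1 A B w d c1)
  from IfFalse.prems show ?case
    by (cases rule: exec.cases) (use IfFalse.IH IfFalse.hyps in blast)+
next
  case (WhileFalse e R M c)
  from WhileFalse.prems show ?case
    by (cases rule: exec.cases) (use WhileFalse.hyps in auto)
next
  case (WhileTrue e R M c R1 M1 A1 B1 w1 d1 R2 M2 A2 B2 w2 d2)
  from WhileTrue.prems show ?case
    by (cases rule: exec.cases) (use WhileTrue.IH WhileTrue.hyps in blast)+
next
  case (ParFor p e R M c x R1 M1 A B w d M')
  from ParFor.prems show ?case
  proof (cases rule: exec.cases)
    case (ParFor q R1' M1' A1' B1' w1' d1')
    have q: "q = p" using ParFor \<open>p = val e R M\<close> by simp
    have eq: "M1 i = M1' i \<and> A i = A1' i \<and> B i = B1' i \<and> w i = w1' i \<and> d i = d1' i"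
      if "i < p" for i
      using ParFor.IH that ParFor(7) q by blast
    have "M' a = M'' a" for a
    proof (cases "a \<in> (\<Union>i<p. B i)")
      case True
      then obtain i where "i < p" "a \<in> B i" by blast
      then show ?thesis using ParFor.hyps ParFor eq q by metis
    next
      case False
      moreover from this have "a \<notin> (\<Union>i<q. B1' i)" using eq q by auto
      ultimately show ?thesis using ParFor.hyps ParFor by metis
    qed
    moreover have "(\<Union>i<p. A i) = (\<Union>i<q. A1' i)" "(\<Union>i<p. B i) = (\<Union>i<q. B1' i)"
      "(\<Sum>i<p. w i) = (\<Sum>i<q. w1' i)" "d ` {..<p} = d1' ` {..<q}"
      using eq q by auto
    ultimately show ?thesis using ParFor by auto
  qed
qed

text \<open>
  A family \<open>S 1, \<dots>, S m\<close> of subsets of \<open>{1..n}\<close> is given by listing the elements of each set, in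
  any order and without repetition.
\<close>

definition lists_family :: "nat \<Rightarrow> (nat \<Rightarrow> nat set) \<Rightarrow> nat list list \<Rightarrow> bool" where
  "lists_family m S xss \<longleftrightarrow>
     length xss = m \<and> (\<forall>i\<in>{1..m}. distinct (xss ! (i - 1)) \<and> set (xss ! (i - 1)) = S i)"

text \<open>
  Input layout: \<open>n\<close>, \<open>m\<close>, then \<open>m + 1\<close> addresses, then all the lists one after the other.  The
  list of \<open>S i\<close> occupies the cells from the \<open>i\<close>-th of these addresses up to (excluding) the next one;
  the last address is the end of the input.  All other cells initially hold 0.
\<close>

definition input_cells :: "nat \<Rightarrow> nat list list \<Rightarrow> nat list" where
  "input_cells n xss =
     [n, length xss] @
     map (\<lambda>j. length xss + 3 + (\<Sum>i<j. length (xss ! i))) [0..<length xss + 1] @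
     concat xss"

definition initial_memory :: "nat list \<Rightarrow> store" where
  "initial_memory cs a = (if a < length cs then cs ! a else 0)"

datatype label = YES | NO | MAYBE

text \<open>
  MAYBE is the blank symbol: the work bound may be smaller than \<open>n\<close>, so elements outside all the sets
  cannot be written one by one.
\<close>

primrec label_code :: "label \<Rightarrow> nat" where
  "label_code YES = 1"
| "label_code NO = 2"
| "label_code MAYBE = 0"

text \<open>The label of the element \<open>v\<close> is output \<open>v\<close> cells after the end of the input.\<close>

definition computes_labels ::
  "com \<Rightarrow> nat \<Rightarrow> nat list list \<Rightarrow> (nat \<Rightarrow> label) \<Rightarrow> nat \<Rightarrow> nat \<Rightarrow> bool" where
  "computes_labels P n xss \<chi> w d \<longleftrightarrow>
     (\<exists>R M A B. exec P (\<lambda>_. 0) (initial_memory (input_cells n xss)) R M A B w d \<and>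
        (\<forall>v\<in>{1..n}. M (length (input_cells n xss) + v) = label_code (\<chi> v)))"

end

theory Submission imports Defs begin

text \<open>
  Cut every set into windows of \<open>L = \<Theta>(log n)\<close> consecutive elements of its list; it suffices that each
  window contains at least \<open>L/4\<close> elements of both classes.  Every element performs a walk on
  \<open>{0..2L}\<close> from \<open>L\<close> with steps \<open>\<plusminus>1\<close>, absorbed at the ends; after \<open>16 L\<^sup>2\<close> steps, \<open>2L\<close> means YES, \<open>0\<close>
  means NO, and anything else MAYBE.  With \<open>y\<close> the distance from the centre and \<open>\<tau>\<close> the number of steps
  before absorption, \<open>\<Sum>(\<tau> - y\<^sup>2 \<mp> 8 L y)\<close> over a window is a martingale for independent signs, and
  bounding it from above for both signs forces almost all elements of the window to be absorbed, about
  half of them at each end.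

  The bound comes from the weights \<open>\<Prod>(1 + z + z\<^sup>2) \<ge> exp (\<Sum>z)\<close>, where \<open>z\<close> are the scaled increments of
  this martingale.  The total weight after one more step is a quadratic form in the signs, so its
  expectation only needs pairwise independence, as provided by \<open>s v = (-1)\<^bsup>\<langle>r, v\<rangle>\<^esup>\<close> for a random bit vector
  \<open>r\<close>.  The bits of \<open>r\<close> are fixed one after the other by the method of conditional expectations: given the
  first \<open>j\<close> bits, the pairs that contribute are those whose identifiers agree above bit \<open>j\<close>.  A window has
  polylogarithmic size, so its contribution is computed sequentially by one processor; only the sum over all
  windows is a parallel reduction.

  All data are kept per occurrence of an element in a list.  Since concurrent writes are forbidden, a
  tournament over blocks of \<open>2\<^sup>i\<close> occurrences selects the first occurrence of each element, which alone
  writes the label.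
\<close>

section \<open>Bounded-loop expressions\<close>

text \<open>One round of pairwise independent signs controls only second moments, too weak for a
  failure probability below \<open>1/N\<close> in windows of logarithmic length. Many small steps
  build up the exponential moment instead. With scale \<open>g\<close>, a step changes the scaled
  martingale of a window by \<open>z\<close> with \<open>|z| <= 10 L^2 / g\<close>. The mean of
  \<open>1 + z + z^2\<close> exceeds 1 by at most \<open>L (10 L)^2 / g^2\<close>, since distinct
  elements leave only diagonal terms. For \<open>g = 3200 L^2\<close> and \<open>16 L^2\<close>
  steps the growth is at most \<open>exp (L / 6400)\<close>. There are at most \<open>2 N\<close>
  weights, each initially at most 1, so \<open>ln (2 N) <= L / 6400\<close> bounds every martingale
  value by \<open>g L / 3200 = L^3\<close>. The number of steps and the multiple \<open>8 L\<close>
  are chosen to make this decisive: an unabsorbed element alone contributes \<open>16 L^2\<close>,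
  and a drift \<open>\<Sum>y\<close> contributes \<open>8 L |\<Sum>y|\<close> for one of the two
  signs. Weights are multiplied by \<open>g^2\<close> in every step, so they stay integers, with
  polylogarithmically many bits.\<close>

lemma exec_While_invariant:
  assumes "i \<le> n" "I i R M"
    and "\<And>i R M. i < n \<Longrightarrow> I i R M \<Longrightarrow> \<exists>R' M' A B w d. exec c R M R' M' A B w d \<and>
           I (Suc i) R' M' \<and> A \<subseteq> S \<and> B \<subseteq> S' \<and> w \<le> W \<and> d \<le> D"
    and "\<And>i R M. i \<le> n \<Longrightarrow> I i R M \<Longrightarrow> (val e R M \<noteq> 0 \<longleftrightarrow> i < n) \<and> reads e R M \<subseteq> S"
  shows "\<exists>R' M' A B w d. exec (While e c) R M R' M' A B w d \<and> I n R' M' \<and> A \<subseteq> S \<and> B \<subseteq> S' \<and>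
           w \<le> (n - i) * (W + cost e + 1) + cost e + 1 \<and> d \<le> (n - i) * (D + cost e + 1) + cost e + 1"
  using assms(1,2)
proof (induction "n - i" arbitrary: i R M)
  case 0
  then have "i = n" by simp
  with 0 assms(4)[of i R M] have v: "val e R M = 0" "reads e R M \<subseteq> S" by auto
  have "exec (While e c) R M R M (reads e R M) {} (cost e + 1) (cost e + 1)"
    using v by (rule_tac exec.WhileFalse)
  moreover have "I n R M" "{} \<subseteq> S'" using 0 \<open>i = n\<close> by auto
  moreover have "cost e + 1 \<le> (n - i) * (W + cost e + 1) + cost e + 1"
    "cost e + 1 \<le> (n - i) * (D + cost e + 1) + cost e + 1" by auto
  ultimately show ?case using v(2) by blast
next
  case (Suc k)
  then have i: "i < n" by simp
  from assms(3)[OF i Suc.prems(2)] obtain R1 M1 A1 B1 w1 d1 where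
    1: "exec c R M R1 M1 A1 B1 w1 d1" "I (Suc i) R1 M1" "A1 \<subseteq> S" "B1 \<subseteq> S'" "w1 \<le> W" "d1 \<le> D" by blast
  have "k = n - Suc i" "Suc i \<le> n" using Suc i by auto
  from Suc.hyps(1)[OF this 1(2)] obtain R2 M2 A2 B2 w2 d2 where
    2: "exec (While e c) R1 M1 R2 M2 A2 B2 w2 d2" "I n R2 M2" "A2 \<subseteq> S" "B2 \<subseteq> S'"
      "w2 \<le> (n - Suc i) * (W + cost e + 1) + cost e + 1" "d2 \<le> (n - Suc i) * (D + cost e + 1) + cost e + 1"
    by blast
  have v: "val e R M \<noteq> 0" "reads e R M \<subseteq> S" using assms(4)[of i R M] i Suc.prems by auto
  have n: "n - i = Suc (n - Suc i)" using i by simp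
  have "cost e + 1 + w1 + w2 \<le> (n - i) * (W + cost e + 1) + cost e + 1"
    "cost e + 1 + d1 + d2 \<le> (n - i) * (D + cost e + 1) + cost e + 1"
    using 1 2 by (simp_all add: n)
  moreover have "reads e R M \<union> A1 \<union> A2 \<subseteq> S" "B1 \<union> B2 \<subseteq> S'" using 1 2 v by auto
  ultimately show ?case using exec.WhileTrue[OF v(1) 1(1) 2(1)] 2(2) by blast
qed

text \<open>
  Register 0 bounds every loop: \<open>It x y n a e\<close> starts with \<open>x = a\<close> and performs \<open>x := e\<close> for
  \<open>y = 0, 1, \<dots>\<close>, at most \<open>n\<close> and at most (register 0) times, so that the cost of an expression is a
  polynomial in register 0 that depends only on its syntax.  Register 1 holds the end of the input and
  register 2 the start of the working memory, in which the arrays \<open>1, \<dots>, 15\<close> are interleaved; array 0 is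
  the input.  Registers from 50 on are temporaries of compiled expressions.
\<close>

type_synonym arrays = "nat \<Rightarrow> nat \<Rightarrow> nat"

datatype hx =
    V nat
  | Cn nat
  | Ar nat hx
  | Ad hx hx
  | Sb hx hx
  | Hf hx
  | Ls hx hx
  | It nat nat hx hx hx

primrec ev :: "hx \<Rightarrow> store \<Rightarrow> arrays \<Rightarrow> nat" where
  "ev (V x) R A = R x"
| "ev (Cn c) R A = c"
| "ev (Ar j e) R A = A j (ev e R A)"
| "ev (Ad e f) R A = ev e R A + ev f R A"
| "ev (Sb e f) R A = ev e R A - ev f R A"
| "ev (Hf e) R A = ev e R A div 2"
| "ev (Ls e f) R A = (if ev e R A < ev f R A then 1 else 0)"
| "ev (It x y n a e) R A =
     fold (\<lambda>i s. ev e (R(x := s, y := i)) A) [0..<min (ev n R A) (R 0)] (ev a R A)"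

text \<open>Loop variables avoid registers 0, 1 and 2, which hold the iteration bound and the memory
  layout, and the temporaries from 50 on.\<close>

primrec wfx :: "hx \<Rightarrow> bool" where
  "wfx (V x) \<longleftrightarrow> x < 50"
| "wfx (Cn c) \<longleftrightarrow> True"
| "wfx (Ar j e) \<longleftrightarrow> j < 16 \<and> wfx e"
| "wfx (Ad e f) \<longleftrightarrow> wfx e \<and> wfx f"
| "wfx (Sb e f) \<longleftrightarrow> wfx e \<and> wfx f"
| "wfx (Hf e) \<longleftrightarrow> wfx e"
| "wfx (Ls e f) \<longleftrightarrow> wfx e \<and> wfx f"
| "wfx (It x y n a e) \<longleftrightarrow> 3 \<le> x \<and> x < 50 \<and> 3 \<le> y \<and> y < 50 \<and> x \<noteq> y \<and> wfx n \<and> wfx a \<and> wfx e"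

primrec arrs :: "hx \<Rightarrow> nat set" where
  "arrs (V x) = {}"
| "arrs (Cn c) = {}"
| "arrs (Ar j e) = insert j (arrs e)"
| "arrs (Ad e f) = arrs e \<union> arrs f"
| "arrs (Sb e f) = arrs e \<union> arrs f"
| "arrs (Hf e) = arrs e"
| "arrs (Ls e f) = arrs e \<union> arrs f"
| "arrs (It x y n a e) = arrs n \<union> arrs a \<union> arrs e"

primrec hcost :: "hx \<Rightarrow> nat \<Rightarrow> nat" where
  "hcost (V x) X = 2"
| "hcost (Cn c) X = 2"
| "hcost (Ar j e) X = hcost e X + 50"
| "hcost (Ad e f) X = hcost e X + hcost f X + 4"
| "hcost (Sb e f) X = hcost e X + hcost f X + 4"
| "hcost (Hf e) X = hcost e X + 3"
| "hcost (Ls e f) X = hcost e X + hcost f X + 4"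
| "hcost (It x y n a e) X = hcost n X + hcost a X + X * (hcost e X + 10) + 30"

text \<open>Clamping input reads at \<open>l\<close> keeps them off the output cells
  \<open>l + 1, ...\<close>, so that labels can be written in a phase that still reads the
  input.\<close>

definition addr :: "nat \<Rightarrow> nat \<Rightarrow> nat \<Rightarrow> nat \<Rightarrow> nat" where
  "addr l b j i = (if j = 0 then min i l else b + (16 * i + j))"

text \<open>Multiplication has no unit-cost instruction, so the factor 16 is four doublings.\<close>

definition slot :: "nat \<Rightarrow> nat \<Rightarrow> expr" where
  "slot j k = Add (Reg 2) (Add (let e = (\<lambda>e. Add e e) in e (e (e (e (Reg k))))) (Const j))"

definition inslot :: "nat \<Rightarrow> expr" where
  "inslot k = Sub (Reg k) (Sub (Reg k) (Reg 1))"

text \<open>Register \<open>k\<close> is the top of an evaluation stack: the result goes there and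
  everything below \<open>k\<close> is left as it was. A loop therefore saves its two variables, and
  its body is evaluated from \<open>k + 4\<close> on.\<close>

primrec cmp :: "hx \<Rightarrow> nat \<Rightarrow> com" where
  "cmp (V x) k = Assign k (Reg x)"
| "cmp (Cn c) k = Assign k (Const c)"
| "cmp (Ar j e) k = Seq (cmp e k) (Assign k (Load (if j = 0 then inslot k else slot j k)))"
| "cmp (Ad e f) k = Seq (cmp e k) (Seq (cmp f (Suc k)) (Assign k (Add (Reg k) (Reg (Suc k)))))"
| "cmp (Sb e f) k = Seq (cmp e k) (Seq (cmp f (Suc k)) (Assign k (Sub (Reg k) (Reg (Suc k)))))"
| "cmp (Hf e) k = Seq (cmp e k) (Assign k (Half (Reg k)))"
| "cmp (Ls e f) k = Seq (cmp e k) (Seq (cmp f (Suc k)) (Assign k (Less (Reg k) (Reg (Suc k)))))"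
| "cmp (It x y n a e) k =
     Seq (cmp n k) (Seq (Assign k (Sub (Reg k) (Sub (Reg k) (Reg 0))))
     (Seq (cmp a (k + 1))
     (Seq (Assign (k + 2) (Reg x)) (Seq (Assign (k + 3) (Reg y))
     (Seq (Assign x (Reg (k + 1))) (Seq (Assign y (Const 0))
     (Seq (While (Less (Reg y) (Reg k))
        (Seq (cmp e (k + 4)) (Seq (Assign x (Reg (k + 4))) (Assign y (Add (Reg y) (Const 1))))))
     (Seq (Assign k (Reg x)) (Seq (Assign x (Reg (k + 2))) (Assign y (Reg (k + 3))))))))))))"

definition region :: "nat \<Rightarrow> nat \<Rightarrow> nat set \<Rightarrow> nat set" where
  "region l b J = {addr l b j i | j i. j \<in> J}"

definition rep :: "nat \<Rightarrow> nat \<Rightarrow> arrays \<Rightarrow> store \<Rightarrow> bool" where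
  "rep l b A M \<longleftrightarrow> (\<forall>j<16. \<forall>i. M (addr l b j i) = A j i)"

lemma region_Un: "region l b (J \<union> J') = region l b J \<union> region l b J'"
  and region_insert: "region l b (insert j J) = range (addr l b j) \<union> region l b J"
  by (auto simp: region_def)

primrec fv :: "hx \<Rightarrow> nat set" where
  "fv (V x) = {x}"
| "fv (Cn c) = {}"
| "fv (Ar j e) = fv e"
| "fv (Ad e f) = fv e \<union> fv f"
| "fv (Sb e f) = fv e \<union> fv f"
| "fv (Hf e) = fv e"
| "fv (Ls e f) = fv e \<union> fv f"
| "fv (It x y n a e) = insert 0 (fv n \<union> fv a \<union> (fv e - {x, y}))"

lemma ev_fv: "(\<And>x. x \<in> fv h \<Longrightarrow> R x = R' x) \<Longrightarrow> ev h R A = ev h R' A"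
proof (induction h arbitrary: R R')
  case (It x y n a e)
  have "ev n R A = ev n R' A" "ev a R A = ev a R' A" "R 0 = R' 0"
    using It.prems It.IH(1)[of R R'] It.IH(2)[of R R'] by simp_all
  moreover have "ev e (R(x := s, y := i)) A = ev e (R'(x := s, y := i)) A" for s i
    using It.prems by (intro It.IH(3)) auto
  ultimately show ?case by (simp add: cong: fold_cong)
next
  case (Ar j e)
  show ?case using Ar.prems Ar.IH[of R R'] by simp
next
  case (Hf e)
  show ?case using Hf.prems Hf.IH[of R R'] by simp
next
  case (Ad e f)
  show ?case using Ad.prems Ad.IH(1)[of R R'] Ad.IH(2)[of R R'] by simp
next
  case (Sb e f)
  show ?case using Sb.prems Sb.IH(1)[of R R'] Sb.IH(2)[of R R'] by simp
next
  case (Ls e f)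
  show ?case using Ls.prems Ls.IH(1)[of R R'] Ls.IH(2)[of R R'] by simp
qed auto

lemma fv_bound: "wfx h \<Longrightarrow> fv h \<subseteq> {..<50}"
  by (induction h) auto

lemma ev_cong:
  "wfx h \<Longrightarrow> (\<And>x. x < 50 \<Longrightarrow> R x = R' x) \<Longrightarrow> ev h R A = ev h R' A"
  using fv_bound[of h] by (intro ev_fv) auto

text \<open>Expressions are sequential and write no shared cell, so one number bounds both work and
  depth, and the memory is unchanged.\<close>

definition runs :: "com \<Rightarrow> store \<Rightarrow> store \<Rightarrow> store \<Rightarrow> nat set \<Rightarrow> nat \<Rightarrow> bool" where
  "runs c M R R' S W \<longleftrightarrow>
     (\<exists>A w d. exec c R M R' M A {} w d \<and> A \<subseteq> S \<and> w \<le> W \<and> d \<le> W)"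

lemma runs_Seq:
  "runs c M R R1 S W \<Longrightarrow> runs c' M R1 R2 S W' \<Longrightarrow> W + W' \<le> W'' \<Longrightarrow> runs (Seq c c') M R R2 S W''"
  unfolding runs_def by (force dest: exec.Seq)

lemma runs_Assign:
  "reads e R M \<subseteq> S \<Longrightarrow> R' = R(x := val e R M) \<Longrightarrow> cost e + 1 \<le> W \<Longrightarrow> runs (Assign x e) M R R' S W"
  unfolding runs_def using exec.Assign by blast

lemma runs_mono: "runs c M R R' S W \<Longrightarrow> S \<subseteq> S' \<Longrightarrow> W \<le> W' \<Longrightarrow> runs c M R R' S' W'"
  unfolding runs_def by (meson order_trans)

lemma runs_While:
  assumes "I 0 R"
    and "\<And>i R. i < n \<Longrightarrow> I i R \<Longrightarrow> \<exists>R'. runs c M R R' S W \<and> I (Suc i) R'"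
    and "\<And>i R. i \<le> n \<Longrightarrow> I i R \<Longrightarrow> (val e R M \<noteq> 0 \<longleftrightarrow> i < n) \<and> reads e R M \<subseteq> S"
  shows "\<exists>R'. runs (While e c) M R R' S (n * (W + cost e + 1) + cost e + 1) \<and> I n R'"
proof -
  have "\<exists>R' M' A B w d. exec (While e c) R M R' M' A B w d \<and> (I n R' \<and> M' = M) \<and> A \<subseteq> S \<and> B \<subseteq> {} \<and>
           w \<le> (n - 0) * (W + cost e + 1) + cost e + 1 \<and> d \<le> (n - 0) * (W + cost e + 1) + cost e + 1"
  proof (rule exec_While_invariant[where I = "\<lambda>i R M'. I i R \<and> M' = M"], goal_cases)
    case (3 i R M')
    then show ?case using assms(2)[of i R] unfolding runs_def by blast
  qed (use assms(1,3) in auto)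
  then show ?thesis unfolding runs_def by auto
qed

lemma val_slot: "val (slot j k) R M = R 2 + (16 * R k + j)" "cost (slot j k) = 35" "reads (slot j k) R M = {}"
  by (auto simp: slot_def Let_def)

lemma val_inslot: "val (inslot k) R M = min (R k) (R 1)" "cost (inslot k) = 5" "reads (inslot k) R M = {}"
  by (auto simp: inslot_def)

lemma runs_updE:
  "runs c M R (R1(k := v)) S W \<Longrightarrow> \<forall>x<k. R1 x = R x \<Longrightarrow>
    \<exists>R'. runs c M R R' S W \<and> R' k = v \<and> (\<forall>x<k. R' x = R x)"
  by (rule exI[of _ "R1(k := v)"], intro conjI, assumption) auto

lemma runs_binop:
  assumes "\<exists>R1. runs c M R R1 S W \<and> R1 k = a \<and> (\<forall>x<k. R1 x = R x)"
    and "\<And>R1. (\<forall>x<k. R1 x = R x) \<Longrightarrow>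
      \<exists>R2. runs c' M R1 R2 S' W' \<and> R2 (Suc k) = a' \<and> (\<forall>x<Suc k. R2 x = R1 x)"
    and "\<And>R2. R2 k = a \<Longrightarrow> R2 (Suc k) = a' \<Longrightarrow> val e R2 M = v \<and> reads e R2 M = {}" "cost e = 3"
  shows "\<exists>R'. runs (Seq c (Seq c' (Assign k e))) M R R' (S \<union> S') (W + W' + 4) \<and> R' k = v \<and> (\<forall>x<k. R' x = R x)"
proof -
  obtain R1 where 1: "runs c M R R1 S W" "R1 k = a" "\<forall>x<k. R1 x = R x" using assms(1) by blast
  obtain R2 where 2: "runs c' M R1 R2 S' W'" "R2 (Suc k) = a'" "\<forall>x<Suc k. R2 x = R1 x"
    using assms(2)[OF 1(3)] by blast
  have 3: "val e R2 M = v" "reads e R2 M = {}" using assms(3)[of R2] 1 2 by auto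
  have "runs (Seq c (Seq c' (Assign k e))) M R (R2(k := v)) (S \<union> S') (W + W' + 4)"
    using 3 assms(4) runs_mono[OF 1(1), of "S \<union> S'" W] runs_mono[OF 2(1), of "S \<union> S'" W']
    by (intro runs_Seq[where W = W and W' = "W' + 4"] runs_Seq[where W = W' and W' = 4] runs_Assign) auto
  then show ?thesis by (rule runs_updE) (use 1 2 in auto)
qed

lemma runs_cmp_binop:
  assumes IH: "\<And>k R. 50 \<le> k \<Longrightarrow> R 1 = l \<Longrightarrow> R 2 = b \<Longrightarrow> R 0 \<le> X \<Longrightarrow>
      \<exists>R'. runs (cmp e k) M R R' S W \<and> R' k = ev e R A \<and> (\<forall>x<k. R' x = R x)"
    "\<And>k R. 50 \<le> k \<Longrightarrow> R 1 = l \<Longrightarrow> R 2 = b \<Longrightarrow> R 0 \<le> X \<Longrightarrow>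
      \<exists>R'. runs (cmp f k) M R R' S' W' \<and> R' k = ev f R A \<and> (\<forall>x<k. R' x = R x)"
    and wf: "wfx f" and R: "50 \<le> k" "R 1 = l" "R 2 = b" "R 0 \<le> X"
    and op: "\<And>R'. R' k = ev e R A \<Longrightarrow> R' (Suc k) = ev f R A \<Longrightarrow> val op R' M = v \<and> reads op R' M = {}" "cost op = 3"
  shows "\<exists>R'. runs (Seq (cmp e k) (Seq (cmp f (Suc k)) (Assign k op))) M R R' (S \<union> S') (W + W' + 4) \<and>
    R' k = v \<and> (\<forall>x<k. R' x = R x)"
proof (rule runs_binop[OF IH(1)[OF R] _ op])
  fix R1 assume R1: "\<forall>x<k. R1 x = R x"
  have "ev f R1 A = ev f R A" using R1 R(1) wf by (intro ev_cong) auto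
  then show "\<exists>R2. runs (cmp f (Suc k)) M R1 R2 S' W' \<and> R2 (Suc k) = ev f R A \<and> (\<forall>x<Suc k. R2 x = R1 x)"
    using IH(2)[of "Suc k" R1] R R1 by simp
qed

text \<open>Value, cost and read footprint are proved together. The footprint depends only on the
  arrays named in the expression, which makes the later race checks syntactic.\<close>

lemma cmp_runs:
  assumes "wfx h" "50 \<le> k" "R 1 = l" "R 2 = b" "R 0 \<le> X" "rep l b A M"
  shows "\<exists>R'. runs (cmp h k) M R R' (region l b (arrs h)) (hcost h X) \<and> R' k = ev h R A \<and> (\<forall>x<k. R' x = R x)"
  using assms(1-5)
proof (induction h arbitrary: k R)
  case (V x)
  have "runs (cmp (V x) k) M R (R(k := R x)) (region l b (arrs (V x))) (hcost (V x) X)"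
    by (auto intro!: runs_Assign)
  then show ?case unfolding ev.simps by (rule runs_updE) auto
next
  case (Cn c)
  have "runs (cmp (Cn c) k) M R (R(k := c)) (region l b (arrs (Cn c))) (hcost (Cn c) X)"
    by (auto intro!: runs_Assign)
  then show ?case unfolding ev.simps by (rule runs_updE) auto
next
  case (Ad e f)
  then show ?case unfolding cmp.simps hcost.simps arrs.simps ev.simps region_Un
    by (intro runs_cmp_binop[where l = l and b = b and X = X]) auto
next
  case (Sb e f)
  then show ?case unfolding cmp.simps hcost.simps arrs.simps ev.simps region_Un
    by (intro runs_cmp_binop[where l = l and b = b and X = X]) auto
next
  case (Ls e f)
  then show ?case unfolding cmp.simps hcost.simps arrs.simps ev.simps region_Un
    by (intro runs_cmp_binop[where l = l and b = b and X = X]) auto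
next
  case (Hf e)
  then obtain R1 where 1: "runs (cmp e k) M R R1 (region l b (arrs e)) (hcost e X)" "R1 k = ev e R A"
    "\<forall>x<k. R1 x = R x" by auto blast
  have "runs (cmp (Hf e) k) M R (R1(k := ev (Hf e) R A)) (region l b (arrs (Hf e))) (hcost (Hf e) X)"
    using 1 by (auto intro!: runs_Seq[OF 1(1), where W' = 3] runs_Assign)
  then show ?case by (rule runs_updE) (use 1 in auto)
next
  case (Ar j e)
  then obtain R1 where 1: "runs (cmp e k) M R R1 (region l b (arrs e)) (hcost e X)" "R1 k = ev e R A"
    "\<forall>x<k. R1 x = R x" by auto blast
  have r: "R1 1 = l" "R1 2 = b" using 1 Ar.prems by auto
  have a: "val (if j = 0 then inslot k else slot j k) R1 M = addr l b j (ev e R A)"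
    using r 1 by (simp add: addr_def val_slot val_inslot)
  have "runs (cmp (Ar j e) k) M R (R1(k := ev (Ar j e) R A)) (region l b (arrs (Ar j e))) (hcost (Ar j e) X)"
    unfolding cmp.simps hcost.simps
  proof (rule runs_Seq[OF runs_mono[OF 1(1)], where W' = 50])
    show "runs (Assign k (Load (if j = 0 then inslot k else slot j k))) M R1 (R1(k := ev (Ar j e) R A))
       (region l b (arrs (Ar j e))) 50"
      using a Ar.prems(1) assms(6)
      by (intro runs_Assign) (auto simp: region_insert rep_def val_slot val_inslot)
  qed (auto simp: region_insert)
  then show ?case by (rule runs_updE) (use 1 in auto)
next
  case (It x y n a e)
  let ?S = "region l b (arrs (It x y n a e))"
  define N where "N = min (ev n R A) (R 0)"
  define g where "g i = fold (\<lambda>i s. ev e (R(x := s, y := i)) A) [0..<i] (ev a R A)" for i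
  have wf: "wfx n" "wfx a" "wfx e" "x \<noteq> y" "3 \<le> x" "x < k" "3 \<le> y" "y < k" "x < 50" "y < 50" using It.prems by auto
  have S: "region l b (arrs n) \<subseteq> ?S" "region l b (arrs a) \<subseteq> ?S" "region l b (arrs e) \<subseteq> ?S"
    by (auto simp: region_Un)
  obtain R1 where 1: "runs (cmp n k) M R R1 (region l b (arrs n)) (hcost n X)" "R1 k = ev n R A"
    "\<forall>x<k. R1 x = R x" using It.IH(1)[OF wf(1) It.prems(2-5)] by blast
  define R2 where "R2 = R1(k := N)"
  have 2: "runs (Assign k (Sub (Reg k) (Sub (Reg k) (Reg 0)))) M R1 R2 ?S 6"
    using 1 It.prems by (intro runs_Assign) (auto simp: R2_def N_def min_def)
  have r2: "\<forall>x<k. R2 x = R x" "R2 k = N" using 1 by (auto simp: R2_def)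
  obtain R3 where 3: "runs (cmp a (k + 1)) M R2 R3 (region l b (arrs a)) (hcost a X)" "R3 (k+1) = ev a R2 A"
    "\<forall>x<k+1. R3 x = R2 x" using It.IH(2)[of "k+1" R2] wf It.prems r2 by auto
  have "ev a R2 A = ev a R A" using r2 It.prems wf by (intro ev_cong) auto
  note 3 = 3(1) 3(2)[unfolded this] 3(3)
  define R4 where "R4 = R3(k + 2 := R3 x)"
  define R5 where "R5 = R4(k + 3 := R3 y)"
  define R6 where "R6 = R5(x := ev a R A)"
  define R7 where "R7 = R6(y := 0)"
  have s: "runs (Assign (k+2) (Reg x)) M R3 R4 ?S 2" "runs (Assign (k+3) (Reg y)) M R4 R5 ?S 2"
    "runs (Assign x (Reg (k+1))) M R5 R6 ?S 2" "runs (Assign y (Const 0)) M R6 R7 ?S 2"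
    using wf 3 by (auto intro!: runs_Assign simp: R4_def R5_def R6_def R7_def)
  \<comment> \<open>Below \<open>k\<close>, only the loop variables may differ from \<open>R\<close>
    during the loop; their saved values survive because the body uses temporaries from
    \<open>k + 4\<close> on.\<close>
  define I where "I i Q \<longleftrightarrow> (\<forall>z<k. z \<noteq> x \<longrightarrow> z \<noteq> y \<longrightarrow> Q z = R z) \<and> Q x = g i \<and> Q y = i \<and>
     Q k = N \<and> Q (k+2) = R x \<and> Q (k+3) = R y" for i Q
  have I0: "I 0 R7" using wf 3 r2 by (auto simp: I_def R7_def R6_def R5_def R4_def g_def)
  let ?c = "Seq (cmp e (k + 4)) (Seq (Assign x (Reg (k + 4))) (Assign y (Add (Reg y) (Const 1))))"
  have cW: "N * (hcost e X + 6 + cost (Less (Reg y) (Reg k)) + 1) + cost (Less (Reg y) (Reg k)) + 1 =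
      N * (hcost e X + 10) + 4" by simp
  have "\<exists>R'. runs (While (Less (Reg y) (Reg k)) ?c) M R7 R' ?S
      (N * (hcost e X + 6 + cost (Less (Reg y) (Reg k)) + 1) + cost (Less (Reg y) (Reg k)) + 1) \<and> I N R'"
  proof (rule runs_While[where I = I], rule I0)
    fix i Q assume i: "i < N" and Q: "I i Q"
    have *: "Q 1 = l" "Q 2 = b" "Q 0 \<le> X" using Q It.prems wf by (auto simp: I_def)
    obtain Q1 where 1: "runs (cmp e (k+4)) M Q Q1 (region l b (arrs e)) (hcost e X)" "Q1 (k+4) = ev e Q A"
      "\<forall>x<k+4. Q1 x = Q x" using It.IH(3)[of "k+4" Q] wf It.prems * by auto
    have "ev e Q A = ev e (R(x := g i, y := i)) A"
      using wf Q It.prems(2) by (intro ev_cong) (auto simp: I_def)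
    then have v: "ev e Q A = g (Suc i)" by (simp add: g_def)
    let ?Q2 = "Q1(x := g (Suc i))" let ?Q3 = "?Q2(y := Suc i)"
    have "runs ?c M Q ?Q3 ?S (hcost e X + 6)"
    proof (rule runs_Seq[OF runs_mono[OF 1(1) S(3) order.refl], where W' = 6])
      show "runs (Seq (Assign x (Reg (k + 4))) (Assign y (Add (Reg y) (Const 1)))) M Q1 ?Q3 ?S 6"
        using wf 1 v Q
        by (auto intro!: runs_Seq[where W = 2 and W' = 4 and ?R1.0 = ?Q2] runs_Assign simp: I_def)
    qed simp
    moreover have "I (Suc i) ?Q3" using Q 1 wf by (auto simp: I_def)
    ultimately show "\<exists>R'. runs ?c M Q R' ?S (hcost e X + 6) \<and> I (Suc i) R'" by blast
  qed (auto simp: I_def)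
  then obtain R8 where 8: "runs (While (Less (Reg y) (Reg k)) ?c) M R7 R8 ?S (N * (hcost e X + 10) + 4)" "I N R8"
    unfolding cW by blast
  let ?R9 = "R8(k := g N)" let ?R10 = "?R9(x := R x)" let ?R11 = "?R10(y := R y)"
  have s': "runs (Assign k (Reg x)) M R8 ?R9 ?S 2" "runs (Assign x (Reg (k+2))) M ?R9 ?R10 ?S 2"
    "runs (Assign y (Reg (k+3))) M ?R10 ?R11 ?S 2"
    using 8 wf by (auto intro!: runs_Assign simp: I_def)
  have NX: "N * (hcost e X + 10) \<le> X * (hcost e X + 10)" using It.prems by (auto simp: N_def)
  have "runs (cmp (It x y n a e) k) M R ?R11 ?S (hcost (It x y n a e) X)"
    unfolding cmp.simps
    apply (rule runs_Seq[OF runs_mono[OF 1(1) S(1) order.refl] runs_Seq[OF 2 runs_Seq[OF runs_mono[OF 3(1) S(2) order.refl]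
          runs_Seq[OF s(1) runs_Seq[OF s(2) runs_Seq[OF s(3) runs_Seq[OF s(4)
          runs_Seq[OF 8(1) runs_Seq[OF s'(1) runs_Seq[OF s'(2) s'(3) order.refl] order.refl] order.refl] order.refl] order.refl] order.refl] order.refl] order.refl] order.refl]])
    unfolding hcost.simps using NX by linarith
  moreover have "ev (It x y n a e) R A = g N" by (simp add: g_def N_def)
  moreover have "?R11 k = g N" "\<forall>z<k. ?R11 z = R z" using 8(2) wf by (auto simp: I_def)
  ultimately show ?case by metis
qed

section \<open>Programs with race-free parallel phases\<close>

datatype prog =
    SetR nat hx
  | Ph nat nat hx hx hx
  | Sq prog prog
  | Lp nat nat prog

text \<open>
  \<open>Ph c j g i v\<close>: for each \<open>p\<close> below register \<open>c\<close>, held in register 3, write \<open>v\<close> to the cell \<open>i\<close> of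
  array \<open>j\<close> if \<open>g\<close> is nonzero; \<open>j = 0\<close> denotes the output cells.  The written array is not read in the same
  phase, so the absence of races only requires \<open>i\<close> to be injective.
\<close>

definition waddr :: "nat \<Rightarrow> nat \<Rightarrow> expr" where
  "waddr j k = (if j = 0 then Add (Reg 1) (Reg k) else slot j k)"

definition phase_body :: "nat \<Rightarrow> hx \<Rightarrow> hx \<Rightarrow> hx \<Rightarrow> com" where
  "phase_body j g i v = Seq (cmp g 50)
     (If (Reg 50) (Seq (cmp i 51) (Seq (cmp v 52) (Write (waddr j 51) (Reg 52)))) Skip)"

primrec pcmp :: "prog \<Rightarrow> com" where
  "pcmp (SetR x h) = Seq (cmp h 50) (Assign x (Reg 50))"
| "pcmp (Ph c j g i v) = ParFor 3 (Reg c) (phase_body j g i v)"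
| "pcmp (Sq p q) = Seq (pcmp p) (pcmp q)"
| "pcmp (Lp y z p) = Seq (Assign y (Const 0)) (While (Less (Reg y) (Reg z))
     (Seq (pcmp p) (Assign y (Add (Reg y) (Const 1)))))"

primrec pcost :: "prog \<Rightarrow> nat \<Rightarrow> nat" where
  "pcost (SetR x h) X = hcost h X + 2"
| "pcost (Ph c j g i v) X = hcost g X + hcost i X + hcost v X + 60"
| "pcost (Sq p q) X = pcost p X + pcost q X"
| "pcost (Lp y z p) X = X * (pcost p X + 8) + 6"

text \<open>Differs from \<open>addr\<close> only at array 0, which is the input for reading and the
  output for writing.\<close>

definition tgt :: "nat \<Rightarrow> nat \<Rightarrow> nat \<Rightarrow> nat \<Rightarrow> nat" where
  "tgt l b j i = (if j = 0 then l + i else b + (16 * i + j))"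

lemma phase_body_exec:
  fixes j :: nat
  assumes "wfx g" "wfx i" "wfx v" "S 1 = l" "S 2 = b" "S 0 \<le> X" "rep l b A M"
  defines "W \<equiv> hcost g X + hcost i X + hcost v X + 50" and "t \<equiv> tgt l b j (ev i S A)"
  shows "\<exists>S' Rd w d. exec (phase_body j g i v) S M S' (if ev g S A \<noteq> 0 then M(t := ev v S A) else M)
     Rd (if ev g S A \<noteq> 0 then {t} else {}) w d \<and> Rd \<subseteq> region l b (arrs g \<union> arrs i \<union> arrs v) \<and> w \<le> W \<and> d \<le> W"
proof -
  let ?S = "region l b (arrs g \<union> arrs i \<union> arrs v)"
  have sub: "region l b (arrs g) \<subseteq> ?S" "region l b (arrs i) \<subseteq> ?S" "region l b (arrs v) \<subseteq> ?S"
    by (auto simp: region_Un)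
  obtain S1 A1 w1 d1 where 1: "exec (cmp g 50) S M S1 M A1 {} w1 d1" "A1 \<subseteq> region l b (arrs g)"
    "w1 \<le> hcost g X" "d1 \<le> hcost g X" "S1 50 = ev g S A" "\<forall>x<50. S1 x = S x"
    using cmp_runs[OF assms(1) order.refl assms(4-7)] unfolding runs_def by blast
  have S1: "S1 1 = l" "S1 2 = b" "S1 0 \<le> X" using 1 assms by auto
  show ?thesis
  proof (cases "ev g S A \<noteq> 0")
    case False
    have v: "val (Reg 50) S1 M = 0" using False 1 by simp
    from exec.Seq[OF 1(1) exec.IfFalse[OF v exec.Skip], folded phase_body_def]
    have "exec (phase_body j g i v) S M S1 M (A1 \<union> (reads (Reg 50) S1 M \<union> {})) ({} \<union> {})
        (w1 + (cost (Reg 50) + 1 + 1)) (d1 + (cost (Reg 50) + 1 + 1))"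
      unfolding phase_body_def .
    moreover have "A1 \<union> (reads (Reg 50) S1 M \<union> {}) \<subseteq> ?S" using 1 sub by auto
    moreover have "w1 + (cost (Reg 50) + 1 + 1) \<le> W" "d1 + (cost (Reg 50) + 1 + 1) \<le> W"
      using 1 by (auto simp: W_def)
    ultimately show ?thesis using False by auto
  next
    case True
    obtain S2 A2 w2 d2 where 2: "exec (cmp i 51) S1 M S2 M A2 {} w2 d2" "A2 \<subseteq> region l b (arrs i)"
      "w2 \<le> hcost i X" "d2 \<le> hcost i X" "S2 51 = ev i S1 A" "\<forall>x<51. S2 x = S1 x"
      using cmp_runs[of i 51, OF assms(2) _ S1 assms(7)] unfolding runs_def by auto
    have S2: "S2 1 = l" "S2 2 = b" "S2 0 \<le> X" using 2 S1 by auto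
    obtain S3 A3 w3 d3 where 3: "exec (cmp v 52) S2 M S3 M A3 {} w3 d3" "A3 \<subseteq> region l b (arrs v)"
      "w3 \<le> hcost v X" "d3 \<le> hcost v X" "S3 52 = ev v S2 A" "\<forall>x<52. S3 x = S2 x"
      using cmp_runs[of v 52, OF assms(3) _ S2 assms(7)] unfolding runs_def by auto
    have e: "ev i S1 A = ev i S A" "ev v S2 A = ev v S A"
      using 1(6) 2(6) assms(2,3) by (auto intro!: ev_cong)
    have t: "val (waddr j 51) S3 M = t" "reads (waddr j 51) S3 M = {}" "cost (waddr j 51) \<le> 35"
      using S2 3 2 e by (auto simp: waddr_def tgt_def t_def val_slot)
    have v: "val (Reg 50) S1 M \<noteq> 0" using True 1 by simp
    have vv: "val (Reg 52) S3 M = ev v S A" using 3 e by simp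
    from exec.Seq[OF 1(1) exec.IfTrue[OF v exec.Seq[OF 2(1) exec.Seq[OF 3(1) exec.Write[of "waddr j 51" "Reg 52"]]]],
       of Skip, folded phase_body_def, unfolded t vv]
    have "\<exists>w d. exec (phase_body j g i v) S M S3 (M(t := ev v S A)) (A1 \<union> A2 \<union> A3) {t} w d \<and> w \<le> W \<and> d \<le> W"
      using 1 2 3 t(3) unfolding W_def by (auto simp: Un_assoc intro!: exI)
    moreover have "A1 \<union> A2 \<union> A3 \<subseteq> ?S" using 1 2 3 sub by auto
    ultimately show ?thesis using True by (simp, blast)
  qed
qed

text \<open>Distinct targets exclude conflicts between writes; targets outside the region of all
  three expressions exclude conflicts with reads. The summand 1 in the work pays for the header of
  the parallel loop.\<close>

lemma phase_exec:
  fixes c j :: nat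
  assumes wf: "wfx g" "wfx i" "wfx v" and R: "S 1 = l" "S 2 = b" "S 0 \<le> X" and M: "rep l b A M"
  defines "W \<equiv> hcost g X + hcost i X + hcost v X + 60"
    and "G \<equiv> {p. p < S c \<and> ev g (S(3 := p)) A \<noteq> 0}" and "t \<equiv> \<lambda>p. tgt l b j (ev i (S(3 := p)) A)"
  assumes inj: "inj_on t G" and dj: "t ` G \<inter> region l b (arrs g \<union> arrs i \<union> arrs v) = {}"
  shows "\<exists>M' Rd Wr w d. exec (ParFor 3 (Reg c) (phase_body j g i v)) S M S M' Rd Wr w d \<and>
    (\<forall>p\<in>G. M' (t p) = ev v (S(3 := p)) A) \<and> (\<forall>a. a \<notin> t ` G \<longrightarrow> M' a = M a) \<and> w \<le> W * (S c + 1) \<and> d \<le> W"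
proof -
  let ?M = "\<lambda>p. if p \<in> G then M(t p := ev v (S(3 := p)) A) else M" and ?B = "\<lambda>p. if p \<in> G then {t p} else {}"
  have "\<exists>S' Rd w d. exec (phase_body j g i v) (S(3 := p)) M S' (?M p) Rd (?B p) w d \<and>
      Rd \<subseteq> region l b (arrs g \<union> arrs i \<union> arrs v) \<and> w \<le> W - 10 \<and> d \<le> W - 10" if "p < S c" for p
  proof -
    have 3: "(S(3 := p)) 1 = l" "(S(3 := p)) 2 = b" "(S(3 := p)) 0 \<le> X" using R by auto
    have G: "p \<in> G \<longleftrightarrow> ev g (S(3 := p)) A \<noteq> 0" using that by (simp add: G_def)
    have W: "hcost g X + hcost i X + hcost v X + 50 = W - 10" by (simp add: W_def)
    show ?thesis using phase_body_exec[OF wf 3 M, of j] unfolding G W t_def .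
  qed
  then obtain S' Rd w d where *: "\<And>p. p < S c \<Longrightarrow> exec (phase_body j g i v) (S(3 := p)) M (S' p) (?M p) (Rd p) (?B p) (w p) (d p)"
     "\<And>p. p < S c \<Longrightarrow> Rd p \<subseteq> region l b (arrs g \<union> arrs i \<union> arrs v)" "\<And>p. p < S c \<Longrightarrow> w p \<le> W - 10"
     "\<And>p. p < S c \<Longrightarrow> d p \<le> W - 10"
    by metis
  \<comment> \<open>Since targets are distinct, the processor that wrote a cell can be recovered
    from the address.\<close>
  define M' where "M' a = (if a \<in> t ` G then ev v (S(3 := inv_into G t a)) A else M a)" for a
  have M't: "M' (t p) = ev v (S(3 := p)) A" if "p \<in> G" for p using that inj by (simp add: M'_def)
  have "exec (ParFor 3 (Reg c) (phase_body j g i v)) S M S M' (reads (Reg c) S M \<union> (\<Union>i<S c. Rd i)) (\<Union>i<S c. ?B i)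
      (cost (Reg c) + 1 + (\<Sum>i<S c. w i)) (cost (Reg c) + 1 + Max (insert 0 (d ` {..<S c})))"
  proof (rule exec.ParFor)
    show "\<forall>i'<S c. exec (phase_body j g i v) (S(3 := i')) M (S' i') (?M i') (Rd i') (?B i') (w i') (d i')"
      using * by blast
    show "\<forall>i<S c. \<forall>j<S c. i \<noteq> j \<longrightarrow> ?B i \<inter> (Rd j \<union> ?B j) = {}"
    proof (intro allI impI)
      fix p q assume pq: "p < S c" "q < S c" "p \<noteq> q"
      have "p \<in> G \<Longrightarrow> t p \<notin> Rd q" using *(2)[of q] pq dj by blast
      moreover have "p \<in> G \<Longrightarrow> q \<in> G \<Longrightarrow> t p \<noteq> t q" using inj pq by (auto dest: inj_onD)
      ultimately show "?B p \<inter> (Rd q \<union> ?B q) = {}" by auto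
    qed
    show "\<forall>i<S c. \<forall>a\<in>?B i. M' a = ?M i a" using M't by auto
    show "\<forall>a. a \<notin> (\<Union>i<S c. ?B i) \<longrightarrow> M' a = M a" by (auto simp: M'_def G_def)
  qed simp
  moreover have "Max (insert 0 (d ` {..<S c})) \<le> W - 10" using *(4) by auto
  then have "cost (Reg c) + 1 + Max (insert 0 (d ` {..<S c})) \<le> W" unfolding cost.simps W_def by linarith
  moreover have "(\<Sum>i<S c. w i) \<le> S c * (W - 10)" using sum_bounded_above[of "{..<S c}" w "W - 10"] *(3) by simp
  then have "cost (Reg c) + 1 + (\<Sum>i<S c. w i) \<le> W * (S c + 1)" by (simp add: W_def algebra_simps)
  moreover have "\<forall>a. a \<notin> t ` G \<longrightarrow> M' a = M a" by (simp add: M'_def)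
  ultimately show ?thesis using M't by blast
qed

section \<open>Weakest preconditions with costs\<close>

definition rst :: "store \<Rightarrow> arrays \<Rightarrow> store \<Rightarrow> store \<Rightarrow> bool" where
  "rst R A S M \<longleftrightarrow> (\<forall>x<50. S x = R x) \<and> rep (R 1) (R 2) A M \<and> (\<forall>a. R 1 < a \<and> a \<le> R 2 \<longrightarrow> M a = 0)"

text \<open>Hides the concrete memory behind abstract arrays and builds in the cost bound;
  \<open>N\<close> bounds the processors of a phase and enters the work only. The clause of
  \<open>rst\<close> on the cells above \<open>R 1\<close> keeps the output blank until the labels
  are written.\<close>

definition wp :: "nat \<Rightarrow> prog \<Rightarrow> (store \<Rightarrow> arrays \<Rightarrow> bool) \<Rightarrow> store \<Rightarrow> arrays \<Rightarrow> bool" where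
  "wp N p Q R A \<longleftrightarrow> (\<forall>S M. rst R A S M \<longrightarrow> (\<exists>S' M' Rd Wr w d R' A'. exec (pcmp p) S M S' M' Rd Wr w d \<and>
     rst R' A' S' M' \<and> R' 0 = R 0 \<and> R' 1 = R 1 \<and> R' 2 = R 2 \<and> Q R' A' \<and>
     w \<le> pcost p (R 0) * (N + 1) \<and> d \<le> pcost p (R 0)))"

lemma wp_Sq:
  assumes "wp N p (wp N q Q) R A" shows "wp N (Sq p q) Q R A"
  unfolding wp_def
proof (intro allI impI)
  fix S M assume "rst R A S M"
  then obtain S' M' Rd Wr w d R' A' where 1: "exec (pcmp p) S M S' M' Rd Wr w d" "rst R' A' S' M'"
    "R' 0 = R 0" "R' 1 = R 1" "R' 2 = R 2" "wp N q Q R' A'" "w \<le> pcost p (R 0) * (N + 1)" "d \<le> pcost p (R 0)"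
    using assms unfolding wp_def[of N p] by blast
  then obtain S2 M2 Rd2 Wr2 w2 d2 R2 A2 where 2: "exec (pcmp q) S' M' S2 M2 Rd2 Wr2 w2 d2" "rst R2 A2 S2 M2"
    "R2 0 = R 0" "R2 1 = R 1" "R2 2 = R 2" "Q R2 A2" "w2 \<le> pcost q (R 0) * (N + 1)" "d2 \<le> pcost q (R 0)"
    unfolding wp_def[of N q] by metis
  have "w + w2 \<le> pcost (Sq p q) (R 0) * (N + 1)" "d + d2 \<le> pcost (Sq p q) (R 0)"
    using 1 2 by (auto simp: algebra_simps)
  with exec.Seq[OF 1(1) 2(1), folded pcmp.simps] 2
  show "\<exists>S' M' Rd Wr w d R' A'. exec (pcmp (Sq p q)) S M S' M' Rd Wr w d \<and>
     rst R' A' S' M' \<and> R' 0 = R 0 \<and> R' 1 = R 1 \<and> R' 2 = R 2 \<and> Q R' A' \<and>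
     w \<le> pcost (Sq p q) (R 0) * (N + 1) \<and> d \<le> pcost (Sq p q) (R 0)" by blast
qed

lemma wp_SetR:
  assumes wf: "wfx h" and x: "3 \<le> x" "x < 50" and Q: "Q (R(x := ev h R A)) A" shows "wp N (SetR x h) Q R A"
  unfolding wp_def
proof (intro allI impI)
  fix S M assume st: "rst R A S M"
  have e: "ev h S A = ev h R A" using st wf by (auto simp: rst_def intro!: ev_cong)
  have S: "S 1 = R 1" "S 2 = R 2" "S 0 \<le> R 0" "rep (R 1) (R 2) A M" using st by (auto simp: rst_def)
  obtain S1 A1 w1 d1 where 1: "exec (cmp h 50) S M S1 M A1 {} w1 d1" "A1 \<subseteq> region (R 1) (R 2) (arrs h)"
    "w1 \<le> hcost h (R 0)" "d1 \<le> hcost h (R 0)" "S1 50 = ev h R A" "\<forall>x<50. S1 x = S x"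
    using cmp_runs[OF wf order.refl S] unfolding runs_def e by blast
  have "exec (pcmp (SetR x h)) S M (S1(x := ev h R A)) M (A1 \<union> reads (Reg 50) S1 M) ({} \<union> {}) (w1 + 2) (d1 + 2)"
    using exec.Seq[OF 1(1) exec.Assign[of x "Reg 50"]] 1 by simp
  moreover have "rst (R(x := ev h R A)) A (S1(x := ev h R A)) M" using 1 st x by (auto simp: rst_def)
  moreover have "w1 + 2 \<le> pcost (SetR x h) (R 0) * (N + 1)" "d1 + 2 \<le> pcost (SetR x h) (R 0)" using 1 by auto
  moreover have "(R(x := ev h R A)) 0 = R 0" "(R(x := ev h R A)) 1 = R 1" "(R(x := ev h R A)) 2 = R 2"
    using x by auto
  ultimately show "\<exists>S' M' Rd Wr w d R' A'. exec (pcmp (SetR x h)) S M S' M' Rd Wr w d \<and>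
     rst R' A' S' M' \<and> R' 0 = R 0 \<and> R' 1 = R 1 \<and> R' 2 = R 2 \<and> Q R' A' \<and>
     w \<le> pcost (SetR x h) (R 0) * (N + 1) \<and> d \<le> pcost (SetR x h) (R 0)" using Q by blast
qed

lemma wp_Lp:
  assumes I0: "I 0 (R(y := 0)) A"
    and step: "\<And>i R A. i < n \<Longrightarrow> I i R A \<Longrightarrow> R y = i \<Longrightarrow> wp N p (\<lambda>R A. R y = i \<and> I (Suc i) (R(y := Suc i)) A) R A"
    and z: "\<And>i R A. i \<le> n \<Longrightarrow> I i R A \<Longrightarrow> R z = n" and n: "n \<le> R 0" and yz: "3 \<le> y" "y < 50" "z < 50" "z \<noteq> y"
    and Q: "\<And>R A. I n R A \<Longrightarrow> R y = n \<Longrightarrow> Q R A"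
  shows "wp N (Lp y z p) Q R A"
  unfolding wp_def
proof (intro allI impI)
  fix S M assume st: "rst R A S M"
  let ?S = "S(y := 0)" let ?W = "pcost p (R 0) * (N + 1) + 4" let ?D = "pcost p (R 0) + 4"
  let ?e = "Less (Reg y) (Reg z)" and ?b = "Seq (pcmp p) (Assign y (Add (Reg y) (Const 1)))"
  define J where "J i S M \<longleftrightarrow> (\<exists>R' A'. rst R' A' S M \<and> I i R' A' \<and> R' y = i \<and> R' 0 = R 0 \<and> R' 1 = R 1 \<and> R' 2 = R 2)" for i S M
  have "rst (R(y := 0)) A ?S M" using st yz by (auto simp: rst_def)
  then have J0: "J 0 ?S M" unfolding J_def using I0 yz by (intro exI[of _ "R(y := 0)"] exI[of _ A] conjI) auto
  have "\<exists>S' M' Rd Wr w d. exec (While ?e ?b) ?S M S' M' Rd Wr w d \<and> J n S' M' \<and> Rd \<subseteq> UNIV \<and> Wr \<subseteq> UNIV \<and>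
      w \<le> (n - 0) * (?W + cost ?e + 1) + cost ?e + 1 \<and> d \<le> (n - 0) * (?D + cost ?e + 1) + cost ?e + 1"
  proof (rule exec_While_invariant[where I = J and c = ?b], simp, rule J0, goal_cases)
    case (1 i S M)
    then obtain R1 A1 where r: "rst R1 A1 S M" "I i R1 A1" "R1 y = i" "R1 0 = R 0" "R1 1 = R 1" "R1 2 = R 2"
      unfolding J_def by blast
    from step[OF 1(1) r(2,3)] r(1) obtain S' M' Rd Wr w d R' A' where 2: "exec (pcmp p) S M S' M' Rd Wr w d"
      "rst R' A' S' M'" "R' 0 = R 0" "R' 1 = R 1" "R' 2 = R 2" "R' y = i" "I (Suc i) (R'(y := Suc i)) A'"
      "w \<le> pcost p (R 0) * (N + 1)" "d \<le> pcost p (R 0)"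
      unfolding wp_def r(4-6) by blast
    have "S' y = i" using 2 yz by (auto simp: rst_def)
    then have "exec ?b S M (S'(y := Suc i)) M' (Rd \<union> {}) (Wr \<union> {}) (w + 4) (d + 4)"
      using exec.Seq[OF 2(1) exec.Assign[of y "Add (Reg y) (Const 1)"]]
      by (simp add: eval_nat_numeral)
    moreover have "rst (R'(y := Suc i)) A' (S'(y := Suc i)) M'" using 2(2) yz by (auto simp: rst_def)
    then have "J (Suc i) (S'(y := Suc i)) M'"
      unfolding J_def using 2 yz by (intro exI[of _ "R'(y := Suc i)"] exI[of _ A'] conjI) auto
    ultimately show ?case using 2(8,9)
      by (meson add_le_mono order_refl top_greatest)
  next
    case (2 i S M)
    then obtain R1 A1 where r: "rst R1 A1 S M" "I i R1 A1" "R1 y = i" unfolding J_def by blast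
    have "S y = i" "S z = n" using r z[OF 2(1) r(2)] yz by (auto simp: rst_def)
    then show ?case by auto
  qed
  then obtain S' M' Rd Wr w d where 3: "exec (While ?e ?b) ?S M S' M' Rd Wr w d" "J n S' M'"
    "w \<le> n * (?W + 4) + 4" "d \<le> n * (?D + 4) + 4" by auto
  have "n * (?W + 4) + 6 \<le> R 0 * (?W + 4) + 6" using n by simp
  also have "\<dots> \<le> (R 0 * (?D + 4) + 6) * (N + 1)" by (simp add: algebra_simps)
  finally have w: "2 + w \<le> pcost (Lp y z p) (R 0) * (N + 1)" using 3(3) by (simp add: algebra_simps)
  have "n * (?D + 4) + 6 \<le> R 0 * (?D + 4) + 6" using n by simp
  then have d: "2 + d \<le> pcost (Lp y z p) (R 0)" using 3(4) by (simp add: algebra_simps)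
  have "exec (pcmp (Lp y z p)) S M S' M' ({} \<union> Rd) ({} \<union> Wr) (2 + w) (2 + d)"
    using exec.Seq[OF exec.Assign[of y "Const 0"] ] 3(1) by fastforce
  moreover from 3(2) obtain R' A' where "rst R' A' S' M'" "I n R' A'" "R' y = n" "R' 0 = R 0" "R' 1 = R 1" "R' 2 = R 2"
    unfolding J_def by blast
  ultimately show "\<exists>S' M' Rd Wr w d R' A'. exec (pcmp (Lp y z p)) S M S' M' Rd Wr w d \<and>
     rst R' A' S' M' \<and> R' 0 = R 0 \<and> R' 1 = R 1 \<and> R' 2 = R 2 \<and> Q R' A' \<and>
     w \<le> pcost (Lp y z p) (R 0) * (N + 1) \<and> d \<le> pcost (Lp y z p) (R 0)" using Q w d by blast
qed

text \<open>Working cells lie above \<open>b\<close>, their offsets separated by residues modulo 16,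
  while input reads stay at or below \<open>l\<close>.\<close>

lemma tgt_notin_region:
  assumes "0 < j" "j < 16" "l \<le> b" "j \<notin> J" "J \<subseteq> {..<16}" shows "tgt l b j i \<notin> region l b J"
proof
  assume "tgt l b j i \<in> region l b J"
  then obtain j' i' where "j' \<in> J" "tgt l b j i = addr l b j' i'" unfolding region_def by blast
  moreover have "j' < 16" "j' \<noteq> j" using \<open>j' \<in> J\<close> assms by auto
  moreover have "min i' l \<le> b" using assms(3) by simp
  moreover have "j' \<noteq> 0 \<Longrightarrow> 16 * i + j = 16 * i' + j'" using calculation(2) assms(1) by (simp add: tgt_def addr_def)
  moreover have "j' = 0 \<Longrightarrow> b + (16 * i + j) = min i' l" using calculation(2) assms(1) by (simp add: tgt_def addr_def)
  moreover have "j < 16" "0 < j" using assms by auto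
  moreover have "(16 * i + j) mod 16 = j" "(16 * i' + j') mod 16 = j'"
    using assms(2,5) \<open>j' \<in> J\<close> by auto
  ultimately show False by (cases "j' = 0") (linarith, metis)
qed

lemma arrs_bound: "wfx h \<Longrightarrow> arrs h \<subseteq> {..<16}"
  by (induction h) auto

lemma wp_Ph:
  assumes wf: "wfx g" "wfx i" "wfx v" and j: "0 < j" "j < 16" "j \<notin> arrs g \<union> arrs i \<union> arrs v" and c: "R c \<le> N" "c < 50"
    and b: "R 1 \<le> R 2"
    and inj: "inj_on (\<lambda>p. ev i (R(3 := p)) A) {p. p < R c \<and> ev g (R(3 := p)) A \<noteq> 0}"
    and Q: "\<And>f. (\<forall>p<R c. ev g (R(3 := p)) A \<noteq> 0 \<longrightarrow> f (ev i (R(3 := p)) A) = ev v (R(3 := p)) A) \<Longrightarrow>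
       (\<forall>a. (\<forall>p<R c. ev g (R(3 := p)) A \<noteq> 0 \<longrightarrow> ev i (R(3 := p)) A \<noteq> a) \<longrightarrow> f a = A j a) \<Longrightarrow> Q R (A(j := f))"
  shows "wp N (Ph c j g i v) Q R A"
  unfolding wp_def
proof (intro allI impI)
  fix S M assume st: "rst R A S M"
  let ?l = "R 1" and ?b = "R 2"
  have S: "S 1 = R 1" "S 2 = R 2" "S 0 \<le> R 0" "rep (R 1) (R 2) A M" "S c = R c" using st c by (auto simp: rst_def)
  have ag: "\<And>p x. x < 50 \<Longrightarrow> (S(3 := p)) x = (R(3 := p)) x" using st by (auto simp: rst_def)
  have e: "ev h (S(3 := p)) A = ev h (R(3 := p)) A" if "wfx h" for h p using ev_cong[OF that ag] .
  let ?G = "{p. p < R c \<and> ev g (R(3 := p)) A \<noteq> 0}" let ?t = "\<lambda>p. tgt ?l ?b j (ev i (R(3 := p)) A)"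
  have i: "inj_on ?t ?G" using inj j by (auto simp: inj_on_def tgt_def)
  have d: "?t ` ?G \<inter> region ?l ?b (arrs g \<union> arrs i \<union> arrs v) = {}"
    using tgt_notin_region[OF j(1,2) b j(3)] arrs_bound wf by auto
  note ex = phase_exec[OF wf S(1-4), of j c, unfolded e[OF wf(1)] e[OF wf(2)] e[OF wf(3)] S(5), OF i d]
  obtain M' Rd Wr w d where 1: "exec (ParFor 3 (Reg c) (phase_body j g i v)) S M S M' Rd Wr w d"
    "\<forall>p\<in>?G. M' (?t p) = ev v (R(3 := p)) A" "\<forall>a. a \<notin> ?t ` ?G \<longrightarrow> M' a = M a"
    "w \<le> pcost (Ph c j g i v) (R 0) * (R c + 1)" "d \<le> pcost (Ph c j g i v) (R 0)"
    using ex unfolding pcost.simps by blast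
  define f where "f a = M' (addr ?l ?b j a)" for a
  have ta: "tgt ?l ?b j a = addr ?l ?b j a" for a using j by (simp add: tgt_def addr_def)
  have M: "M (addr ?l ?b j' a) = A j' a" if "j' < 16" for j' a using S that by (simp add: rep_def)
  have nt: "addr ?l ?b j' a \<notin> range (\<lambda>p. ?t p)" if "j' \<noteq> j" "j' < 16" for a j'
  proof -
    have "addr ?l ?b j' a \<in> region ?l ?b {j'}" by (auto simp: region_def)
    moreover have "?t p \<notin> region ?l ?b {j'}" for p using that by (intro tgt_notin_region[OF j(1,2) b]) auto
    ultimately show ?thesis by (intro notI, elim rangeE) simp
  qed
  have "rep ?l ?b (A(j := f)) M'" unfolding rep_def
  proof (intro allI impI)
    fix j' a assume j': "j' < (16::nat)"
    show "M' (addr ?l ?b j' a) = (A(j := f)) j' a"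
    proof (cases "j' = j")
      case False
      then have "addr ?l ?b j' a \<notin> ?t ` ?G" using nt[OF False j', of a] by blast
      then show ?thesis using 1(3) M[OF j', of a] False by simp
    qed (simp add: f_def)
  qed
  moreover have "\<forall>a. ?l < a \<and> a \<le> ?b \<longrightarrow> M' a = 0"
  proof (intro allI impI)
    fix a assume a: "?l < a \<and> a \<le> ?b"
    then have "a \<notin> ?t ` ?G" using j by (auto simp: tgt_def)
    then show "M' a = 0" using 1(3) st a by (auto simp: rst_def)
  qed
  ultimately have "rst R (A(j := f)) S M'" using st by (auto simp: rst_def)
  moreover have "Q R (A(j := f))"
  proof (rule Q)
    show "\<forall>p<R c. ev g (R(3 := p)) A \<noteq> 0 \<longrightarrow> f (ev i (R(3 := p)) A) = ev v (R(3 := p)) A"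
      using 1(2) unfolding f_def ta[symmetric] by blast
    show "\<forall>a. (\<forall>p<R c. ev g (R(3 := p)) A \<noteq> 0 \<longrightarrow> ev i (R(3 := p)) A \<noteq> a) \<longrightarrow> f a = A j a"
    proof (intro allI impI)
      fix a assume "\<forall>p<R c. ev g (R(3 := p)) A \<noteq> 0 \<longrightarrow> ev i (R(3 := p)) A \<noteq> a"
      then have "addr ?l ?b j a \<notin> ?t ` ?G" using j by (auto simp: tgt_def addr_def)
      then show "f a = A j a" using 1(3) M[OF j(2)] by (auto simp: f_def)
    qed
  qed
  moreover have "pcost (Ph c j g i v) (R 0) * (R c + 1) \<le> pcost (Ph c j g i v) (R 0) * (N + 1)"
    using c by (intro mult_left_mono) auto
  then have "w \<le> pcost (Ph c j g i v) (R 0) * (N + 1)" using 1(4) by linarith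
  ultimately show "\<exists>S' M' Rd Wr w d R' A'. exec (pcmp (Ph c j g i v)) S M S' M' Rd Wr w d \<and>
     rst R' A' S' M' \<and> R' 0 = R 0 \<and> R' 1 = R 1 \<and> R' 2 = R 2 \<and> Q R' A' \<and>
     w \<le> pcost (Ph c j g i v) (R 0) * (N + 1) \<and> d \<le> pcost (Ph c j g i v) (R 0)"
    using 1(1,5) unfolding pcmp.simps by blast
qed

definition Par :: "nat \<Rightarrow> nat \<Rightarrow> hx \<Rightarrow> prog" where
  "Par c j v = Ph c j (Cn 1) (V 3) v"

lemma wp_Par:
  assumes "wfx v" "0 < j" "j < 16" "j \<notin> arrs v" "R c \<le> N" "c < 50" "R 1 \<le> R 2"
    and Q: "Q R (A(j := \<lambda>p. if p < R c then ev v (R(3 := p)) A else A j p))"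
  shows "wp N (Par c j v) Q R A"
  unfolding Par_def
proof (rule wp_Ph)
  fix f assume f: "\<forall>p<R c. ev (Cn 1) (R(3 := p)) A \<noteq> 0 \<longrightarrow> f (ev (V 3) (R(3 := p)) A) = ev v (R(3 := p)) A"
    "\<forall>a. (\<forall>p<R c. ev (Cn 1) (R(3 := p)) A \<noteq> 0 \<longrightarrow> ev (V 3) (R(3 := p)) A \<noteq> a) \<longrightarrow> f a = A j a"
  have "f = (\<lambda>p. if p < R c then ev v (R(3 := p)) A else A j p)" using f by (auto simp: fun_eq_iff)
  then show "Q R (A(j := f))" using Q by simp
qed (use assms in \<open>auto simp: inj_on_def\<close>)

section \<open>Polynomial cost bounds\<close>

definition polyb :: "(nat \<Rightarrow> nat) \<Rightarrow> bool" where
  "polyb f \<longleftrightarrow> (\<exists>K k. \<forall>X\<ge>1. f X \<le> K * X ^ k)"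

lemma polynomial_add:
  assumes "polyb f" "polyb g"
  shows "polyb (\<lambda>X. f X + g X)"
proof -
  obtain K k K' k' where *: "\<And>X. X \<ge> 1 \<Longrightarrow> f X \<le> K * X ^ k" "\<And>X. X \<ge> 1 \<Longrightarrow> g X \<le> K' * X ^ k'"
    using assms unfolding polyb_def by blast
  have "f X + g X \<le> (K + K') * X ^ (k + k')" if "X \<ge> 1" for X
  proof -
    have "X ^ k \<le> X ^ (k + k')" "X ^ k' \<le> X ^ (k + k')" using that by (auto intro: power_increasing)
    then have "K * X ^ k \<le> K * X ^ (k + k')" "K' * X ^ k' \<le> K' * X ^ (k + k')" by (auto intro: mult_left_mono)
    then show ?thesis using *[OF that] unfolding add_mult_distrib by linarith
  qed
  then show ?thesis unfolding polyb_def by blast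
qed

lemma polynomial_const: "polyb (\<lambda>X. c)"
  unfolding polyb_def by (intro exI[of _ c] exI[of _ 0]) simp

lemma polynomial_times:
  assumes "polyb f"
  shows "polyb (\<lambda>X. X * f X)"
proof -
  obtain K k where "\<And>X. X \<ge> 1 \<Longrightarrow> f X \<le> K * X ^ k" using assms unfolding polyb_def by blast
  then have "X * f X \<le> K * X ^ Suc k" if "X \<ge> 1" for X
    using mult_left_mono[of "f X" "K * X ^ k" X] that by (simp add: mult.left_commute)
  then show ?thesis unfolding polyb_def by blast
qed

text \<open>Only loops contribute a factor \<open>X\<close>, so the nesting depth bounds the
  degree.\<close>

lemma hcost_polynomial: "polyb (hcost h)"
  by (induction h; simp only: hcost.simps[abs_def]; intro polynomial_add polynomial_times polynomial_const; assumption)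

lemma pcost_polynomial: "polyb (pcost p)"
  by (induction p; simp only: pcost.simps[abs_def];
      intro polynomial_add polynomial_times polynomial_const hcost_polynomial; assumption?)

section \<open>Conditional expectations and the balance of a window\<close>

text \<open>The conditional mean of the square of \<open>\<Sum>x\<close> once the bits below
  \<open>j\<close> are fixed: signs whose identifiers agree from bit \<open>j\<close> on share the
  same undetermined factor, and every other product of two signs has mean 0.\<close>

definition grp :: "nat \<Rightarrow> (nat \<Rightarrow> nat) \<Rightarrow> (nat \<Rightarrow> int) \<Rightarrow> nat set \<Rightarrow> int" where
  "grp j ident x I = (\<Sum>u\<in>I. \<Sum>v\<in>I. if ident u div 2 ^ j = ident v div 2 ^ j then x u * x v else 0)"

definition flip :: "nat \<Rightarrow> (nat \<Rightarrow> nat) \<Rightarrow> (nat \<Rightarrow> int) \<Rightarrow> nat \<Rightarrow> int" where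
  "flip j ident x u = (if odd (ident u div 2 ^ j) then - x u else x u)"

text \<open>If two identifiers agree above bit \<open>j\<close>, flipping keeps the product when
  they also agree in bit \<open>j\<close> and negates it otherwise, so the latter pairs
  cancel.\<close>

lemma grp_flip: "grp (Suc j) ident x I + grp (Suc j) ident (flip j ident x) I = 2 * grp j ident x I"
proof -
  have h: "a div 2 ^ j = b div 2 ^ j \<longleftrightarrow> a div 2 ^ Suc j = b div 2 ^ Suc j \<and> (odd (a div 2 ^ j) \<longleftrightarrow> odd (b div 2 ^ j))" for a b :: nat
  proof -
    have q: "c div 2 ^ Suc j = c div 2 ^ j div 2" for c :: nat by (simp only: power_Suc2 div_mult2_eq)
    have "(x = y) \<longleftrightarrow> (x div 2 = y div 2 \<and> (odd x \<longleftrightarrow> odd y))" for x y :: nat by presburger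
    then show ?thesis unfolding q .
  qed
  show ?thesis
    unfolding grp_def sum_distrib_left sum.distrib[symmetric]
    by (intro sum.cong refl) (subst h, auto simp: flip_def simp del: power_Suc)
qed

text \<open>Pairwise independence: when no bit is fixed, distinct identifiers leave only the
  diagonal.\<close>

lemma grp_0: "finite I \<Longrightarrow> inj_on ident I \<Longrightarrow> grp 0 ident x I = (\<Sum>u\<in>I. (x u)\<^sup>2)"
proof -
  assume I: "finite I" "inj_on ident I"
  have "(\<Sum>v\<in>I. if ident u div 2 ^ 0 = ident v div 2 ^ 0 then x u * x v else 0) = (x u)\<^sup>2" if "u \<in> I" for u
  proof -
    have "(\<Sum>v\<in>I. if ident u div 2 ^ 0 = ident v div 2 ^ 0 then x u * x v else 0) = (\<Sum>v\<in>I. if u = v then x u * x v else 0)"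
      using I that by (intro sum.cong) (auto dest: inj_onD)
    then show ?thesis using I that by (simp add: power2_eq_square)
  qed
  then show ?thesis unfolding grp_def by simp
qed

lemma grp_top:
  assumes "\<And>u v. u \<in> I \<Longrightarrow> v \<in> I \<Longrightarrow> ident u div 2 ^ j = ident v div 2 ^ j"
  shows "grp j ident x I = (\<Sum>u\<in>I. x u)\<^sup>2"
  unfolding grp_def power2_eq_square sum_product by (intro sum.cong refl if_P assms)

lemma abs_grp_le: "finite I \<Longrightarrow> (\<And>u. u \<in> I \<Longrightarrow> \<bar>x u\<bar> \<le> B) \<Longrightarrow> \<bar>grp j ident x I\<bar> \<le> (int (card I) * B)\<^sup>2"
proof -
  assume I: "finite I" "\<And>u. u \<in> I \<Longrightarrow> \<bar>x u\<bar> \<le> B"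
  have "\<bar>grp j ident x I\<bar> \<le> (\<Sum>u\<in>I. \<bar>\<Sum>v\<in>I. if ident u div 2 ^ j = ident v div 2 ^ j then x u * x v else 0\<bar>)"
    unfolding grp_def by (rule sum_abs)
  also have "\<dots> \<le> (\<Sum>u\<in>I. \<Sum>v\<in>I. \<bar>if ident u div 2 ^ j = ident v div 2 ^ j then x u * x v else 0\<bar>)"
    by (intro sum_mono sum_abs)
  also have "\<dots> \<le> (\<Sum>u\<in>I. \<Sum>v\<in>I. B * B)"
  proof (intro sum_mono)
    fix u v assume "u \<in> I" "v \<in> I"
    then have "\<bar>x u\<bar> * \<bar>x v\<bar> \<le> B * B" "0 \<le> B * B" using I(2)[of u] I(2)[of v] by (auto intro!: mult_mono)
    then show "\<bar>if ident u div 2 ^ j = ident v div 2 ^ j then x u * x v else 0\<bar> \<le> B * B" by (simp add: abs_mult)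
  qed
  also have "\<dots> = (int (card I) * B)\<^sup>2" by (simp add: power2_eq_square algebra_simps)
  finally show ?thesis .
qed

text \<open>The conditional mean of \<open>g^2 (1 + z + z^2)\<close> for
  \<open>z = e \<Sum>x / g\<close> and \<open>e\<close> a sign. The linear term has mean 0 until all
  \<open>X\<close> bits are fixed, because the top bit, set in every identifier, is decided
  last.\<close>

definition CF :: "nat \<Rightarrow> nat \<Rightarrow> nat \<Rightarrow> (nat \<Rightarrow> nat) \<Rightarrow> nat \<Rightarrow> int \<Rightarrow> (nat \<Rightarrow> int) \<Rightarrow> nat \<Rightarrow> int" where
  "CF X g L ident j e x p = (int g)\<^sup>2 + (if j = X then e * (int g * (\<Sum>u\<in>{p..<p+L}. x u)) else 0) + grp j ident x {p..<p+L}"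

text \<open>At the top bit all signs flip together, which cancels the two linear terms.\<close>

lemma CF_flip:
  assumes "j < X" "\<And>u. u \<in> {p..<p+L} \<Longrightarrow> odd (ident u div 2 ^ (X - 1))"
  shows "CF X g L ident (Suc j) e x p + CF X g L ident (Suc j) e (flip j ident x) p = 2 * CF X g L ident j e x p"
proof -
  have "(\<Sum>u\<in>{p..<p+L}. flip j ident x u) = - (\<Sum>u\<in>{p..<p+L}. x u)" if "Suc j = X"
    using assms(2) that by (auto simp: flip_def sum_negf[symmetric] intro!: sum.cong)
  then show ?thesis using grp_flip[of j ident x "{p..<p+L}"] assms(1) by (auto simp: CF_def)
qed

text \<open>
  The absolute value of the coefficient \<open>2 y \<plusminus> 8 H\<close> of the sign in the increment of the martingale, where
  \<open>y\<close> here counts from the left end, so that the centre is \<open>H\<close>; for \<open>k = 1\<close> the coefficient is negative.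
\<close>

definition mag :: "nat \<Rightarrow> nat \<Rightarrow> nat \<Rightarrow> nat" where
  "mag H k y = (if y = 0 \<or> y = 2 * H then 0 else if k = 0 then 2 * y + 6 * H else 10 * H - 2 * y)"

definition ksg :: "nat \<Rightarrow> int" where "ksg k = (if k = 0 then 1 else - 1)"

lemma mag_le: "y \<le> 2 * H \<Longrightarrow> mag H k y \<le> 10 * H"
  by (auto simp: mag_def)

lemma exp_le_quadratic: "\<bar>x\<bar> \<le> 1 \<Longrightarrow> exp x \<le> 1 + x + x\<^sup>2" for x :: real
proof (cases "x \<ge> 0")
  case False
  assume "\<bar>x\<bar> \<le> 1"
  have "1 - x \<le> exp (- x)" using exp_ge_add_one_self[of "-x"] by simp
  then have "exp x \<le> 1 / (1 - x)" using False by (simp add: exp_minus field_simps)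
  also have "\<dots> \<le> 1 + x + x\<^sup>2"
  proof -
    \<comment> \<open>The product equals \<open>1 - x^3\<close>, and \<open>x\<close> is
      negative.\<close>
    have "1 \<le> (1 + x + x\<^sup>2) * (1 - x)"
      using False mult_nonneg_nonpos[of "x\<^sup>2" x] by (simp add: algebra_simps power2_eq_square)
    then show ?thesis using False by (simp add: field_simps)
  qed
  finally show ?thesis .
qed (use exp_bound[of x] in auto)

text \<open>A lower bound for \<open>g\<close> times the logarithm of the normalised weight of a window; \<open>\<tau> u\<close> is the number of
  steps the position \<open>u\<close> has been active.\<close>

definition energy :: "nat \<Rightarrow> nat \<Rightarrow> (nat \<Rightarrow> nat) \<Rightarrow> (nat \<Rightarrow> nat) \<Rightarrow> nat set \<Rightarrow> real" where
  "energy H k \<tau> Y I = (\<Sum>u\<in>I. real (\<tau> u) - (real (Y u) - real H)\<^sup>2 - of_int (ksg k) * (8 * real H) * (real (Y u) - real H))"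

text \<open>Sign 1 moves to the left; this makes the increment of \<open>energy\<close> the sign
  times \<open>2 (y - H) + 8 H ksg k\<close> rather than its negative.\<close>

definition walk :: "nat \<Rightarrow> nat \<Rightarrow> int \<Rightarrow> nat" where
  "walk H y s = (if y = 0 \<or> y = 2 * H then y else if s = 1 then y - 1 else y + 1)"

lemma walk_le: "y \<le> 2 * H \<Longrightarrow> walk H y s \<le> 2 * H"
  by (auto simp: walk_def)

text \<open>The step added to \<open>\<tau>\<close> cancels the constant \<open>s^2 = 1\<close> in
  the change of the squared displacement, leaving an increment linear in the signs. Absorbed
  positions contribute nothing.\<close>

lemma energy_walk:
  assumes "\<And>u. u \<in> I \<Longrightarrow> Y u \<le> 2 * H" "\<And>u. u \<in> I \<Longrightarrow> s u = 1 \<or> s u = - 1"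
  shows "energy H k (\<lambda>u. if Y u = 0 \<or> Y u = 2 * H then \<tau> u else Suc (\<tau> u)) (\<lambda>u. walk H (Y u) (s u)) I =
    energy H k \<tau> Y I + of_int (ksg k * (\<Sum>u\<in>I. int (mag H k (Y u)) * s u))"
  unfolding energy_def sum_distrib_left of_int_sum sum.distrib[symmetric]
proof (intro sum.cong refl, goal_cases)
  case (1 u)
  show ?case
  proof (cases "Y u = 0 \<or> Y u = 2 * H")
    case False
    have Y: "1 \<le> Y u" "Y u \<le> 2 * H" using False assms(1)[OF 1] by auto
    have m: "real_of_int (ksg k) * real (mag H k (Y u)) = 2 * (real (Y u) - real H) + of_int (ksg k) * (8 * real H)"
      using False Y by (auto simp: mag_def ksg_def of_nat_diff)
    have w: "real (walk H (Y u) (s u)) = real (Y u) - of_int (s u)"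
      using False assms(2)[OF 1] Y by (auto simp: walk_def of_nat_diff)
    have s: "(real_of_int (s u))\<^sup>2 = 1" using assms(2)[OF 1] by auto
    have eq: "real_of_int (ksg k * (int (mag H k (Y u)) * s u)) =
        (2 * (real (Y u) - real H) + of_int (ksg k) * (8 * real H)) * of_int (s u)"
      unfolding m[symmetric] by simp
    show ?thesis unfolding eq w using False s by (simp add: power2_eq_square algebra_simps)
  qed (auto simp: mag_def walk_def)
qed

text \<open>Adding the energy bounds for the two values of \<open>k\<close> cancels the drift and
  limits the number of unabsorbed elements; each bound alone then limits the drift on one
  side.\<close>

lemma window_balanced:
  fixes L T g :: nat and N :: real
  assumes L: "0 < L" "g = 3200 * L\<^sup>2" "T = 16 * L\<^sup>2" and N: "1 \<le> N" "6400 * ln (2 * N) \<le> L"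
    and I: "finite I" "card I = L"
    and Y: "\<And>u. u \<in> I \<Longrightarrow> Y u \<le> 2 * L" and \<tau>: "\<And>u. u \<in> I \<Longrightarrow> Y u \<noteq> 0 \<Longrightarrow> Y u \<noteq> 2 * L \<Longrightarrow> \<tau> u = T"
    and W: "\<And>k. k < 2 \<Longrightarrow> real g ^ (2 * T) * exp (energy L k \<tau> Y I / g) \<le> 2 * N * (real g ^ 2 + 100 * real L ^ 3) ^ T"
  shows "L \<le> 4 * card {u \<in> I. Y u = 2 * L}" "L \<le> 4 * card {u \<in> I. Y u = 0}"
proof -
  define l where "l = real L"
  have l: "l > 0" "l \<ge> 1" using L by (auto simp: l_def)
  have g: "real g = 3200 * l\<^sup>2" "real g > 0" using L by (auto simp: l_def)
  have T: "real T = 16 * l\<^sup>2" using L by (simp add: l_def)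
  \<comment> \<open>After division by \<open>g^(2 T)\<close> the logarithm is at most
    \<open>ln (2 N) + 100 T l^3 / g^2\<close>. Each summand is at most \<open>l / 6400\<close>, and
    \<open>g l / 3200 = l^3\<close>.\<close>
  have E: "energy L k \<tau> Y I \<le> l ^ 3" if "k < 2" for k
  proof -
    have "(real g ^ 2 + 100 * real L ^ 3) = real g ^ 2 * (1 + 100 * l ^ 3 / real g ^ 2)" using g by (simp add: field_simps l_def)
    also have "\<dots> ^ T = real g ^ (2 * T) * (1 + 100 * l ^ 3 / real g ^ 2) ^ T" by (simp add: power_mult_distrib power_mult)
    also have "\<dots> \<le> real g ^ (2 * T) * exp (100 * l ^ 3 / real g ^ 2) ^ T"
      using l g by (intro mult_left_mono power_mono) auto
    finally have *: "(real g ^ 2 + 100 * real L ^ 3) ^ T \<le> real g ^ (2 * T) * exp (100 * l ^ 3 / real g ^ 2) ^ T" .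
    note W[OF that]
    also have "2 * N * (real g ^ 2 + 100 * real L ^ 3) ^ T \<le> 2 * N * (real g ^ (2 * T) * exp (100 * l ^ 3 / real g ^ 2) ^ T)"
      using * N by (intro mult_left_mono) auto
    finally have "real g ^ (2 * T) * exp (energy L k \<tau> Y I / g) \<le> real g ^ (2 * T) * (2 * N * exp (100 * l ^ 3 / real g ^ 2) ^ T)"
      by (simp only: mult_ac)
    then have "exp (energy L k \<tau> Y I / g) \<le> 2 * N * exp (100 * l ^ 3 / real g ^ 2) ^ T"
      using g(2) by (simp add: mult_le_cancel_left_pos)
    also have "\<dots> = exp (ln (2 * N) + T * (100 * l ^ 3 / real g ^ 2))" unfolding exp_add exp_of_nat_mult using N by simp
    finally have "energy L k \<tau> Y I / g \<le> ln (2 * N) + T * (100 * l ^ 3 / real g ^ 2)" by simp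
    also have "T * (100 * l ^ 3 / real g ^ 2) = l / 6400"
      unfolding g T using l by (simp add: field_simps power2_eq_square power3_eq_cube)
    also have "ln (2 * N) + l / 6400 \<le> l / 3200" using N(2) by (simp add: l_def)
    finally have "energy L k \<tau> Y I \<le> l / 3200 * real g" using g by (simp add: field_simps)
    also have "\<dots> = l ^ 3" unfolding g by (simp add: power2_eq_square power3_eq_cube)
    finally show ?thesis .
  qed
  define y where "y u = real (Y u) - l" for u
  define A where "A = {u \<in> I. Y u = 2 * L}" define B where "B = {u \<in> I. Y u = 0}"
  define C where "C = {u \<in> I. Y u \<noteq> 0 \<and> Y u \<noteq> 2 * L}"
  have fin: "finite A" "finite B" "finite C" using I by (auto simp: A_def B_def C_def)
  have ABC: "I = A \<union> B \<union> C" "A \<inter> B = {}" "(A \<union> B) \<inter> C = {}" using L by (auto simp: A_def B_def C_def)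
  have y: "\<bar>y u\<bar> \<le> l" if "u \<in> I" for u using Y[OF that] by (auto simp: y_def l_def)
  have e: "energy L k \<tau> Y I = (\<Sum>u\<in>I. real (\<tau> u)) - (\<Sum>u\<in>I. (y u)\<^sup>2) - of_int (ksg k) * (8 * l) * (\<Sum>u\<in>I. y u)" for k
    unfolding energy_def l_def[symmetric] y_def[symmetric] sum_subtractf sum_distrib_left ..
  have sq: "(\<Sum>u\<in>I. (y u)\<^sup>2) \<le> l ^ 3"
  proof -
    have "(\<Sum>u\<in>I. (y u)\<^sup>2) \<le> (\<Sum>u\<in>I. l\<^sup>2)"
      using y l by (intro sum_mono) (simp add: abs_le_square_iff[symmetric])
    then show ?thesis using I by (simp add: l_def power2_eq_square power3_eq_cube)
  qed
  have tau: "(\<Sum>u\<in>I. real (\<tau> u)) \<ge> 16 * l\<^sup>2 * card C"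
  proof -
    have "(\<Sum>u\<in>I. real (\<tau> u)) \<ge> (\<Sum>u\<in>C. real (\<tau> u))" using I by (intro sum_mono2) (auto simp: C_def)
    moreover have "(\<Sum>u\<in>C. real (\<tau> u)) = (\<Sum>u\<in>C. 16 * l\<^sup>2)" using \<tau> T by (intro sum.cong) (auto simp: C_def)
    ultimately show ?thesis by (simp add: mult_ac)
  qed
  let ?s = "\<Sum>u\<in>I. y u"
  have e1: "(\<Sum>u\<in>I. real (\<tau> u)) - 8 * l * ?s \<le> 2 * l ^ 3" "(\<Sum>u\<in>I. real (\<tau> u)) + 8 * l * ?s \<le> 2 * l ^ 3"
    using E[of 0] E[of 1] sq unfolding e by (auto simp: ksg_def)
  \<comment> \<open>Averaging the two inequalities removes the drift. Each element of
    \<open>C\<close> contributes \<open>16 l^2\<close> to the total time, so at most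
    \<open>l / 8\<close> elements are unabsorbed.\<close>
  have "16 * l\<^sup>2 * card C \<le> 2 * l ^ 3" using e1 tau by linarith
  then have "l\<^sup>2 * (8 * card C) \<le> l\<^sup>2 * l" by (simp add: power2_eq_square power3_eq_cube mult_ac)
  then have C: "8 * real (card C) \<le> l" using l by simp
  have "0 \<le> (\<Sum>u\<in>I. real (\<tau> u))" by (simp add: sum_nonneg)
  then have "\<bar>8 * l * ?s\<bar> \<le> 2 * l ^ 3" using e1 by linarith
  then have "(8 * l) * \<bar>?s\<bar> \<le> (8 * l) * (l\<^sup>2 / 4)" using l by (simp add: abs_mult power2_eq_square power3_eq_cube mult_ac)
  then have s: "\<bar>?s\<bar> \<le> l\<^sup>2 / 4" using l by simp
  have "?s = (\<Sum>u\<in>A. y u) + (\<Sum>u\<in>B. y u) + (\<Sum>u\<in>C. y u)"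
    using ABC fin by (simp add: sum.union_disjoint)
  also have "(\<Sum>u\<in>A. y u) = l * card A" by (subst sum.cong[OF refl, of A y "\<lambda>_. l"]) (auto simp: A_def y_def l_def)
  also have "(\<Sum>u\<in>B. y u) = - (l * card B)" by (subst sum.cong[OF refl, of B y "\<lambda>_. - l"]) (auto simp: B_def y_def l_def)
  finally have s2: "?s = l * card A - l * card B + (\<Sum>u\<in>C. y u)" by simp
  have "\<bar>\<Sum>u\<in>C. y u\<bar> \<le> (\<Sum>u\<in>C. \<bar>y u\<bar>)" by (rule sum_abs)
  also have "\<dots> \<le> card C * l" using y by (intro sum_bounded_above) (auto simp: C_def)
  finally have sC: "\<bar>\<Sum>u\<in>C. y u\<bar> \<le> card C * l" .
  have "\<bar>l * card A - l * card B\<bar> \<le> l\<^sup>2 / 4 + card C * l" using s s2 sC by linarith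
  moreover have "l * \<bar>real (card A) - card B\<bar> = \<bar>l * card A - l * card B\<bar>"
    using l by (simp only: right_diff_distrib[symmetric] abs_mult)
  moreover have "l\<^sup>2 / 4 + card C * l = l * (l / 4 + card C)" by (simp add: power2_eq_square distrib_left)
  ultimately have "l * \<bar>real (card A) - card B\<bar> \<le> l * (l / 4 + card C)" by simp
  then have d: "\<bar>real (card A) - card B\<bar> \<le> l / 4 + card C" using l by simp
  have "card I = card A + card B + card C" using ABC fin by (simp add: card_Un_disjoint)
  then have "l = card A + card B + card C" using I by (simp add: l_def)
  \<comment> \<open>\<open>A\<close> and \<open>B\<close> differ by at most
    \<open>l / 4 + card C\<close> and together have \<open>l - card C\<close> elements, so each has
    at least \<open>3 l / 8 - card C\<close>, which is at least \<open>l / 4\<close>.\<close>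
  then have "l \<le> 4 * real (card A)" "l \<le> 4 * real (card B)" using d C by linarith+
  then show "L \<le> 4 * card {u \<in> I. Y u = 2 * L}" "L \<le> 4 * card {u \<in> I. Y u = 0}" unfolding l_def A_def B_def by linarith+
qed

section \<open>Expressions of the algorithm\<close>

lemma ev_upd [simp]: "x \<notin> fv h \<Longrightarrow> ev h (R(x := s)) A = ev h R A"
  by (intro ev_fv) auto

lemma fold_add_upt: "fold (\<lambda>i s. s + f i) [0..<n] a = a + (\<Sum>i<n. f i :: nat)"
  by (induction n) (auto simp: lessThan_Suc)

lemma fold_half_upt: "fold (\<lambda>i s. s div 2) [0..<n] a = (a::nat) div 2 ^ n"
proof (induction n)
  case (Suc n)
  then show ?case by (simp only: upt_Suc_append fold_append comp_def fold.simps id_def power_Suc2 div_mult2_eq)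
qed simp

lemma fold_double_upt: "fold (\<lambda>i s. s + s) [0..<n] a = (a::nat) * 2 ^ n"
  by (induction n) auto

definition summ :: "nat \<Rightarrow> nat \<Rightarrow> hx \<Rightarrow> hx \<Rightarrow> hx" where
  "summ x y n e = It x y n (Cn 0) (Ad (V x) e)"
text \<open>Repeated addition: the first factor counts iterations and is capped by register 0, while
  the second may have many bits. Quantities known to be small therefore come first.\<close>

definition mul :: "nat \<Rightarrow> nat \<Rightarrow> hx \<Rightarrow> hx \<Rightarrow> hx" where
  "mul x y a e = summ x y a e"
definition shr :: "hx \<Rightarrow> hx \<Rightarrow> hx" where
  "shr e n = It 20 21 n e (Hf (V 20))"
definition shl :: "hx \<Rightarrow> hx \<Rightarrow> hx" where
  "shl e n = It 20 21 n e (Ad (V 20) (V 20))"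
definition neq :: "hx \<Rightarrow> hx \<Rightarrow> hx" where
  "neq e f = Ad (Ls e f) (Ls f e)"
definition eqx :: "hx \<Rightarrow> hx \<Rightarrow> hx" where
  "eqx e f = Ls (neq e f) (Cn 1)"
definition andx :: "hx \<Rightarrow> hx \<Rightarrow> hx" where
  "andx e f = Ls (Cn 1) (Ad (Ls (Cn 0) e) (Ls (Cn 0) f))"
primrec tm :: "nat \<Rightarrow> hx \<Rightarrow> hx" where
  "tm 0 e = Cn 0"
| "tm (Suc n) e = Ad e (tm n e)"

lemma ev_summ: "x \<noteq> y \<Longrightarrow> x \<notin> fv e \<Longrightarrow> ev (summ x y n e) R A = (\<Sum>i<min (ev n R A) (R 0). ev e (R(y := i)) A)"
proof -
  assume a: "x \<noteq> y" "x \<notin> fv e"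
  have "ev (summ x y n e) R A = fold (\<lambda>i s. s + ev e (R(y := i)) A) [0..<min (ev n R A) (R 0)] 0"
    unfolding summ_def ev.simps using a by (simp add: fun_upd_twist[of x y] )
  then show ?thesis by (simp add: fold_add_upt)
qed

lemma ev_mul: "x \<noteq> y \<Longrightarrow> x \<notin> fv e \<Longrightarrow> y \<notin> fv e \<Longrightarrow> ev (mul x y a e) R A = min (ev a R A) (R 0) * ev e R A"
  by (simp add: mul_def ev_summ)

lemma ev_shr [simp]: "ev (shr e n) R A = ev e R A div 2 ^ min (ev n R A) (R 0)"
  by (simp add: shr_def fold_half_upt)

lemma ev_shl [simp]: "ev (shl e n) R A = ev e R A * 2 ^ min (ev n R A) (R 0)"
  by (simp add: shl_def fold_double_upt)

lemma ev_logic [simp]: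
  "ev (neq e f) R A = (if ev e R A \<noteq> ev f R A then 1 else 0)"
  "ev (eqx e f) R A = (if ev e R A = ev f R A then 1 else 0)"
  "ev (andx e f) R A = (if ev e R A \<noteq> 0 \<and> ev f R A \<noteq> 0 then 1 else 0)"
  "ev (tm n e) R A = n * ev e R A"
  by (auto simp: neq_def eqx_def andx_def) (induction n, auto)

lemma fv_macros [simp]:
  "fv (summ x y n e) = insert 0 (fv n \<union> ((insert x (fv e)) - {x, y}))"
  "fv (mul x y n e) = insert 0 (fv n \<union> ((insert x (fv e)) - {x, y}))"
  "fv (shr e n) = insert 0 (fv e \<union> fv n)" "fv (shl e n) = insert 0 (fv e \<union> fv n)"
  "fv (neq e f) = fv e \<union> fv f" "fv (eqx e f) = fv e \<union> fv f" "fv (andx e f) = fv e \<union> fv f"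
  by (auto simp: summ_def mul_def shr_def shl_def neq_def eqx_def andx_def)

lemma fv_tm [simp]: "fv (tm n e) \<subseteq> fv e"
  by (induction n) auto

lemma wfx_macros [simp]:
  "wfx (summ x y n e) \<longleftrightarrow> 3 \<le> x \<and> x < 50 \<and> 3 \<le> y \<and> y < 50 \<and> x \<noteq> y \<and> wfx n \<and> wfx e"
  "wfx (mul x y n e) \<longleftrightarrow> 3 \<le> x \<and> x < 50 \<and> 3 \<le> y \<and> y < 50 \<and> x \<noteq> y \<and> wfx n \<and> wfx e"
  "wfx (shr e n) \<longleftrightarrow> wfx e \<and> wfx n" "wfx (shl e n) \<longleftrightarrow> wfx e \<and> wfx n"
  "wfx (neq e f) \<longleftrightarrow> wfx e \<and> wfx f" "wfx (eqx e f) \<longleftrightarrow> wfx e \<and> wfx f" "wfx (andx e f) \<longleftrightarrow> wfx e \<and> wfx f"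
  by (auto simp: summ_def mul_def shr_def shl_def neq_def eqx_def andx_def)

lemma wfx_tm [simp]: "wfx e \<Longrightarrow> wfx (tm n e)"
  by (induction n) auto

lemma arrs_macros [simp]:
  "arrs (summ x y n e) = arrs n \<union> arrs e" "arrs (mul x y n e) = arrs n \<union> arrs e"
  "arrs (shr e n) = arrs e \<union> arrs n" "arrs (shl e n) = arrs e \<union> arrs n"
  "arrs (neq e f) = arrs e \<union> arrs f" "arrs (eqx e f) = arrs e \<union> arrs f" "arrs (andx e f) = arrs e \<union> arrs f"
  by (auto simp: summ_def mul_def shr_def shl_def neq_def eqx_def andx_def)

lemma arrs_tm [simp]: "arrs (tm n e) \<subseteq> arrs e"
  by (induction n) auto

text \<open>
  Registers: 4 the start of the lists, 5 the number \<open>N\<close> of occurrences, 6 the window length \<open>L\<close>, 7 the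
  scale \<open>g\<close> of the increments, 8 the number of steps, 9 the number of sets, 11 the current bit, 12 its
  tentative value.  Arrays: 2 marks the starts of the lists, 3 and 4 are the weights for the two signs, 5
  the positions of the walks, 6 the sign bits, 10 the occurrences selected so far, 11 the tournament table;
  7 and 8 are scratch.
\<close>

definition dv :: "hx \<Rightarrow> hx" where
  "dv e = Ar 0 (Ad (V 4) e)"
definition idx :: "hx \<Rightarrow> hx" where
  "idx e = Ad (dv e) (shl (Cn 1) (Sb (V 0) (Cn 1)))"
definition bitx :: "hx \<Rightarrow> hx \<Rightarrow> hx" where
  "bitx e n = Sb (shr e n) (Ad (Hf (shr e n)) (Hf (shr e n)))"
text \<open>The sign bit with bit \<open>V 11\<close> of the random vector tentatively set to
  \<open>V 12\<close>; a sign bit 1 stands for the sign -1.\<close>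

definition sgx :: "hx \<Rightarrow> hx" where
  "sgx e = neq (Ar 6 e) (andx (V 12) (bitx (idx e) (V 11)))"
definition actx :: "hx \<Rightarrow> hx" where
  "actx e = andx (Ar 5 e) (neq (Ar 5 e) (Ad (V 6) (V 6)))"
text \<open>Multiplication by a 0-1 value serves as a conditional expression.\<close>

definition magx :: "nat \<Rightarrow> hx \<Rightarrow> hx" where
  "magx k e = mul 20 21 (actx e)
     (if k = 0 then Ad (tm 2 (Ar 5 e)) (tm 6 (V 6)) else Sb (tm 10 (V 6)) (tm 2 (Ar 5 e)))"
definition samex :: "hx \<Rightarrow> hx \<Rightarrow> hx" where
  "samex e f = eqx (shr (idx e) (Ad (V 11) (Cn 1))) (shr (idx f) (Ad (V 11) (Cn 1)))"
definition posx :: "nat \<Rightarrow> hx" where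
  "posx i = Ad (V 3) (V i)"
text \<open>Values are natural numbers, so products of equal signs (\<open>b = 0\<close>) and of
  opposite signs (\<open>b = 1\<close>) are summed separately and subtracted only once, in
  \<open>formx\<close>.\<close>

definition pairs :: "nat \<Rightarrow> nat \<Rightarrow> hx" where
  "pairs k b = summ 30 31 (V 6) (summ 32 33 (V 6) (mul 22 23 (samex (posx 31) (posx 33))
     (mul 24 25 (eqx (neq (sgx (posx 31)) (sgx (posx 33))) (Cn b)) (mul 26 27 (magx k (posx 31)) (magx k (posx 33))))))"
text \<open>A summand counts positively exactly if the sign bit equals \<open>k\<close>, since both
  encode -1 by 1. The guard admits the linear term only when the last bit is being decided.\<close>

definition linx :: "nat \<Rightarrow> nat \<Rightarrow> hx" where
  "linx k b = mul 22 23 (eqx (Ad (V 11) (Cn 1)) (V 0)) (mul 24 25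
     (summ 30 31 (V 6) (mul 26 27 (eqx (neq (sgx (posx 31)) (Cn k)) (Cn b)) (magx k (posx 31)))) (V 7))"
definition formx :: "nat \<Rightarrow> hx" where
  "formx k = Sb (Ad (mul 20 21 (V 7) (V 7)) (Ad (pairs k 0) (linx k 0))) (Ad (pairs k 1) (linx k 1))"

text \<open>The top bit is set in all identifiers; deciding it last flips all signs at once.\<close>

definition idf :: "store \<Rightarrow> arrays \<Rightarrow> nat \<Rightarrow> nat" where
  "idf R A q = A 0 (R 4 + q) + 2 ^ (R 0 - 1)"

lemma idf_upd [simp]: "x \<noteq> 0 \<Longrightarrow> x \<noteq> 4 \<Longrightarrow> idf (R(x := a)) A = idf R A"
  by (auto simp: idf_def)

lemma ev_dv [simp]: "ev (dv e) R A = A 0 (R 4 + ev e R A)"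
  by (simp add: dv_def)
lemma ev_idx [simp]: "ev (idx e) R A = idf R A (ev e R A)"
  by (simp add: idx_def idf_def)
lemma ev_bitx [simp]: "ev (bitx e n) R A = ev e R A div 2 ^ min (ev n R A) (R 0) mod 2"
  by (simp add: bitx_def modulo_nat_def mult_2_right)
lemma ev_actx [simp]: "ev (actx e) R A = (if A 5 (ev e R A) \<noteq> 0 \<and> A 5 (ev e R A) \<noteq> 2 * R 6 then 1 else 0)"
  by (simp add: actx_def)
lemma ev_magx: "20 \<notin> fv e \<Longrightarrow> 21 \<notin> fv e \<Longrightarrow> 1 \<le> R 0 \<Longrightarrow> ev (magx k e) R A = mag (R 6) k (A 5 (ev e R A))"
  unfolding magx_def by (subst ev_mul) (auto simp: mag_def numeral_eq_Suc)
lemma ev_posx [simp]: "ev (posx i) R A = R 3 + R i" "fv (posx i) = {3, i}" "arrs (posx i) = {}" "wfx (posx i) \<longleftrightarrow> i < 50"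
  by (auto simp: posx_def)
lemma fv_exprs: "fv (sgx e) = {0, 4, 11, 12} \<union> fv e" "fv (samex e f) = {0, 4, 11} \<union> fv e \<union> fv f"
  "fv (magx k e) \<subseteq> {0, 6} \<union> fv e" "fv (actx e) = {6} \<union> fv e"
  by (auto simp: sgx_def samex_def magx_def actx_def bitx_def idx_def dv_def numeral_eq_Suc)

definition sbit :: "nat \<Rightarrow> (nat \<Rightarrow> nat) \<Rightarrow> nat \<Rightarrow> (nat \<Rightarrow> nat) \<Rightarrow> nat \<Rightarrow> nat" where
  "sbit j ident r s q = (if s q \<noteq> (if r \<noteq> 0 \<and> odd (ident q div 2 ^ j) then 1 else 0) then 1 else 0)"

definition sgz :: "nat \<Rightarrow> int" where "sgz b = (if b = 0 then 1 else - 1)"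

lemma ev_sgx: "R 11 \<le> R 0 \<Longrightarrow> ev (sgx e) R A = sbit (R 11) (idf R A) (R 12) (A 6) (ev e R A)"
  by (auto simp: sgx_def sbit_def odd_iff_mod_2_eq_one)

lemma sum_window: "(\<Sum>u\<in>{p..<p+L}. f u) = (\<Sum>u<L. f (p + u))" for f :: "nat \<Rightarrow> 'a::comm_monoid_add"
  using sum.atLeastLessThan_shift_0[of f p "p + L"] by (simp add: lessThan_atLeast0 comp_def)

text \<open>The linear and the quadratic part are each at most \<open>10 L^2 g\<close>, hence at
  most \<open>g^2 / 2\<close>, in absolute value. So the truncated subtraction is exact, and the
  value is at most \<open>2 g^2\<close>, small enough for a loop count.\<close>

lemma ev_formx:
  assumes R: "R 11 < R 0" "R 6 \<le> R 0" "R 7 \<le> R 0" "10 * R 6 * R 6 \<le> R 0" "10 * R 6 \<le> R 0" and k: "k < 2"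
    and Y: "\<And>q. A 5 q \<le> 2 * R 6" and g: "20 * R 6 * R 6 \<le> R 7"
  defines "x \<equiv> \<lambda>q. int (mag (R 6) k (A 5 q)) * sgz (sbit (R 11) (idf R A) (R 12) (A 6) q)"
  shows "int (ev (formx k) R A) = CF (R 0) (R 7) (R 6) (idf R A) (Suc (R 11)) (ksg k) x (R 3)"
    and "int (ev (formx k) R A) \<le> 2 * int (R 7) ^ 2"
proof -
  let ?L = "R 6" and ?X = "R 0" and ?p = "R 3" and ?j = "R 11" and ?g = "R 7"
  note fv3 = fv_exprs(3)[of k "posx 31"] fv_exprs(3)[of k "posx 33"]
  define m where "m u = mag ?L k (A 5 (?p + u))" for u
  define s where "s u = sbit ?j (idf R A) (R 12) (A 6) (?p + u)" for u
  define same where "same u v \<longleftrightarrow> idf R A (?p + u) div 2 ^ Suc ?j = idf R A (?p + v) div 2 ^ Suc ?j" for u v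
  have m: "m u \<le> 10 * ?L" for u using mag_le[OF Y] by (simp add: m_def)
  have mX: "min (m u) ?X = m u" for u using m[of u] R by simp
  have s01: "s u < 2" for u by (auto simp: s_def sbit_def)
  have j: "min (Suc ?j) ?X = Suc ?j" "1 \<le> ?X" "min ?L ?X = ?L" using R by auto
  have P: "ev (pairs k b) R A = (\<Sum>u<?L. \<Sum>v<?L. if same u v \<and> (s u \<noteq> s v) = (b = 1) then m u * m v else 0)" if "b < 2" for b
    unfolding pairs_def
    apply (subst ev_summ)
      apply simp
    using fv3
     apply (auto simp: fv_exprs)[1]
    apply (simp add: j, rule sum.cong[OF refl])
    apply (subst ev_summ)
      apply simp
    using fv3
     apply (auto simp: fv_exprs)[1]
    apply (simp add: j, rule sum.cong[OF refl])
    apply (subst ev_mul, simp)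
    using fv3
      apply (auto simp: fv_exprs)[2]
    apply (subst ev_mul, simp)
    using fv3
      apply (auto simp: fv_exprs)[2]
    apply (subst ev_mul, simp)
    using fv3
      apply (auto simp: fv_exprs)[2]
    using R that by (auto simp: ev_magx ev_sgx samex_def m_def[symmetric] s_def[symmetric] same_def j mX simp del: power_Suc)
  have Ls: "(\<Sum>u<?L. if (s u \<noteq> k) = (b = 1) then m u else 0) \<le> 10 * ?L * ?L" for b
  proof -
    have "(\<Sum>u<?L. if (s u \<noteq> k) = (b = 1) then m u else 0) \<le> (\<Sum>u<?L. 10 * ?L)"
      using m by (intro sum_mono) auto
    then show ?thesis by (simp add: mult_ac)
  qed
  have Ln: "ev (linx k b) R A = (if Suc ?j = ?X then (\<Sum>u<?L. if (s u \<noteq> k) = (b = 1) then m u else 0) * ?g else 0)" if "b < 2" for b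
  proof -
    have in_sum: "ev (summ 30 31 (V 6) (mul 26 27 (eqx (neq (sgx (posx 31)) (Cn k)) (Cn b)) (magx k (posx 31)))) R A =
      (\<Sum>u<?L. if (s u \<noteq> k) = (b = 1) then m u else 0)"
      apply (subst ev_summ)
        apply simp
      using fv3
       apply (auto simp: fv_exprs)[1]
      apply (simp add: j, rule sum.cong[OF refl])
      apply (subst ev_mul, simp)
      using fv3
        apply (auto simp: fv_exprs)[2]
      using R that s01 by (auto simp: ev_magx ev_sgx m_def[symmetric] s_def[symmetric])
    show ?thesis unfolding linx_def
      apply (subst ev_mul, simp)
      using fv3
        apply (auto simp: fv_exprs)[2]
      apply (subst ev_mul, simp, simp, simp)
      using order_trans[OF Ls R(4), of b] R unfolding in_sum by (auto simp: min_def)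
  qed
  have x: "x (?p + u) = int (m u) * sgz (s u)" for u by (simp add: x_def m_def s_def)
  have P0: "ev (pairs k 0) R A = (\<Sum>u<?L. \<Sum>v<?L. if same u v \<and> s u = s v then m u * m v else 0)"
    using P[of 0] by simp
  have P1: "ev (pairs k 1) R A = (\<Sum>u<?L. \<Sum>v<?L. if same u v \<and> s u \<noteq> s v then m u * m v else 0)"
    using P[of 1] by simp
  have sg: "sgz (s u) * sgz (s v) = (if s u = s v then 1 else - 1)" for u v
    using s01[of u] s01[of v] by (auto simp: sgz_def)
  have gr: "grp (Suc ?j) (idf R A) x {?p..<?p+?L} = int (ev (pairs k 0) R A) - int (ev (pairs k 1) R A)"
    unfolding grp_def sum_window P0 P1 of_nat_sum sum_subtractf[symmetric] same_def[symmetric] x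
  proof (intro sum.cong refl, goal_cases)
    case (1 u v)
    have e: "int (m u) * sgz (s u) * (int (m v) * sgz (s v)) = int (m u * m v) * (if s u = s v then 1 else - 1)"
      unfolding sg[symmetric] by simp
    show ?case unfolding e by simp
  qed
  have ln: "(if Suc ?j = ?X then ksg k * (int ?g * (\<Sum>u\<in>{?p..<?p+?L}. x u)) else 0) =
      int (ev (linx k 0) R A) - int (ev (linx k 1) R A)"
  proof (cases "Suc ?j = ?X")
    case True
    have "int (ev (linx k 0) R A) - int (ev (linx k 1) R A) = int ?g * (\<Sum>u<?L. int (if s u = k then m u else 0) - int (if s u \<noteq> k then m u else 0))"
      using True by (simp add: Ln sum_subtractf algebra_simps sum_distrib_left sum_distrib_right)
    also have "(\<Sum>u<?L. int (if s u = k then m u else 0) - int (if s u \<noteq> k then m u else 0)) = (\<Sum>u<?L. ksg k * x (?p + u))"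
    proof (intro sum.cong refl, goal_cases)
      case (1 u)
      show ?case using s01[of u] k by (auto simp: x sgz_def ksg_def dest!: less_2_cases)
    qed
    finally show ?thesis using True by (simp add: sum_window sum_distrib_left mult_ac)
  qed (simp add: Ln)
  have gi: "20 * int ?L * int ?L \<le> int ?g" "10 * int ?L * int ?L \<le> int ?g"
  proof -
    have "int (20 * ?L * ?L) \<le> int ?g" using g by (simp only: of_nat_le_iff)
    then show "20 * int ?L * int ?L \<le> int ?g" by simp
    moreover have "0 \<le> int ?L * int ?L" by simp
    ultimately show "10 * int ?L * int ?L \<le> int ?g" by linarith
  qed
  have xb: "\<bar>x u\<bar> \<le> 10 * int ?L" for u
    using mag_le[OF Y, of k u] by (auto simp: x_def sgz_def)
  have "\<bar>grp (Suc ?j) (idf R A) x {?p..<?p+?L}\<bar> \<le> (int (card {?p..<?p+?L}) * (10 * int ?L))\<^sup>2"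
    by (rule abs_grp_le) (use xb in auto)
  also have "\<dots> = (10 * int ?L * int ?L)\<^sup>2" by (simp add: power2_eq_square)
  also have "\<dots> \<le> 10 * int ?L * int ?L * int ?g"
    unfolding power2_eq_square using gi by (intro mult_left_mono) auto
  finally have b1: "\<bar>grp (Suc ?j) (idf R A) x {?p..<?p+?L}\<bar> \<le> 10 * int ?L * int ?L * int ?g" .
  have "\<bar>\<Sum>u\<in>{?p..<?p+?L}. x u\<bar> \<le> (\<Sum>u\<in>{?p..<?p+?L}. \<bar>x u\<bar>)" by (rule sum_abs)
  also have "\<dots> \<le> of_nat (card {?p..<?p+?L}) * (10 * int ?L)" using xb by (intro sum_bounded_above) auto
  finally have "\<bar>\<Sum>u\<in>{?p..<?p+?L}. x u\<bar> * int ?g \<le> 10 * int ?L * int ?L * int ?g"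
    by (intro mult_right_mono) (auto simp: mult_ac)
  then have b2: "\<bar>if Suc ?j = ?X then ksg k * (int ?g * (\<Sum>u\<in>{?p..<?p+?L}. x u)) else 0\<bar> \<le> 10 * int ?L * int ?L * int ?g"
    by (auto simp: abs_mult ksg_def mult_ac)
  have "20 * int ?L * int ?L * int ?g \<le> int ?g * int ?g"
    using mult_right_mono[OF gi(1), of "int ?g"] by simp
  then have b3: "\<bar>CF ?X ?g ?L (idf R A) (Suc ?j) (ksg k) x ?p - (int ?g)\<^sup>2\<bar> \<le> (int ?g)\<^sup>2"
    using b1 b2 unfolding CF_def power2_eq_square by linarith
  have gg: "ev (mul 20 21 (V 7) (V 7)) R A = ?g * ?g" using R by (simp add: ev_mul)
  have eq: "CF ?X ?g ?L (idf R A) (Suc ?j) (ksg k) x ?p = int (?g * ?g + (ev (pairs k 0) R A + ev (linx k 0) R A)) - int (ev (pairs k 1) R A + ev (linx k 1) R A)"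
    unfolding CF_def gr ln by (simp add: power2_eq_square)
  have "0 \<le> CF ?X ?g ?L (idf R A) (Suc ?j) (ksg k) x ?p" using b3 by linarith
  then have le: "ev (pairs k 1) R A + ev (linx k 1) R A \<le> ?g * ?g + (ev (pairs k 0) R A + ev (linx k 0) R A)"
    unfolding eq by linarith
  show "int (ev (formx k) R A) = CF ?X ?g ?L (idf R A) (Suc ?j) (ksg k) x ?p"
    unfolding formx_def ev.simps gg eq of_nat_diff[OF le] ..
  then show "int (ev (formx k) R A) \<le> 2 * int ?g ^ 2" using b3 by linarith
qed

lemma formx_static: "wfx (formx k)" "arrs (formx k) \<subseteq> {0, 5, 6}" "fv (formx k) \<subseteq> {0, 3, 4, 6, 7, 11, 12}"
  by (auto simp: formx_def pairs_def linx_def magx_def actx_def samex_def sgx_def bitx_def idx_def dv_def numeral_eq_Suc)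

section \<open>Choosing the signs\<close>

text \<open>Pairwise summation of array 8: after \<open>i\<close> rounds cell \<open>q\<close> holds
  the sum of the block \<open>q\<close> of length \<open>2^i\<close>. All \<open>N\<close> cells
  take part in every round, relying on zeros beyond the end. Array 7 is a buffer, because a phase
  may not read the array it writes.\<close>

definition reduce :: prog where
  "reduce = Lp 13 0 (Sq (Par 5 7 (Ad (Ar 8 (Ad (V 3) (V 3))) (Ar 8 (Ad (Ad (V 3) (V 3)) (Cn 1))))) (Par 5 8 (Ar 7 (V 3))))"

lemma wp_reduce:
  assumes R: "R 5 = N" "R 1 \<le> R 2" "N \<le> 2 ^ R 0" and A: "\<And>i. N \<le> i \<Longrightarrow> A 8 i = 0"
    and Q: "\<And>f g. f 0 = (\<Sum>p<N. A 8 p) \<Longrightarrow> (\<And>i. N \<le> i \<Longrightarrow> f i = 0) \<Longrightarrow> Q (R(13 := R 0)) (A(7 := g, 8 := f))"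
  shows "wp N reduce Q R A"
  unfolding reduce_def
proof (rule wp_Lp[where n = "R 0" and I = "\<lambda>i R' A'. R' = R(13 := i) \<and>
     (\<exists>f g. A' = A(7 := g, 8 := f) \<and> (\<forall>q. f q = (\<Sum>p | p < N \<and> p div 2 ^ i = q. A 8 p)))"], goal_cases)
  case 1
  have "(\<Sum>p | p < N \<and> p div 2 ^ 0 = q. A 8 p) = A 8 q" for q
  proof (cases "q < N")
    case True
    then have "{p. p < N \<and> p div 2 ^ 0 = q} = {q}" by auto
    then show ?thesis by simp
  next
    case False
    then have "{p. p < N \<and> p div 2 ^ 0 = q} = {}" by auto
    then show ?thesis using A[of q] False by (simp only: sum.empty)
  qed
  then have "A = A(7 := A 7, 8 := A 8) \<and> (\<forall>q. A 8 q = (\<Sum>p | p < N \<and> p div 2 ^ 0 = q. A 8 p))" by simp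
  then show ?case by blast
next
  case (2 i R' A')
  then obtain f g where *: "R' = R(13 := i)" "A' = A(7 := g, 8 := f)"
    "\<And>q. f q = (\<Sum>p | p < N \<and> p div 2 ^ i = q. A 8 p)" by blast
  have s: "f (2 * q) + f (Suc (2 * q)) = (\<Sum>p | p < N \<and> p div 2 ^ Suc i = q. A 8 p)" for q
  proof -
    have d: "p div 2 ^ Suc i = p div 2 ^ i div 2" for p :: nat by (simp only: power_Suc2 div_mult2_eq)
    have e: "{p. p < N \<and> p div 2 ^ Suc i = q} = {p. p < N \<and> p div 2 ^ i = 2 * q} \<union> {p. p < N \<and> p div 2 ^ i = Suc (2 * q)}"
      unfolding d by (auto; presburger)
    show ?thesis unfolding e *(3) by (rule sum.union_disjoint[symmetric]) auto
  qed
  have z: "(\<Sum>p | p < N \<and> p div 2 ^ j = q. A 8 p) = 0" if "N \<le> q" for q j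
  proof -
    have "p div 2 ^ j \<noteq> q" if "p < N" for p using div_le_dividend[of p "2 ^ j"] that \<open>N \<le> q\<close> by linarith
    then have "{p. p < N \<and> p div 2 ^ j = q} = {}" by blast
    then show ?thesis by (simp only: sum.empty)
  qed
  show ?case
    apply (rule wp_Sq, rule wp_Par; (use R * in simp)?)
    apply (rule wp_Par; (use R * in simp)?)
    apply (intro exI conjI allI)
     apply (subst fun_upd_twist, simp, rule refl)
    subgoal for q using s[of q] z[of q "Suc i"] z[of q i] *(3)[of q] R
      by (cases "q < N") (simp_all add: mult_2)
    done
next
  case (9 R' A')
  then obtain f g where *: "R' = R(13 := R 0)" "A' = A(7 := g, 8 := f)"
    "\<And>q. f q = (\<Sum>p | p < N \<and> p div 2 ^ R 0 = q. A 8 p)" by blast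
  have "p div 2 ^ R 0 = 0" if "p < N" for p using that R by simp
  then have e: "{p. p < N \<and> p div 2 ^ R 0 = q} = (if q = 0 then {..<N} else {})" for q by auto
  have f0: "f 0 = (\<Sum>p<N. A 8 p)" using *(3)[of 0] unfolding e by simp
  moreover have "f i = 0" if "N \<le> i" for i
  proof (cases "i = 0")
    case True
    then show ?thesis using that f0 by simp
  next
    case False
    then show ?thesis using *(3)[of i] unfolding e by simp
  qed
  ultimately show ?case using Q * by simp
qed (use R in auto)


definition xsg :: "nat \<Rightarrow> (nat \<Rightarrow> nat) \<Rightarrow> nat \<Rightarrow> (nat \<Rightarrow> nat) \<Rightarrow> nat \<Rightarrow> int" where
  "xsg L Y k s q = int (mag L k (Y q)) * sgz (s q)"

text \<open>The conditional expectation of the total weight after the next step, when the signs are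
  determined up to one fair coin for each class of identifiers agreeing above bit \<open>j\<close>.\<close>

definition PE :: "nat \<Rightarrow> nat \<Rightarrow> nat \<Rightarrow> nat \<Rightarrow> (nat \<Rightarrow> nat) \<Rightarrow> (nat \<Rightarrow> nat) \<Rightarrow> (nat \<Rightarrow> nat \<Rightarrow> nat) \<Rightarrow> nat \<Rightarrow> (nat \<Rightarrow> nat) \<Rightarrow> int" where
  "PE N X g L ident Y W j s = (\<Sum>p<N. \<Sum>k<2. int (W k p) * CF X g L ident j (ksg k) (xsg L Y k s) p)"

lemma CF_cong:
  assumes "\<And>q. q \<in> {p..<p+L} \<Longrightarrow> x q = x' q"
  shows "CF X g L ident j e x p = CF X g L ident j e x' p"
proof -
  have "(\<Sum>u\<in>{p..<p+L}. x u) = (\<Sum>u\<in>{p..<p+L}. x' u)" using assms by (intro sum.cong) auto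
  moreover have "grp j ident x {p..<p+L} = grp j ident x' {p..<p+L}"
    unfolding grp_def using assms by (intro sum.cong refl) auto
  ultimately show ?thesis unfolding CF_def by simp
qed

text \<open>Windows reaching beyond \<open>N\<close> have weight 0, so only the signs of actual
  occurrences matter.\<close>

lemma PE_cong:
  assumes "\<And>q. q < N \<Longrightarrow> s q = s' q" and "\<And>k p. k < 2 \<Longrightarrow> N < p + L \<Longrightarrow> W k p = 0"
  shows "PE N X g L ident Y W j s = PE N X g L ident Y W j s'"
  unfolding PE_def
proof (intro sum.cong refl)
  fix p k assume "p \<in> {..<N}" "k \<in> {..<2::nat}"
  have "CF X g L ident j (ksg k) (xsg L Y k s) p = CF X g L ident j (ksg k) (xsg L Y k s') p" if "p + L \<le> N"
    using that assms(1) by (intro CF_cong) (auto simp: xsg_def)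
  then show "int (W k p) * CF X g L ident j (ksg k) (xsg L Y k s) p = int (W k p) * CF X g L ident j (ksg k) (xsg L Y k s') p"
    using assms(2)[of k p] \<open>k \<in> _\<close> by (cases "p + L \<le> N") auto
qed

text \<open>The two choices for a bit average to the current conditional expectation, so the smaller
  one never increases it.\<close>

lemma PE_average:
  assumes "j < X" "\<And>q. s q < 2" "\<And>q. q < N \<Longrightarrow> odd (ident q div 2 ^ (X - 1))" and "\<And>k p. k < 2 \<Longrightarrow> N < p + L \<Longrightarrow> W k p = 0"
  shows "PE N X g L ident Y W (Suc j) (sbit j ident 0 s) + PE N X g L ident Y W (Suc j) (sbit j ident 1 s) = 2 * PE N X g L ident Y W j s"
proof -
  have s0: "sbit j ident 0 s = s"
  proof
    fix q show "sbit j ident 0 s q = s q" using assms(2)[of q] by (auto simp: sbit_def)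
  qed
  have s1: "xsg L Y k (sbit j ident 1 s) = flip j ident (xsg L Y k s)" for k
  proof
    fix q show "xsg L Y k (sbit j ident 1 s) q = flip j ident (xsg L Y k s) q"
      using assms(2)[of q] by (auto simp: xsg_def flip_def sbit_def sgz_def)
  qed
  show ?thesis unfolding PE_def s0 s1 sum_distrib_left sum.distrib[symmetric]
  proof (intro sum.cong refl)
    fix p k assume "p \<in> {..<N}" "k \<in> {..<2::nat}"
    show "int (W k p) * CF X g L ident (Suc j) (ksg k) (xsg L Y k s) p +
        int (W k p) * CF X g L ident (Suc j) (ksg k) (flip j ident (xsg L Y k s)) p =
        2 * (int (W k p) * CF X g L ident j (ksg k) (xsg L Y k s) p)"
    proof (cases "p + L \<le> N")
      case True
      have "CF X g L ident (Suc j) (ksg k) (xsg L Y k s) p + CF X g L ident (Suc j) (ksg k) (flip j ident (xsg L Y k s)) p =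
          2 * CF X g L ident j (ksg k) (xsg L Y k s) p"
        using True assms by (intro CF_flip) auto
      then show ?thesis by (simp only: distrib_left[symmetric] mult.left_commute)
    qed (use assms(4)[of k p] \<open>k \<in> _\<close> in auto)
  qed
qed

text \<open>The numeric side conditions serve two purposes: \<open>20 L^2 <= g\<close> keeps the
  conditional expectations nonnegative, and \<open>2 g^2 <= X\<close> keeps those of single windows
  within the cap on loop counts.\<close>

definition ctx :: "nat \<Rightarrow> nat \<Rightarrow> nat \<Rightarrow> nat \<Rightarrow> (nat \<Rightarrow> nat) \<Rightarrow> (nat \<Rightarrow> nat) \<Rightarrow> (nat \<Rightarrow> nat \<Rightarrow> nat) \<Rightarrow> store \<Rightarrow> arrays \<Rightarrow> bool" where
  "ctx N X g L ident Y W R A \<longleftrightarrow> R 0 = X \<and> R 1 \<le> R 2 \<and> R 5 = N \<and> R 6 = L \<and> R 7 = g \<and> idf R A = ident \<and>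
     A 3 = W 0 \<and> A 4 = W 1 \<and> A 5 = Y \<and> (\<forall>i\<ge>N. A 8 i = 0) \<and>
     N \<le> 2 ^ X \<and> 2 * g\<^sup>2 \<le> X \<and> 1 \<le> L \<and> 20 * L * L \<le> g \<and> (\<forall>q. Y q \<le> 2 * L)"

lemma ctx_bounds:
  assumes "ctx N X g L ident Y W R A"
  shows "L \<le> X" "g \<le> X" "10 * L * L \<le> X" "10 * L \<le> X" "1 \<le> X"
proof -
  have c: "2 * g\<^sup>2 \<le> X" "1 \<le> L" "20 * L * L \<le> g" using assms by (auto simp: ctx_def)
  have "L * 1 \<le> L * L" using c by (intro mult_left_mono) auto
  then have L: "L \<le> g" "10 * L \<le> g" "10 * L * L \<le> g" using c unfolding mult.assoc by linarith+
  have "g * 1 \<le> g * g" using c L by (intro mult_left_mono) auto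
  then have "g \<le> X" using c(1) unfolding power2_eq_square by linarith
  then show "L \<le> X" "g \<le> X" "10 * L * L \<le> X" "10 * L \<le> X" "1 \<le> X" using L c by linarith+
qed

lemma ctx_formx:
  assumes "ctx N X g L ident Y W R A" "R 11 < X" "k < 2"
  shows "int (ev (formx k) R A) = CF X g L ident (Suc (R 11)) (ksg k) (xsg L Y k (sbit (R 11) ident (R 12) (A 6))) (R 3)"
    and "ev (formx k) R A \<le> X"
proof -
  note b = ctx_bounds[OF assms(1)]
  note c = assms(1)[unfolded ctx_def]
  have *: "R 11 < R 0" "R 6 \<le> R 0" "R 7 \<le> R 0" "10 * R 6 * R 6 \<le> R 0" "10 * R 6 \<le> R 0" using c b assms(2) by auto
  have Y: "\<And>q. A 5 q \<le> 2 * R 6" "20 * R 6 * R 6 \<le> R 7" using c by auto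
  show "int (ev (formx k) R A) = CF X g L ident (Suc (R 11)) (ksg k) (xsg L Y k (sbit (R 11) ident (R 12) (A 6))) (R 3)"
    using ev_formx(1)[where R = R and A = A, OF * assms(3) Y] c unfolding xsg_def by simp
  have "int (ev (formx k) R A) \<le> int (2 * g\<^sup>2)" using ev_formx(2)[where R = R and A = A, OF * assms(3) Y] c by simp
  then show "ev (formx k) R A \<le> X" using c by linarith
qed

definition estep :: "nat \<Rightarrow> prog" where
  "estep r = Sq (SetR 12 (Cn r)) (Sq (Par 5 8 (Ad (mul 20 21 (formx 0) (Ar 3 (V 3))) (mul 20 21 (formx 1) (Ar 4 (V 3)))))
     (Sq reduce (SetR (14 + r) (Ar 8 (Cn 0)))))"

lemma wp_estep:
  assumes c: "ctx N X g L ident Y W R A" and j: "R 11 < X" and r: "r < 2"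
    and Q: "\<And>e f h. int e = PE N X g L ident Y W (Suc (R 11)) (sbit (R 11) ident r (A 6)) \<Longrightarrow> (\<And>i. N \<le> i \<Longrightarrow> f i = 0) \<Longrightarrow>
       Q (R(12 := r, 13 := X, 14 + r := e)) (A(7 := h, 8 := f))"
  shows "wp N (estep r) Q R A"
proof -
  note d = c[unfolded ctx_def]
  let ?R = "R(12 := r)"
  define F where "F p = (if p < N then ev (Ad (mul 20 21 (formx 0) (Ar 3 (V 3))) (mul 20 21 (formx 1) (Ar 4 (V 3)))) (?R(3 := p)) A else A 8 p)" for p
  have "int (F p) = (\<Sum>k<2. int (W k p) * CF X g L ident (Suc (R 11)) (ksg k) (xsg L Y k (sbit (R 11) ident r (A 6))) p)" if "p < N" for p
  proof -
    have c': "ctx N X g L ident Y W (?R(3 := p)) A" using c by (simp add: ctx_def)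
    note f = ctx_formx[OF c', simplified, OF j]
    \<comment> \<open>The form, not the weight, is the loop count of the product; the weight may
      exceed register 0.\<close>
    have "min (ev (formx k) (?R(3 := p)) A) (R 0) = ev (formx k) (?R(3 := p)) A" if "k < 2" for k
      using f(2)[OF that] d by simp
    then have "F p = ev (formx 0) (?R(3 := p)) A * W 0 p + ev (formx 1) (?R(3 := p)) A * W 1 p"
      unfolding F_def using that d by (simp add: ev_mul)
    then show ?thesis using f(1)[of 0] f(1)[of 1] by (simp add: numeral_2_eq_2 mult.commute)
  qed
  then have S: "int (\<Sum>p<N. F p) = PE N X g L ident Y W (Suc (R 11)) (sbit (R 11) ident r (A 6))"
    unfolding PE_def of_nat_sum by (intro sum.cong) auto
  have F0: "F i = 0" if "N \<le> i" for i using that d by (simp add: F_def)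
  have "wp N (Sq reduce (SetR (14 + r) (Ar 8 (Cn 0)))) Q ?R (A(8 := F))"
  proof (rule wp_Sq, rule wp_reduce)
    fix f h assume f: "f 0 = (\<Sum>p<N. (A(8 := F)) 8 p)" "\<And>i. N \<le> i \<Longrightarrow> f i = 0"
    have "Q (R(12 := r, 13 := X, 14 + r := f 0)) (A(7 := h, 8 := f))" using Q[of "f 0" f h] S f by simp
    moreover have "A(8 := F, 7 := h, 8 := f) = A(7 := h, 8 := f)" by (auto simp: fun_eq_iff)
    ultimately show "wp N (SetR (14 + r) (Ar 8 (Cn 0))) Q (?R(13 := ?R 0)) (A(8 := F, 7 := h, 8 := f))"
      using r d by (intro wp_SetR) auto
  qed (use d F0 in auto)
  then have "wp N (Sq (Par 5 8 (Ad (mul 20 21 (formx 0) (Ar 3 (V 3))) (mul 20 21 (formx 1) (Ar 4 (V 3)))))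
      (Sq reduce (SetR (14 + r) (Ar 8 (Cn 0))))) Q ?R A"
    using d formx_static(1,2)[of 0] formx_static(1,2)[of 1]
    by - (rule wp_Sq, rule wp_Par, auto simp: F_def[abs_def])
  then show ?thesis unfolding estep_def by - (rule wp_Sq, rule wp_SetR, auto)
qed

text \<open>Both values of the bit are evaluated on the same signs. The signs are rewritten only for
  the better value, via array 7 because \<open>sgx\<close> reads array 6.\<close>

definition bitloop :: prog where
  "bitloop = Lp 11 0 (Sq (estep 0) (Sq (estep 1) (Sq (SetR 12 (Ls (V 15) (V 14)))
     (Sq (Par 5 7 (sgx (V 3))) (Par 5 6 (Ar 7 (V 3)))))))"

text \<open>Each occurrence carries its own copy of the state of its element. Updates depend only on
  the identifier and on the old copies at that occurrence, so equal identifiers keep equal copies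
  without communication.\<close>

definition consistent :: "nat \<Rightarrow> (nat \<Rightarrow> nat) \<Rightarrow> (nat \<Rightarrow> nat) \<Rightarrow> bool" where
  "consistent N ident s \<longleftrightarrow> (\<forall>q<N. \<forall>q'<N. ident q = ident q' \<longrightarrow> s q = s q')"

lemma sgx_static: "wfx e \<Longrightarrow> wfx (sgx e)" "arrs (sgx e) = {0, 6} \<union> arrs e"
  by (auto simp: sgx_def bitx_def idx_def dv_def)

lemma wp_bitloop:
  assumes c: "ctx N X g L ident Y W R A" and odd: "\<And>q. q < N \<Longrightarrow> odd (ident q div 2 ^ (X - 1))"
    and Wz: "\<And>k p. k < 2 \<Longrightarrow> N < p + L \<Longrightarrow> W k p = 0" and s0: "\<And>q. A 6 q < 2" "consistent N ident (A 6)"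
    and Q: "\<And>s f h a b c d. (\<And>q. s q < 2) \<Longrightarrow> consistent N ident s \<Longrightarrow> PE N X g L ident Y W X s \<le> PE N X g L ident Y W 0 (A 6) \<Longrightarrow>
       (\<And>i. N \<le> i \<Longrightarrow> f i = 0) \<Longrightarrow> Q (R(11 := X, 12 := a, 13 := b, 14 := c, 15 := d)) (A(6 := s, 7 := h, 8 := f))"
  shows "wp N bitloop Q R A"
  unfolding bitloop_def
proof (rule wp_Lp[where n = X and I = "\<lambda>i R' A'. \<exists>s f h a b c d. R' = R(11 := i, 12 := a, 13 := b, 14 := c, 15 := d) \<and>
     A' = A(6 := s, 7 := h, 8 := f) \<and> (\<forall>q. s q < 2) \<and> consistent N ident s \<and>
     PE N X g L ident Y W i s \<le> PE N X g L ident Y W 0 (A 6) \<and> (\<forall>i\<ge>N. f i = 0)"], goal_cases)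
  case 1
  show ?case using c s0
    by (intro exI[of _ "A 6"] exI[of _ "A 8"] exI[of _ "A 7"])
       (rule exI[of _ "R 12"], rule exI[of _ "R 13"], rule exI[of _ "R 14"], rule exI[of _ "R 15"], auto simp: ctx_def fun_eq_iff)
next
  case (2 i R1 A1)
  let ?PE = "PE N X g L ident Y W"
  from 2 obtain s f h a b c' d where I: "R1 = R(11 := i, 12 := a, 13 := b, 14 := c', 15 := d)"
     "A1 = A(6 := s, 7 := h, 8 := f)" "\<And>q. s q < 2" "consistent N ident s"
     "?PE i s \<le> ?PE 0 (A 6)" "\<And>i. N \<le> i \<Longrightarrow> f i = 0" by blast
  have c1: "ctx N X g L ident Y W R1 A1" using c I by (auto simp: ctx_def idf_def fun_eq_iff)
  have i: "i < X" "R1 11 = i" using 2 by auto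
  let ?Q = "\<lambda>R' A'. R' 11 = i \<and> (\<exists>s f h a b c d. R'(11 := Suc i) = R(11 := Suc i, 12 := a, 13 := b, 14 := c, 15 := d) \<and>
      A' = A(6 := s, 7 := h, 8 := f) \<and> (\<forall>q. s q < 2) \<and> consistent N ident s \<and>
      ?PE (Suc i) s \<le> ?PE 0 (A 6) \<and> (\<forall>i\<ge>N. f i = 0))"
  show ?case
  proof (rule wp_Sq, rule wp_estep[OF c1])
    fix e0 and f0 h0 :: "nat \<Rightarrow> nat" assume 3: "int e0 = ?PE (Suc (R1 11)) (sbit (R1 11) ident 0 (A1 6))" "\<And>i. N \<le> i \<Longrightarrow> f0 i = 0"
    let ?R2 = "R1(12 := 0, 13 := X, 14 + 0 := e0)" and ?A2 = "A1(7 := h0, 8 := f0)"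
    have c2: "ctx N X g L ident Y W ?R2 ?A2" using c1 3 by (auto simp: ctx_def idf_def fun_eq_iff)
    show "wp N (Sq (estep 1) (Sq (SetR 12 (Ls (V 15) (V 14))) (Sq (Par 5 7 (sgx (V 3))) (Par 5 6 (Ar 7 (V 3))))))
       ?Q ?R2 ?A2"
    proof (rule wp_Sq, rule wp_estep[OF c2])
      fix e1 and f1 h1 :: "nat \<Rightarrow> nat" assume 4: "int e1 = ?PE (Suc (?R2 11)) (sbit (?R2 11) ident 1 (?A2 6))" "\<And>i. N \<le> i \<Longrightarrow> f1 i = 0"
      let ?R3 = "?R2(12 := 1, 13 := X, 14 + 1 := e1)" and ?A3 = "?A2(7 := h1, 8 := f1)"
      define r :: nat where "r = (if e1 < e0 then 1 else 0)"
      let ?R4 = "?R3(12 := r)"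
      define s' where "s' q = (if q < N then sbit i ident r s q else s q)" for q
      define h' where "h' q = (if q < N then sbit i ident r s q else h1 q)" for q
      have e: "int e0 = ?PE (Suc i) (sbit i ident 0 s)" "int e1 = ?PE (Suc i) (sbit i ident 1 s)"
        using 3(1) 4(1) i I(2) by auto
      have "int e0 + int e1 = 2 * ?PE i s"
        unfolding e by (rule PE_average[OF i(1) I(3) odd Wz])
      moreover have "?PE (Suc i) (sbit i ident r s) = (if e1 < e0 then int e1 else int e0)"
        unfolding r_def using e by simp
      ultimately have "?PE (Suc i) (sbit i ident r s) \<le> ?PE i s" by auto
      moreover have "?PE (Suc i) s' = ?PE (Suc i) (sbit i ident r s)"
        by (rule PE_cong) (auto simp: s'_def Wz)
      ultimately have P: "?PE (Suc i) s' \<le> ?PE 0 (A 6)" using I(5) by linarith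
      have s': "s' q < 2" for q using I(3)[of q] by (auto simp: s'_def sbit_def)
      have cs: "consistent N ident s'" unfolding consistent_def
      proof (intro allI impI)
        fix q q' assume q: "q < N" "q' < N" "ident q = ident q'"
        then have "s q = s q'" using I(4) unfolding consistent_def by blast
        then show "s' q = s' q'" using q(1,2) unfolding s'_def sbit_def q(3) by simp
      qed
      have N: "?R4 5 = N" "?R4 1 \<le> ?R4 2" using c2 by (auto simp: ctx_def)
      have idf: "idf ?R4 ?A3 = ident" using c2 by (auto simp: ctx_def idf_def fun_eq_iff)
      have v1: "(\<lambda>p. if p < ?R4 5 then ev (sgx (V 3)) (?R4(3 := p)) ?A3 else ?A3 7 p) = h'"
      proof
        fix p
        have "ev (sgx (V 3)) (?R4(3 := p)) ?A3 = sbit i ident r s p"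
          using i idf I(2) c2 by (subst ev_sgx) (auto simp: ctx_def)
        then show "(if p < ?R4 5 then ev (sgx (V 3)) (?R4(3 := p)) ?A3 else ?A3 7 p) = h' p"
          using N by (auto simp: h'_def)
      qed
      have v2: "(\<lambda>p. if p < ?R4 5 then ev (Ar 7 (V 3)) (?R4(3 := p)) (?A3(7 := h')) else (?A3(7 := h')) 6 p) = s'"
        using N I(2) by (auto simp: s'_def h'_def fun_eq_iff)
      have fin: "?Q ?R4 (?A3(7 := h', 6 := s'))"
        using i P s' cs 4(2) unfolding I(1,2)
        by (intro conjI, simp, rule_tac exI[of _ s'], rule_tac exI[of _ f1], rule_tac exI[of _ h'], rule_tac exI[of _ r],
            rule_tac exI[of _ X], rule_tac exI[of _ e0], rule_tac exI[of _ e1]) (auto simp: fun_eq_iff)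
      have "wp N (Sq (Par 5 7 (sgx (V 3))) (Par 5 6 (Ar 7 (V 3)))) ?Q ?R4 ?A3"
        apply (rule wp_Sq, rule wp_Par)
               apply (simp add: sgx_static)
              apply simp
             apply simp
            apply (simp add: sgx_static)
           apply (simp only: N order.refl)
          apply simp
         apply (rule N)
        unfolding v1
        apply (rule wp_Par)
               apply simp
              apply simp
             apply simp
            apply simp
           apply (simp only: N order.refl)
          apply simp
         apply (rule N)
        unfolding v2
        apply (rule fin)
        done
      moreover have "?R3(12 := ev (Ls (V 15) (V 14)) ?R3 ?A3) = ?R4" by (simp add: r_def)
      ultimately show "wp N (Sq (SetR 12 (Ls (V 15) (V 14))) (Sq (Par 5 7 (sgx (V 3))) (Par 5 6 (Ar 7 (V 3)))))
       ?Q ?R3 ?A3"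
        by - (rule wp_Sq, rule wp_SetR, simp, simp, simp, simp only:)
    qed (use i in auto)
  qed (use i in auto)
next
  case (9 R' A')
  then show ?case using Q by blast
qed (use c in \<open>auto simp: ctx_def\<close>)

section \<open>The walk\<close>

definition ok_windows :: "nat \<Rightarrow> nat \<Rightarrow> (nat \<Rightarrow> nat) \<Rightarrow> (nat \<Rightarrow> bool) \<Rightarrow> bool" where
  "ok_windows N L ident ok \<longleftrightarrow> (\<forall>p. ok p \<longrightarrow> p + L \<le> N \<and> inj_on ident {p..<p+L})"

text \<open>The total weight is bounded from above and the weight of each window from below;
  together these limit the energy. The times \<open>\<tau>\<close> are not stored by the program and
  exist only in the proof.\<close>

definition Inv :: "nat \<Rightarrow> nat \<Rightarrow> nat \<Rightarrow> (nat \<Rightarrow> nat) \<Rightarrow> (nat \<Rightarrow> bool) \<Rightarrow> nat \<Rightarrow> (nat \<Rightarrow> nat) \<Rightarrow> (nat \<Rightarrow> nat \<Rightarrow> nat) \<Rightarrow> bool" where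
  "Inv N g L ident ok t Y W \<longleftrightarrow> (\<forall>q. Y q \<le> 2 * L) \<and> (\<forall>k<2. \<forall>p. W k p \<noteq> 0 \<longrightarrow> ok p) \<and> consistent N ident Y \<and>
     real (\<Sum>p<N. \<Sum>k<2. W k p) \<le> 2 * real N * (real g ^ 2 + 100 * real L ^ 3) ^ t \<and>
     (\<exists>\<tau>. (\<forall>q<N. Y q \<noteq> 0 \<longrightarrow> Y q \<noteq> 2 * L \<longrightarrow> \<tau> q = t) \<and>
       (\<forall>p. ok p \<longrightarrow> (\<forall>k<2. real g ^ (2 * t) * exp (energy L k \<tau> Y {p..<p+L} / g) \<le> real (W k p))))"

text \<open>With no bit fixed, only \<open>L\<close> squares of size at most \<open>(10 L)^2\<close>
  remain, because a window of positive weight has distinct identifiers.\<close>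

lemma PE_0_le:
  assumes "0 < X" "\<And>k p. k < 2 \<Longrightarrow> W k p \<noteq> 0 \<Longrightarrow> inj_on ident {p..<p+L}" "\<And>q. Y q \<le> 2 * L"
  shows "PE N X g L ident Y W 0 s \<le> int (\<Sum>p<N. \<Sum>k<2. W k p) * (int g ^ 2 + 100 * int L ^ 3)"
  unfolding PE_def of_nat_sum sum_distrib_right
proof (intro sum_mono)
  fix p k assume k: "k \<in> {..<2::nat}"
  show "int (W k p) * CF X g L ident 0 (ksg k) (xsg L Y k s) p \<le> int (W k p) * (int g ^ 2 + 100 * int L ^ 3)"
  proof (cases "W k p = 0")
    case False
    have "CF X g L ident 0 (ksg k) (xsg L Y k s) p = int g ^ 2 + (\<Sum>u\<in>{p..<p+L}. (xsg L Y k s u)\<^sup>2)"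
      using assms(1) grp_0[OF _ assms(2)[OF _ False], of "xsg L Y k s"] k by (simp add: CF_def)
    also have "(\<Sum>u\<in>{p..<p+L}. (xsg L Y k s u)\<^sup>2) \<le> of_nat (card {p..<p+L}) * (10 * int L)\<^sup>2"
    proof (rule sum_bounded_above)
      fix u
      have "\<bar>xsg L Y k s u\<bar> \<le> 10 * int L" using mag_le[OF assms(3), of k u] by (auto simp: xsg_def sgz_def)
      then show "(xsg L Y k s u)\<^sup>2 \<le> (10 * int L)\<^sup>2" by (metis abs_ge_zero power2_abs power_mono)
    qed
    also have "of_nat (card {p..<p+L}) * (10 * int L)\<^sup>2 = 100 * int L ^ 3" by (simp add: power2_eq_square power3_eq_cube)
    finally show ?thesis by (intro mult_left_mono) auto
  qed simp
qed

text \<open>The total grows by at most the averaged factor, whereas each single weight is multiplied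
  by exactly \<open>g^2 (1 + z + z^2)\<close>, at least \<open>g^2 exp z\<close>, where
  \<open>z\<close> is the increment of \<open>energy / g\<close>.\<close>

lemma Inv_step:
  assumes I: "Inv N g L ident ok t Y W" and okw: "ok_windows N L ident ok" and X: "0 < X" and g: "20 * L * L \<le> g" "0 < L"
    and idt: "\<And>q. q < N \<Longrightarrow> ident q div 2 ^ (X - 1) = 1"
    and s: "\<And>q. s q < 2" "consistent N ident s" "PE N X g L ident Y W X s \<le> PE N X g L ident Y W 0 s0"
    and W': "\<And>k p. k < 2 \<Longrightarrow> p < N \<Longrightarrow> int (W' k p) = int (W k p) * CF X g L ident X (ksg k) (xsg L Y k s) p"
       "\<And>k p. k < 2 \<Longrightarrow> N \<le> p \<Longrightarrow> W' k p = W k p"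
    and Y': "\<And>q. q < N \<Longrightarrow> Y' q = walk L (Y q) (sgz (s q))" "\<And>q. N \<le> q \<Longrightarrow> Y' q = Y q"
  shows "Inv N g L ident ok (Suc t) Y' W'"
proof -
  obtain \<tau> where *: "\<And>q. Y q \<le> 2 * L" "\<And>k p. k < 2 \<Longrightarrow> W k p \<noteq> 0 \<Longrightarrow> ok p" "consistent N ident Y"
    "real (\<Sum>p<N. \<Sum>k<2. W k p) \<le> 2 * real N * (real g ^ 2 + 100 * real L ^ 3) ^ t"
    "\<And>q. q < N \<Longrightarrow> Y q \<noteq> 0 \<Longrightarrow> Y q \<noteq> 2 * L \<Longrightarrow> \<tau> q = t"
    "\<And>k p. ok p \<Longrightarrow> k < 2 \<Longrightarrow> real g ^ (2 * t) * exp (energy L k \<tau> Y {p..<p+L} / g) \<le> real (W k p)"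
    using I unfolding Inv_def by blast
  have ok: "p + L \<le> N" "inj_on ident {p..<p+L}" if "ok p" for p using okw that unfolding ok_windows_def by auto
  have y: "Y' q \<le> 2 * L" for q using Y'[of q] *(1)[of q] walk_le[of "Y q" L] by (cases "q < N") auto
  have w: "ok p" if "k < 2" "W' k p \<noteq> 0" for k p
  proof (rule ccontr)
    assume "\<not> ok p"
    then have "W k p = 0" using *(2) that(1) by blast
    then have "W' k p = 0" using W'[OF that(1), of p] by (cases "p < N") auto
    then show False using that(2) by simp
  qed
  have cons: "consistent N ident Y'" unfolding consistent_def
  proof (intro allI impI)
    fix q q' assume q: "q < N" "q' < N" "ident q = ident q'"
    then have "Y q = Y q'" "s q = s q'" using *(3) s(2) unfolding consistent_def by blast+
    then show "Y' q = Y' q'" using q Y' by simp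
  qed
  have "int (\<Sum>p<N. \<Sum>k<2. W' k p) = PE N X g L ident Y W X s"
    unfolding PE_def of_nat_sum using W' by (intro sum.cong refl) auto
  also have "\<dots> \<le> int (\<Sum>p<N. \<Sum>k<2. W k p) * (int g ^ 2 + 100 * int L ^ 3)"
    using s(3) PE_0_le[OF X, of W ident L Y N g s0] *(1,2) ok(2) by force
  finally have "real_of_int (int (\<Sum>p<N. \<Sum>k<2. W' k p)) \<le> real_of_int (int (\<Sum>p<N. \<Sum>k<2. W k p) * (int g ^ 2 + 100 * int L ^ 3))"
    by (simp only: of_int_le_iff)
  then have "real (\<Sum>p<N. \<Sum>k<2. W' k p) \<le> real (\<Sum>p<N. \<Sum>k<2. W k p) * (real g ^ 2 + 100 * real L ^ 3)"
    by simp
  also have "\<dots> \<le> 2 * real N * (real g ^ 2 + 100 * real L ^ 3) ^ t * (real g ^ 2 + 100 * real L ^ 3)"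
    using *(4) by (intro mult_right_mono) auto
  finally have tot: "real (\<Sum>p<N. \<Sum>k<2. W' k p) \<le> 2 * real N * (real g ^ 2 + 100 * real L ^ 3) ^ Suc t"
    by (simp add: mult_ac)
  define \<tau>' where "\<tau>' u = (if Y u = 0 \<or> Y u = 2 * L then \<tau> u else Suc (\<tau> u))" for u
  have t1: "\<tau>' q = Suc t" if "q < N" "Y' q \<noteq> 0" "Y' q \<noteq> 2 * L" for q
  proof -
    have "Y q \<noteq> 0 \<and> Y q \<noteq> 2 * L"
    proof (rule ccontr)
      assume n: "\<not> (Y q \<noteq> 0 \<and> Y q \<noteq> 2 * L)"
      then have "Y' q = Y q" using Y'(1)[OF that(1)] by (simp add: walk_def)
      then show False using n that(2,3) by simp
    qed
    then show ?thesis using *(5)[OF that(1)] by (simp add: \<tau>'_def)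
  qed
  have t2: "real g ^ (2 * Suc t) * exp (energy L k \<tau>' Y' {p..<p+L} / g) \<le> real (W' k p)" if p: "ok p" and k: "k < 2" for p k
  proof -
    let ?I = "{p..<p+L}"
    have pN: "p < N" "\<And>u. u \<in> ?I \<Longrightarrow> u < N" using ok[OF p] g by auto
    define Z where "Z = ksg k * (\<Sum>u\<in>?I. int (mag L k (Y u)) * sgz (s u))"
    have g0: "0 < real g"
    proof -
      have "0 < L * L" using g by simp
      then show ?thesis using g(1) unfolding mult.assoc by linarith
    qed
    have "energy L k \<tau>' Y' ?I = energy L k \<tau>' (\<lambda>u. walk L (Y u) (sgz (s u))) ?I"
      unfolding energy_def using pN Y' by (intro sum.cong refl) auto
    also have "\<dots> = energy L k \<tau> Y ?I + of_int Z" unfolding \<tau>'_def Z_def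
      by (rule energy_walk) (auto simp: sgz_def *(1))
    finally have E: "energy L k \<tau>' Y' ?I / g = energy L k \<tau> Y ?I / g + of_int Z / g" by (simp add: add_divide_distrib)
    \<comment> \<open>Identifiers are below \<open>2^X\<close>, so once all bits are fixed every
      pair counts and the quadratic term is a full square.\<close>
    have idX: "ident u div 2 ^ X = 0" if "u \<in> ?I" for u
    proof -
      have "ident u div 2 ^ X = ident u div 2 ^ (X - 1) div 2"
        using X by (metis Suc_diff_1 power_Suc2 div_mult2_eq)
      then show ?thesis using idt[OF pN(2)[OF that]] by simp
    qed
    have ks: "ksg k * ksg k = 1" by (simp add: ksg_def)
    have "CF X g L ident X (ksg k) (xsg L Y k s) p = int g ^ 2 + int g * Z + (\<Sum>u\<in>?I. xsg L Y k s u)\<^sup>2"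
      using grp_top[of ?I ident X "xsg L Y k s"] idX by (simp add: CF_def Z_def xsg_def mult_ac)
    also have "(\<Sum>u\<in>?I. xsg L Y k s u)\<^sup>2 = Z\<^sup>2"
      using ks by (simp add: Z_def xsg_def power2_eq_square mult_ac)
    finally have CF: "real_of_int (CF X g L ident X (ksg k) (xsg L Y k s) p) = real g ^ 2 * (1 + of_int Z / g + (of_int Z / g)\<^sup>2)"
      using g0 by (simp add: field_simps power2_eq_square)
    have "\<bar>ksg k\<bar> = 1" by (simp add: ksg_def)
    then have "\<bar>Z\<bar> = \<bar>\<Sum>u\<in>?I. int (mag L k (Y u)) * sgz (s u)\<bar>" by (simp add: Z_def abs_mult)
    also have "\<dots> \<le> (\<Sum>u\<in>?I. \<bar>int (mag L k (Y u)) * sgz (s u)\<bar>)" by (rule sum_abs)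
    also have "\<dots> \<le> of_nat (card ?I) * (10 * int L)"
    proof (rule sum_bounded_above)
      fix u show "\<bar>int (mag L k (Y u)) * sgz (s u)\<bar> \<le> 10 * int L"
        using mag_le[OF *(1), of k u] by (auto simp: sgz_def)
    qed
    also have "\<dots> = int (10 * (L * L))" by simp
    also have "\<dots> \<le> int g" using g(1) unfolding mult.assoc by linarith
    finally have "\<bar>of_int Z / real g\<bar> \<le> 1" using g0 by (simp add: field_simps)
    note q = exp_le_quadratic[OF this]
    have "real g ^ (2 * Suc t) * exp (energy L k \<tau>' Y' ?I / g) =
        (real g ^ (2 * t) * exp (energy L k \<tau> Y ?I / g)) * (real g ^ 2 * exp (of_int Z / g))"
      unfolding E exp_add by (simp add: power_add power2_eq_square mult_ac)
    also have "\<dots> \<le> real (W k p) * (real g ^ 2 * (1 + of_int Z / g + (of_int Z / g)\<^sup>2))"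
      using *(6)[OF p k] q g0 by (intro mult_mono mult_left_mono) auto
    also have "\<dots> = real_of_int (int (W' k p))" unfolding W'(1)[OF k pN(1)] of_int_mult CF by simp
    finally show ?thesis by simp
  qed
  show ?thesis unfolding Inv_def using y w cons tot t1 t2 by (intro conjI exI[of _ \<tau>']) auto
qed

definition walkx :: hx where
  "walkx = Sb (Ad (Ar 5 (V 3)) (andx (actx (V 3)) (Ar 6 (V 3)))) (andx (actx (V 3)) (Ls (Ar 6 (V 3)) (Cn 1)))"

text \<open>With bit index \<open>X - 1\<close> and tentative value 0, \<open>formx\<close>
  evaluates the form of index \<open>X\<close> on the signs as they stand, so the expression for the
  conditional expectation also yields the true weight factor. Both weights are computed before the
  positions move.\<close>

definition update :: prog where
  "update = Sq (SetR 11 (Sb (V 0) (Cn 1))) (Sq (SetR 12 (Cn 0)) (Sq (Par 5 7 (mul 20 21 (formx 0) (Ar 3 (V 3))))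
     (Sq (Par 5 8 (mul 20 21 (formx 1) (Ar 4 (V 3)))) (Sq (Par 5 3 (Ar 7 (V 3))) (Sq (Par 5 4 (Ar 8 (V 3)))
     (Sq (Par 5 7 walkx) (Par 5 5 (Ar 7 (V 3)))))))))"

lemma ev_walkx: "A 6 (R 3) < 2 \<Longrightarrow> ev walkx R A = walk (R 6) (A 5 (R 3)) (sgz (A 6 (R 3)))"
  by (auto simp: walkx_def walk_def sgz_def)

lemma walkx_static: "wfx walkx" "arrs walkx = {5, 6}"
  by (auto simp: walkx_def actx_def)

lemma wp_update:
  assumes c: "ctx N X g L ident Y W R A" and s: "\<And>q. A 6 q < 2"
    and Q: "\<And>W' Y' f h. (\<And>k p. k < 2 \<Longrightarrow> p < N \<Longrightarrow> int (W' k p) = int (W k p) * CF X g L ident X (ksg k) (xsg L Y k (A 6)) p) \<Longrightarrow>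
       (\<And>k p. k < 2 \<Longrightarrow> N \<le> p \<Longrightarrow> W' k p = W k p) \<Longrightarrow>
       (\<And>q. q < N \<Longrightarrow> Y' q = walk L (Y q) (sgz (A 6 q))) \<Longrightarrow> (\<And>q. N \<le> q \<Longrightarrow> Y' q = Y q) \<Longrightarrow> (\<And>i. N \<le> i \<Longrightarrow> f i = 0) \<Longrightarrow>
       Q (R(11 := X - 1, 12 := 0)) (A(3 := W' 0, 4 := W' 1, 5 := Y', 7 := h, 8 := f))"
  shows "wp N update Q R A"
proof -
  note d = c[unfolded ctx_def]
  note b = ctx_bounds[OF c]
  let ?R = "R(11 := X - 1, 12 := 0)"
  have R: "?R 5 = N" "?R 1 \<le> ?R 2" "?R 5 \<le> N" using d by auto
  have cR: "ctx N X g L ident Y W (?R(3 := p)) A'" if "A' = A(7 := h)" for p A' h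
    using c that by (auto simp: ctx_def idf_def fun_eq_iff)
  have sb: "sbit (X - 1) ident 0 (A 6) = A 6"
  proof
    fix q show "sbit (X - 1) ident 0 (A 6) q = A 6 q" using s[of q] by (auto simp: sbit_def)
  qed
  have F: "int (ev (mul 20 21 (formx k) (Ar (3 + k) (V 3))) (?R(3 := p)) A') = int (W k p) * CF X g L ident X (ksg k) (xsg L Y k (A 6)) p"
    if k: "k < 2" and A': "A' = A(7 := h)" for k p h A'
  proof -
    note f = ctx_formx[OF cR[OF A', of p] _ k]
    have X1: "(?R(3 := p)) 11 < X" "Suc (X - 1) = X" using b by auto
    have m: "min (ev (formx k) (?R(3 := p)) A') ((?R(3 := p)) 0) = ev (formx k) (?R(3 := p)) A'"
      using f(2)[OF X1(1)] d by simp
    have w: "A' (3 + k) p = W k p" using k A' d by (auto simp: less_2_cases_iff)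
    have "ev (mul 20 21 (formx k) (Ar (3 + k) (V 3))) (?R(3 := p)) A' = ev (formx k) (?R(3 := p)) A' * W k p"
      by (subst ev_mul) (auto simp: m[simplified] w)
    then show ?thesis using f(1)[OF X1(1)] X1 A' sb by (simp add: mult.commute)
  qed
  define h where "h p = (if p < N then ev (mul 20 21 (formx 0) (Ar 3 (V 3))) (?R(3 := p)) A else A 7 p)" for p
  define f where "f p = (if p < N then ev (mul 20 21 (formx 1) (Ar 4 (V 3))) (?R(3 := p)) (A(7 := h)) else A 8 p)" for p
  define W' where "W' k p = (if p < N then (if k = 0 then h p else f p) else W k p)" for k p
  define h2 where "h2 p = (if p < N then walk L (Y p) (sgz (A 6 p)) else h p)" for p
  define Y' where "Y' p = (if p < N then h2 p else Y p)" for p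
  have fin: "Q ?R (A(3 := W' 0, 4 := W' 1, 5 := Y', 7 := h2, 8 := f))"
  proof (rule Q)
    fix k p :: nat assume "k < 2" "p < N"
    then show "int (W' k p) = int (W k p) * CF X g L ident X (ksg k) (xsg L Y k (A 6)) p"
      using F[of 0 A "A 7" p] F[of 1 "A(7 := h)" h p] by (auto simp: W'_def h_def f_def less_2_cases_iff)
  qed (use d in \<open>auto simp: W'_def Y'_def h2_def f_def\<close>)
  let ?p4 = "Sq (Par 5 7 walkx) (Par 5 5 (Ar 7 (V 3)))"
  let ?p3 = "Sq (Par 5 4 (Ar 8 (V 3))) ?p4"
  let ?p2 = "Sq (Par 5 3 (Ar 7 (V 3))) ?p3"
  let ?p1 = "Sq (Par 5 8 (mul 20 21 (formx 1) (Ar 4 (V 3)))) ?p2"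
  let ?p0 = "Sq (Par 5 7 (mul 20 21 (formx 0) (Ar 3 (V 3)))) ?p1"
  let ?A1 = "A(7 := h)" let ?A2 = "?A1(8 := f)" let ?A3 = "?A2(3 := W' 0)" let ?A4 = "?A3(4 := W' 1)" let ?A5 = "?A4(7 := h2)"
  have "A(3 := W' 0, 4 := W' 1, 5 := Y', 7 := h2, 8 := f) = ?A5(5 := Y')" by (auto simp: fun_eq_iff)
  then have "Q ?R (?A5(5 := Y'))" using fin by simp
  moreover have "?A5(5 := \<lambda>p. if p < ?R 5 then ev (Ar 7 (V 3)) (?R(3 := p)) ?A5 else ?A5 5 p) = ?A5(5 := Y')"
    using d by (auto simp: Y'_def fun_eq_iff)
  ultimately have 5: "wp N (Par 5 5 (Ar 7 (V 3))) Q ?R ?A5" by - (rule wp_Par, use R in auto)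
  have "?A4(7 := \<lambda>p. if p < ?R 5 then ev walkx (?R(3 := p)) ?A4 else ?A4 7 p) = ?A5"
    using d s by (auto simp: h2_def fun_eq_iff ev_walkx)
  with 5 have 4: "wp N ?p4 Q ?R ?A4"
    by - (rule wp_Sq, rule wp_Par, use R walkx_static in auto)
  have "?A3(4 := \<lambda>p. if p < ?R 5 then ev (Ar 8 (V 3)) (?R(3 := p)) ?A3 else ?A3 4 p) = ?A4"
    using d by (auto simp: W'_def fun_eq_iff)
  with 4 have 3: "wp N ?p3 Q ?R ?A3"
    by - (rule wp_Sq, rule wp_Par, use R in auto)
  have "?A2(3 := \<lambda>p. if p < ?R 5 then ev (Ar 7 (V 3)) (?R(3 := p)) ?A2 else ?A2 3 p) = ?A3"
    using d by (auto simp: W'_def fun_eq_iff)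
  with 3 have 2: "wp N ?p2 Q ?R ?A2"
    by - (rule wp_Sq, rule wp_Par, use R in auto)
  have e: "?A1(8 := \<lambda>p. if p < ?R 5 then ev (mul 20 21 (formx 1) (Ar 4 (V 3))) (?R(3 := p)) ?A1 else ?A1 8 p) = ?A2"
    using d by (auto simp: f_def fun_eq_iff)
  have st: "wfx (mul 20 21 (formx k) (Ar (3 + k) (V 3)))" "7 \<notin> arrs (mul 20 21 (formx k) (Ar (3 + k) (V 3)))"
    "8 \<notin> arrs (mul 20 21 (formx k) (Ar (3 + k) (V 3)))" if "k < 2" for k
    using formx_static(1,2)[of k] that by auto
  have 1: "wp N ?p1 Q ?R ?A1"
    by (rule wp_Sq, rule wp_Par, unfold e) (use R 2 st[of 1] in auto)
  have e: "A(7 := \<lambda>p. if p < ?R 5 then ev (mul 20 21 (formx 0) (Ar 3 (V 3))) (?R(3 := p)) A else A 7 p) = ?A1"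
    using d by (auto simp: h_def fun_eq_iff)
  have 0: "wp N ?p0 Q ?R A"
    by (rule wp_Sq, rule wp_Par, unfold e) (use R 1 st[of 0] in auto)
  have R': "R(11 := ev (Sb (V 0) (Cn 1)) R A, 12 := ev (Cn 0) (R(11 := ev (Sb (V 0) (Cn 1)) R A)) A) = ?R" using d by simp
  show ?thesis unfolding update_def
    apply (rule wp_Sq, rule wp_SetR, simp, simp, simp)
    apply (rule wp_Sq, rule wp_SetR, simp, simp, simp)
    unfolding R' by (rule 0)
qed

text \<open>Resetting the sign bits to 0 means that no bit of the random vector is fixed yet; every
  bit chosen as 1 then flips the signs of the identifiers containing it.\<close>

definition step :: prog where
  "step = Sq (Par 5 6 (Cn 0)) (Sq bitloop update)"

lemma back_subst2: "Q R A \<Longrightarrow> R = R' \<Longrightarrow> A = A' \<Longrightarrow> Q R' A'"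
  by simp

lemma wp_step:
  assumes c: "ctx N X g L ident Y W R A" and s: "\<And>q. A 6 q < 2" and I: "Inv N g L ident ok t Y W"
    and okw: "ok_windows N L ident ok" and idt: "\<And>q. q < N \<Longrightarrow> ident q div 2 ^ (X - 1) = 1"
    and Q: "\<And>W' Y' s f h a b c d e. Inv N g L ident ok (Suc t) Y' W' \<Longrightarrow> (\<And>q. s q < 2) \<Longrightarrow> (\<And>i. N \<le> i \<Longrightarrow> f i = 0) \<Longrightarrow>
       Q (R(11 := a, 12 := b, 13 := c, 14 := d, 15 := e)) (A(3 := W' 0, 4 := W' 1, 5 := Y', 6 := s, 7 := h, 8 := f))"
  shows "wp N step Q R A"
proof -
  note d = c[unfolded ctx_def]
  define s0 where "s0 q = (if q < N then 0 else A 6 q)" for q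
  have W0: "\<And>k p. k < 2 \<Longrightarrow> N < p + L \<Longrightarrow> W k p = 0"
    using I okw unfolding Inv_def ok_windows_def by (metis not_le)
  have e: "A(6 := \<lambda>p. if p < R 5 then ev (Cn 0) (R(3 := p)) A else A 6 p) = A(6 := s0)"
    using d by (auto simp: s0_def fun_eq_iff)
  have c0: "ctx N X g L ident Y W R (A(6 := s0))" using c by (auto simp: ctx_def idf_def fun_eq_iff)
  have "wp N (Sq bitloop update) Q R (A(6 := s0))"
  proof (rule wp_Sq, rule wp_bitloop[OF c0])
    fix s1 f h :: "nat \<Rightarrow> nat" and a b c' d'
    assume 1: "\<And>q. s1 q < 2" "consistent N ident s1" "PE N X g L ident Y W X s1 \<le> PE N X g L ident Y W 0 ((A(6 := s0)) 6)"
      "\<And>i. N \<le> i \<Longrightarrow> f i = 0"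
    let ?R = "R(11 := X, 12 := a, 13 := b, 14 := c', 15 := d')" and ?A = "A(6 := s0, 6 := s1, 7 := h, 8 := f)"
    have c1: "ctx N X g L ident Y W ?R ?A" using c 1(4) by (auto simp: ctx_def idf_def fun_eq_iff)
    show "wp N update Q ?R ?A"
    proof (rule wp_update[OF c1])
      fix W' :: "nat \<Rightarrow> nat \<Rightarrow> nat" and Y' f' h' :: "nat \<Rightarrow> nat"
      assume 2: "\<And>k p. k < 2 \<Longrightarrow> p < N \<Longrightarrow> int (W' k p) = int (W k p) * CF X g L ident X (ksg k) (xsg L Y k (?A 6)) p"
        "\<And>k p. k < 2 \<Longrightarrow> N \<le> p \<Longrightarrow> W' k p = W k p" "\<And>q. q < N \<Longrightarrow> Y' q = walk L (Y q) (sgz (?A 6 q))"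
        "\<And>q. N \<le> q \<Longrightarrow> Y' q = Y q" "\<And>i. N \<le> i \<Longrightarrow> f' i = 0"
      have "?A 6 = s1" by simp
      note 2 = 2[unfolded this]
      have X: "0 < X" using ctx_bounds[OF c] by simp
      have g: "20 * L * L \<le> g" "0 < L" using d by auto
      have "Inv N g L ident ok (Suc t) Y' W'"
        by (rule Inv_step[OF I okw X g idt 1(1,2,3) 2(1-4)])
      from Q[OF this 1(1) 2(5), where a = "X - 1" and b = 0 and c = b and d = c' and e = d' and h = h']
      show "Q (?R(11 := X - 1, 12 := 0)) (?A(3 := W' 0, 4 := W' 1, 5 := Y', 7 := h', 8 := f'))"
        by (rule back_subst2[where Q = Q]) (auto simp: fun_eq_iff)
    qed (use 1 in auto)
  qed (use idt W0 s in \<open>auto simp: s0_def consistent_def\<close>)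
  then show ?thesis unfolding step_def
    by - (rule wp_Sq, rule wp_Par, use d in \<open>auto simp: e\<close>)
qed

definition mainloop :: prog where "mainloop = Lp 10 8 step"

lemma wp_mainloop:
  assumes c: "ctx N X g L ident Y W R A" and s: "\<And>q. A 6 q < 2" and I: "Inv N g L ident ok 0 Y W"
    and okw: "ok_windows N L ident ok" and idt: "\<And>q. q < N \<Longrightarrow> ident q div 2 ^ (X - 1) = 1" and T: "R 8 = T" "T \<le> X"
    and Q: "\<And>W' Y' s f h a b c d e. Inv N g L ident ok T Y' W' \<Longrightarrow>
       Q (R(10 := T, 11 := a, 12 := b, 13 := c, 14 := d, 15 := e)) (A(3 := W' 0, 4 := W' 1, 5 := Y', 6 := s, 7 := h, 8 := f))"
  shows "wp N mainloop Q R A"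
  unfolding mainloop_def
proof (rule wp_Lp[where n = T and I = "\<lambda>t R' A'. \<exists>W' Y' s f h a b c d e. R' = R(10 := t, 11 := a, 12 := b, 13 := c, 14 := d, 15 := e) \<and>
     A' = A(3 := W' 0, 4 := W' 1, 5 := Y', 6 := s, 7 := h, 8 := f) \<and> Inv N g L ident ok t Y' W' \<and> (\<forall>q. s q < 2) \<and> (\<forall>i\<ge>N. f i = 0)"], goal_cases)
  case 1
  have "R(10 := 0) = R(10 := 0, 11 := R 11, 12 := R 12, 13 := R 13, 14 := R 14, 15 := R 15)" by (auto simp: fun_eq_iff)
  moreover have "A = A(3 := W 0, 4 := W 1, 5 := Y, 6 := A 6, 7 := A 7, 8 := A 8)" using c by (auto simp: fun_eq_iff ctx_def)
  moreover have "\<forall>i\<ge>N. A 8 i = 0" using c by (simp add: ctx_def)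
  ultimately show ?case using I s by blast
next
  case (2 t R1 A1)
  then obtain W' Y' s f h a b c' d e where 3: "R1 = R(10 := t, 11 := a, 12 := b, 13 := c', 14 := d, 15 := e)"
    "A1 = A(3 := W' 0, 4 := W' 1, 5 := Y', 6 := s, 7 := h, 8 := f)" "Inv N g L ident ok t Y' W'" "\<And>q. s q < 2" "\<And>i. N \<le> i \<Longrightarrow> f i = 0" by blast
  have "\<forall>q. Y' q \<le> 2 * L" using 3(3) by (simp add: Inv_def)
  then have c1: "ctx N X g L ident Y' W' R1 A1" using c 3 by (auto simp: ctx_def idf_def fun_eq_iff)
  show ?case
  proof (rule wp_step[OF c1 _ 3(3) okw idt])
    fix W1 :: "nat \<Rightarrow> nat \<Rightarrow> nat" and Y1 s1 f1 h1 :: "nat \<Rightarrow> nat" and a1 b1 c1 d1 e1 :: nat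
    assume 4: "Inv N g L ident ok (Suc t) Y1 W1" "\<And>q. s1 q < 2" "\<And>i. N \<le> i \<Longrightarrow> f1 i = 0"
    let ?R = "R1(11 := a1, 12 := b1, 13 := c1, 14 := d1, 15 := e1)" and ?A = "A1(3 := W1 0, 4 := W1 1, 5 := Y1, 6 := s1, 7 := h1, 8 := f1)"
    have r: "?R(10 := Suc t) = R(10 := Suc t, 11 := a1, 12 := b1, 13 := c1, 14 := d1, 15 := e1)" "?R 10 = t" unfolding 3(1) by (auto simp: fun_eq_iff)
    have a: "?A = A(3 := W1 0, 4 := W1 1, 5 := Y1, 6 := s1, 7 := h1, 8 := f1)" unfolding 3(2) by (auto simp: fun_eq_iff)
    show "?R 10 = t \<and> (\<exists>W' Y' s f h a b c d e. ?R(10 := Suc t) = R(10 := Suc t, 11 := a, 12 := b, 13 := c, 14 := d, 15 := e) \<and>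
      ?A = A(3 := W' 0, 4 := W' 1, 5 := Y', 6 := s, 7 := h, 8 := f) \<and> Inv N g L ident ok (Suc t) Y' W' \<and> (\<forall>q. s q < 2) \<and> (\<forall>i\<ge>N. f i = 0))"
      using r a 4 by blast
  qed (use 3 in auto)
next
  case (9 R1 A1)
  then show ?case using Q by blast
qed (use c T in \<open>auto simp: ctx_def\<close>)

section \<open>Initialisation and selection of first occurrences\<close>

text \<open>A window lies inside one list if no list starts strictly inside it, which can be tested
  on start marks alone. The conjunct \<open>V 31\<close> exempts offset 0, where a start is
  allowed.\<close>

definition okx :: hx where
  "okx = andx (Ls (Ad (V 3) (V 6)) (Ad (V 5) (Cn 1))) (Ls (summ 30 31 (V 6) (andx (V 31) (Ar 2 (posx 31)))) (Cn 1))"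

definition setup_regs :: "nat \<Rightarrow> prog" where
  "setup_regs c = Sq (SetR 9 (Ar 0 (Cn 1))) (Sq (SetR 4 (Ad (V 9) (Cn 3))) (Sq (SetR 5 (Sb (V 1) (V 4)))
     (Sq (SetR 6 (tm c (V 16))) (Sq (SetR 7 (tm 3200 (mul 20 21 (V 6) (V 6)))) (SetR 8 (tm 16 (mul 20 21 (V 6) (V 6))))))))"

definition setup_arrays :: prog where
  "setup_arrays = Sq (Ph 9 2 (Cn 1) (Sb (Ar 0 (Ad (V 3) (Cn 2))) (V 4)) (Cn 1)) (Sq (Par 5 3 okx) (Sq (Par 5 4 okx) (Par 5 5 (V 6))))"

definition okw :: "nat \<Rightarrow> nat \<Rightarrow> (nat \<Rightarrow> nat) \<Rightarrow> nat \<Rightarrow> bool" where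
  "okw N L mk p \<longleftrightarrow> p + L \<le> N \<and> (\<forall>i<L. i \<noteq> 0 \<longrightarrow> mk (p + i) = 0)"

lemma okx_static: "wfx okx" "arrs okx = {2}"
  by (auto simp: okx_def)

lemma ev_okx: "R 6 \<le> R 0 \<Longrightarrow> ev okx R A = (if okw (R 5) (R 6) (A 2) (R 3) then 1 else 0)"
proof -
  assume "R 6 \<le> R 0"
  then have m: "min (R 6) (R 0) = R 6" by simp
  have "ev (summ 30 31 (V 6) (andx (V 31) (Ar 2 (posx 31)))) R A = (\<Sum>i<R 6. if i \<noteq> 0 \<and> A 2 (R 3 + i) \<noteq> 0 then 1 else 0)"
    by (subst ev_summ) (auto simp: m intro!: sum.cong)
  then show ?thesis unfolding okx_def by (auto simp: okw_def)
qed

lemma wp_setup_regs: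
  assumes m: "A 0 1 = m" "R 16 = b" "R 1 = m + 3 + N" "c * b \<le> R 0" and L: "L = c * b"
    and Q: "Q (R(9 := m, 4 := m + 3, 5 := N, 6 := L, 7 := 3200 * L\<^sup>2, 8 := 16 * L\<^sup>2)) A"
  shows "wp N (setup_regs c) Q R A"
proof -
  let ?R1 = "R(9 := m, 4 := m + 3, 5 := N, 6 := L)"
  have m': "ev (mul 20 21 (V 6) (V 6)) R' A = (R' 6)\<^sup>2" if "R' 6 \<le> R' 0" for R'
    using that by (subst ev_mul) (auto simp: power2_eq_square)
  let ?p5 = "SetR 8 (tm 16 (mul 20 21 (V 6) (V 6)))"
  let ?p4 = "Sq (SetR 7 (tm 3200 (mul 20 21 (V 6) (V 6)))) ?p5"
  let ?p3 = "Sq (SetR 6 (tm c (V 16))) ?p4"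
  let ?p2 = "Sq (SetR 5 (Sb (V 1) (V 4))) ?p3"
  let ?p1 = "Sq (SetR 4 (Ad (V 9) (Cn 3))) ?p2"
  have 1: "wp N ?p5 Q (?R1(7 := 3200 * L\<^sup>2)) A"
    by (rule wp_SetR) (use Q m L m'[of "?R1(7 := 3200 * L\<^sup>2)"] in auto)
  have 2: "wp N ?p4 Q ?R1 A"
    by (rule wp_Sq, rule wp_SetR) (use 1 m L m'[of ?R1] in auto)
  have 3: "wp N ?p3 Q (R(9 := m, 4 := m + 3, 5 := N)) A"
    by (rule wp_Sq, rule wp_SetR) (use 2 m L in auto)
  have 4: "wp N ?p2 Q (R(9 := m, 4 := m + 3)) A"
    by (rule wp_Sq, rule wp_SetR) (use 3 m L in auto)
  have 5: "wp N ?p1 Q (R(9 := m)) A"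
    by (rule wp_Sq, rule wp_SetR) (use 4 m L in \<open>auto simp: numeral_3_eq_3\<close>)
  show ?thesis unfolding setup_regs_def
    by (rule wp_Sq, rule wp_SetR) (use 5 m L in auto)
qed

lemma wp_setup_arrays:
  assumes R: "R 9 = m" "R 4 = m + 3" "R 5 = N" "R 6 = L" "L \<le> R 0" "R 1 \<le> R 2" "m \<le> N"
    and a: "\<And>i. i < m \<Longrightarrow> m + 3 \<le> A 0 (i + 2)" "inj_on (\<lambda>i. A 0 (i + 2)) {..<m}" and A: "A 2 = (\<lambda>_. 0)" "A 3 = (\<lambda>_. 0)" "A 4 = (\<lambda>_. 0)" "A 5 = (\<lambda>_. 0)"
    and Q: "\<And>mk. (\<And>q. mk q \<noteq> 0 \<longleftrightarrow> (\<exists>i<m. A 0 (i + 2) = m + 3 + q)) \<Longrightarrow>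
      Q R (A(2 := mk, 3 := (\<lambda>p. if p < N \<and> okw N L mk p then 1 else 0), 4 := (\<lambda>p. if p < N \<and> okw N L mk p then 1 else 0), 5 := (\<lambda>p. if p < N then L else 0)))"
  shows "wp N setup_arrays Q R A"
  unfolding setup_arrays_def
proof (rule wp_Sq, rule wp_Ph)
  show "inj_on (\<lambda>p. ev (Sb (Ar 0 (Ad (V 3) (Cn 2))) (V 4)) (R(3 := p)) A) {p. p < R 9 \<and> ev (Cn 1) (R(3 := p)) A \<noteq> 0}"
  proof (rule inj_onI, goal_cases)
    case (1 x y)
    then have "x < m" "y < m" "A 0 (x + 2) - (m + 3) = A 0 (y + 2) - (m + 3)" using R by auto
    then have "A 0 (x + 2) = A 0 (y + 2)" using a(1)[of x] a(1)[of y] by linarith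
    then show "x = y" using a(2) \<open>x < m\<close> \<open>y < m\<close> by (auto dest: inj_onD)
  qed
next
  fix f assume f: "\<forall>p<R 9. ev (Cn 1) (R(3 := p)) A \<noteq> 0 \<longrightarrow> f (ev (Sb (Ar 0 (Ad (V 3) (Cn 2))) (V 4)) (R(3 := p)) A) = ev (Cn 1) (R(3 := p)) A"
    "\<forall>a. (\<forall>p<R 9. ev (Cn 1) (R(3 := p)) A \<noteq> 0 \<longrightarrow> ev (Sb (Ar 0 (Ad (V 3) (Cn 2))) (V 4)) (R(3 := p)) A \<noteq> a) \<longrightarrow> f a = A 2 a"
  have f1: "f (A 0 (i + 2) - (m + 3)) = 1" if "i < m" for i using f(1) R that by auto
  have f2: "f q = 0" if "\<And>i. i < m \<Longrightarrow> A 0 (i + 2) - (m + 3) \<noteq> q" for q using f(2) R that A by auto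
  have mk: "f q \<noteq> 0 \<longleftrightarrow> (\<exists>i<m. A 0 (i + 2) = m + 3 + q)" for q
  proof
    assume "f q \<noteq> 0"
    then have "\<exists>i<m. A 0 (i + 2) - (m + 3) = q" using f2[of q] by (intro ccontr[of "\<exists>i<m. A 0 (i + 2) - (m + 3) = q"]) simp
    then obtain i where "i < m" "A 0 (i + 2) - (m + 3) = q" by blast
    then show "\<exists>i<m. A 0 (i + 2) = m + 3 + q" using a(1)[of i] by (intro exI[of _ i]) linarith
  next
    assume "\<exists>i<m. A 0 (i + 2) = m + 3 + q"
    then obtain i where "i < m" "A 0 (i + 2) = m + 3 + q" by blast
    then show "f q \<noteq> 0" using f1[of i] by simp
  qed
  let ?W = "\<lambda>p. if p < N \<and> okw N L f p then 1 else 0 :: nat"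
  let ?A1 = "A(2 := f)" let ?A2 = "?A1(3 := ?W)" let ?A3 = "?A2(4 := ?W)"
  have e1: "?A1(3 := \<lambda>p. if p < R 5 then ev okx (R(3 := p)) ?A1 else ?A1 3 p) = ?A2"
    using R A by (auto simp: fun_eq_iff ev_okx)
  have e2: "?A2(4 := \<lambda>p. if p < R 5 then ev okx (R(3 := p)) ?A2 else ?A2 4 p) = ?A3"
    using R A by (auto simp: fun_eq_iff ev_okx)
  have e3: "?A3(5 := \<lambda>p. if p < R 5 then ev (V 6) (R(3 := p)) ?A3 else ?A3 5 p) = ?A3(5 := \<lambda>p. if p < N then L else 0)"
    using R A by (auto simp: fun_eq_iff)
  have 3: "wp N (Par 5 5 (V 6)) Q R ?A3" by (rule wp_Par, unfold e3) (use R Q[OF mk] in auto)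
  have 2: "wp N (Sq (Par 5 4 okx) (Par 5 5 (V 6))) Q R ?A2" by (rule wp_Sq, rule wp_Par, unfold e2) (use R 3 in \<open>auto simp: okx_static\<close>)
  show "wp N (Sq (Par 5 3 okx) (Sq (Par 5 4 okx) (Par 5 5 (V 6)))) Q R ?A1"
    by (rule wp_Sq, rule wp_Par, unfold e1) (use R 2 in \<open>auto simp: okx_static\<close>)
qed (use R in auto)

text \<open>All walks start at the centre, where both energies vanish, so weight 1 suffices for each
  admissible start and each of the two signs.\<close>

lemma Inv_0:
  assumes "0 < L" "\<And>p. ok p \<longleftrightarrow> p < N \<and> okw N L mk p"
  shows "Inv N g L ident ok 0 (\<lambda>p. if p < N then L else 0) (\<lambda>k p. if p < N \<and> okw N L mk p then 1 else 0)"
proof -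
  have "energy L k (\<lambda>_. 0) (\<lambda>p. if p < N then L else 0) {p..<p+L} = 0" if "ok p" for p k
    unfolding energy_def using that assms by (intro sum.neutral) (auto simp: okw_def)
  moreover have "(\<Sum>p<N. \<Sum>k<2::nat. if p < N \<and> okw N L mk p then 1 else 0) \<le> (\<Sum>p<N. \<Sum>k<2::nat. 1::nat)"
    by (intro sum_mono) auto
  then have "real (\<Sum>p<N. \<Sum>k<2::nat. if p < N \<and> okw N L mk p then 1 else 0) \<le> real (\<Sum>p<N. \<Sum>k<2::nat. 1::nat)"
    by (simp only: of_nat_le_iff)
  then have "real (\<Sum>p<N. \<Sum>k<2::nat. if p < N \<and> okw N L mk p then 1 else 0) \<le> 2 * real N"
    by (rule order_trans) simp
  ultimately show ?thesis unfolding Inv_def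
    using assms by (intro conjI exI[of _ "\<lambda>_. 0"]) (auto simp: consistent_def)
qed

section \<open>Tournament for first occurrences\<close>

definition tix :: "hx \<Rightarrow> hx" where
  "tix i = Ad (shl (shl (shr (V 3) i) i) (V 0)) (dv (V 3))"

text \<open>A block of length \<open>2^(i + 1)\<close> has the same start, hence the same table
  address, as its left half. An entry found there means that the element occurs in the left half,
  and a candidate in the right half must give way.\<close>

definition leadx :: hx where
  "leadx = andx (Ar 10 (V 3)) (Ls (andx (bitx (V 3) (V 13)) (Ar 11 (tix (Ad (V 13) (Cn 1))))) (Cn 1))"

definition dedup :: prog where
  "dedup = Sq (Par 5 10 (Cn 1)) (Sq (Ph 5 11 (Cn 1) (tix (Cn 0)) (Cn 1))
     (Lp 13 0 (Sq (Par 5 7 leadx) (Sq (Par 5 10 (Ar 7 (V 3))) (Ph 5 11 (Ar 10 (V 3)) (tix (Ad (V 13) (Cn 1))) (Cn 1))))))"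

text \<open>The table entry for the element \<open>x\<close> in the block that starts at \<open>s\<close> has the index \<open>s * 2 ^ X + x\<close>.\<close>

definition first_in_block :: "(nat \<Rightarrow> nat) \<Rightarrow> nat \<Rightarrow> nat \<Rightarrow> bool" where
  "first_in_block v i p \<longleftrightarrow> (\<forall>q<p. q div 2 ^ i = p div 2 ^ i \<longrightarrow> v q \<noteq> v p)"

lemma tix_static: "wfx i \<Longrightarrow> wfx (tix i)" "arrs (tix i) = {0} \<union> arrs i" "fv (tix i) = {0, 3, 4} \<union> fv i"
  by (auto simp: tix_def dv_def)

lemma ev_tix: "ev i R A \<le> R 0 \<Longrightarrow> ev (tix i) R A = R 3 div 2 ^ ev i R A * 2 ^ ev i R A * 2 ^ R 0 + A 0 (R 4 + R 3)"
  by (simp add: tix_def min_def)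

lemma leadx_static: "wfx leadx" "arrs leadx = {0, 10, 11}"
  by (auto simp: leadx_def bitx_def tix_static)

lemma pair_index_inj: "a * 2 ^ X + b = c * 2 ^ X + d \<Longrightarrow> b < 2 ^ X \<Longrightarrow> d < 2 ^ X \<Longrightarrow> a = c \<and> b = (d::nat)"
proof -
  assume e: "a * 2 ^ X + b = c * 2 ^ X + d" and l: "b < 2 ^ X" "d < 2 ^ X"
  have "(a * 2 ^ X + b) div 2 ^ X = a" "(c * 2 ^ X + d) div 2 ^ X = c" using l by simp_all
  then have "a = c" using e by metis
  then show ?thesis using e by simp
qed

text \<open>An earlier position in the doubled block lies in the same half, or in the left half
  while \<open>p\<close> is in the right half.\<close>

lemma first_in_block_Suc:
  assumes "p < N"
  shows "first_in_block v (Suc i) p \<longleftrightarrow> first_in_block v i p \<and>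
     \<not> (odd (p div 2 ^ i) \<and> (\<exists>q<N. q div 2 ^ i = 2 * (p div 2 ^ Suc i) \<and> v q = v p))"
proof -
  have d: "q div 2 ^ Suc i = q div 2 ^ i div 2" for q :: nat by (simp only: power_Suc2 div_mult2_eq)
  have m: "q div 2 ^ i \<le> p div 2 ^ i" if "q < p" for q using that by (simp add: div_le_mono)
  have k: "x div 2 = y div 2 \<longleftrightarrow> x = y \<or> (odd y \<and> x = 2 * (y div 2))" if "x \<le> y" for x y :: nat
    using that by presburger
  have 1: "q div 2 ^ Suc i = p div 2 ^ Suc i \<longleftrightarrow> q div 2 ^ i = p div 2 ^ i \<or> (odd (p div 2 ^ i) \<and> q div 2 ^ i = 2 * (p div 2 ^ Suc i))" if "q < p" for q
    unfolding d by (rule k[OF m[OF that]])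
  have 2: "q < p" if "odd (p div 2 ^ i)" "q div 2 ^ i = 2 * (p div 2 ^ Suc i)" for q
  proof (rule ccontr)
    assume "\<not> q < p"
    then have "p div 2 ^ i \<le> q div 2 ^ i" by (simp add: div_le_mono)
    moreover have "2 * (x div 2) < x" if "odd x" for x :: nat using that by presburger
    from this[OF that(1)] have "2 * (p div 2 ^ i div 2) < p div 2 ^ i" .
    ultimately show False using that(2) unfolding d by simp
  qed
  have 3: "q < N" if "q < p" for q using that assms by simp
  show ?thesis unfolding first_in_block_def using 1 2 3 by blast
qed

lemma wp_dedup:
  assumes R: "R 5 = N" "R 1 \<le> R 2" "N \<le> 2 ^ X" "R 0 = X" and v: "\<And>q. v q = A 0 (R 4 + q)" "\<And>q. q < N \<Longrightarrow> v q < 2 ^ X" and A: "A 11 = (\<lambda>_. 0)"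
    and Q: "\<And>ld f t. (\<And>p. p < N \<Longrightarrow> ld p \<noteq> 0 \<longleftrightarrow> (\<forall>q<p. v q \<noteq> v p)) \<Longrightarrow> Q (R(13 := X)) (A(7 := f, 10 := ld, 11 := t))"
  shows "wp N dedup Q R A"
proof -
  let ?tix = "tix (Ad (V 13) (Cn 1))"
  let ?ph = "Ph 5 11 (Ar 10 (V 3)) ?tix (Cn 1)"
  let ?loop = "Lp 13 0 (Sq (Par 5 7 leadx) (Sq (Par 5 10 (Ar 7 (V 3))) ?ph))"
  \<comment> \<open>The invariant speaks only of blocks aligned at the current level; entries of
    former right halves stay in the table but are never read again.\<close>
  define I where "I i R' A' \<longleftrightarrow> R' = R(13 := i) \<and> (\<exists>ld f t. A' = A(7 := f, 10 := ld, 11 := t) \<and>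
     (\<forall>p<N. ld p \<noteq> 0 \<longleftrightarrow> first_in_block v i p) \<and>
     (\<forall>s w. w < 2 ^ X \<longrightarrow> (t (s * 2 ^ i * 2 ^ X + w) \<noteq> 0 \<longleftrightarrow> (\<exists>q<N. q div 2 ^ i = s \<and> v q = w))))" for i R' A'
  have Iw: "I i R' A'" if "R' = R(13 := i)" "A' = A(7 := f, 10 := ld, 11 := t)" "\<And>p. p < N \<Longrightarrow> ld p \<noteq> 0 \<longleftrightarrow> first_in_block v i p"
    "\<And>s w. w < 2 ^ X \<Longrightarrow> t (s * 2 ^ i * 2 ^ X + w) \<noteq> 0 \<longleftrightarrow> (\<exists>q<N. q div 2 ^ i = s \<and> v q = w)" for i R' A' f ld t
    unfolding I_def using that by blast
  define ix where "ix i p = p div 2 ^ i * 2 ^ i * 2 ^ X + v p" for i p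
  have ix_inj: "s = p div 2 ^ i \<and> w = v p" if "s * 2 ^ i * 2 ^ X + w = ix i p" "w < 2 ^ X" "p < N" for s i p w
    using pair_index_inj[of "s * 2 ^ i" X w "p div 2 ^ i * 2 ^ i" "v p"] that v(2)[OF that(3)] by (auto simp: ix_def)
  have loop: "wp N ?loop Q R0 A0"
    if I0: "I 0 (R0(13 := 0)) A0" and R0: "R0 0 = X" for R0 A0
  proof (rule wp_Lp[where n = X and I = I], rule I0, goal_cases)
    case (1 i R1 A1)
    then obtain ld f t where *: "R1 = R(13 := i)" "A1 = A(7 := f, 10 := ld, 11 := t)" "\<And>p. p < N \<Longrightarrow> ld p \<noteq> 0 \<longleftrightarrow> first_in_block v i p"
      "\<And>s w. w < 2 ^ X \<Longrightarrow> t (s * 2 ^ i * 2 ^ X + w) \<noteq> 0 \<longleftrightarrow> (\<exists>q<N. q div 2 ^ i = s \<and> v q = w)"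
      unfolding I_def by blast
    have i: "Suc i \<le> R1 0" "i \<le> R1 0" using 1 * R by auto
    have R1: "R1 5 = N" "R1 1 \<le> R1 2" "R1 5 \<le> N" using * R by auto
    have tx: "ev ?tix (R1(3 := p)) A' = ix (Suc i) p" if "A' 0 = A 0" for p A'
      using i * R that by (subst ev_tix) (auto simp: ix_def v(1))
    have told: "t (ix (Suc i) p) \<noteq> 0 \<longleftrightarrow> (\<exists>q<N. q div 2 ^ i = 2 * (p div 2 ^ Suc i) \<and> v q = v p)" if "p < N" for p
      using *(4)[of "v p" "2 * (p div 2 ^ Suc i)"] v(2)[OF that] by (simp add: ix_def mult_ac)
    define h where "h p = (if p < N then ev leadx (R1(3 := p)) A1 else f p)" for p
    define ld' where "ld' p = (if p < N then h p else ld p)" for p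
    have ld': "ld' p \<noteq> 0 \<longleftrightarrow> first_in_block v (Suc i) p" if "p < N" for p
    proof -
      have l: "ld' p = ev leadx (R1(3 := p)) A1" using that by (simp add: ld'_def h_def)
      have "ev leadx (R1(3 := p)) A1 \<noteq> 0 \<longleftrightarrow> ld p \<noteq> 0 \<and> \<not> (odd (p div 2 ^ i) \<and> t (ix (Suc i) p) \<noteq> 0)"
        unfolding leadx_def using tx[of A1 p] *(1,2) i by (auto simp: odd_iff_mod_2_eq_one)
      then show ?thesis unfolding l first_in_block_Suc[OF that] told[OF that] *(3)[OF that] .
    qed
    let ?A1 = "A1(7 := h)" let ?A2 = "?A1(10 := ld')"
    have e1: "A1(7 := \<lambda>p. if p < R1 5 then ev leadx (R1(3 := p)) A1 else A1 7 p) = ?A1"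
      using R1 *(2) by (auto simp: h_def fun_eq_iff)
    have e2: "?A1(10 := \<lambda>p. if p < R1 5 then ev (Ar 7 (V 3)) (R1(3 := p)) ?A1 else ?A1 10 p) = ?A2"
      using R1 *(2) by (auto simp: ld'_def fun_eq_iff)
    have A2: "?A2 0 = A 0" using *(2) by simp
    have tx2: "ev ?tix (R1(3 := p)) ?A2 = ix (Suc i) p" for p by (rule tx[of ?A2 p, OF A2])
    have gd: "ev (Ar 10 (V 3)) (R1(3 := p)) ?A2 = ld' p" for p by simp
    have 3: "wp N ?ph (\<lambda>R A. R 13 = i \<and> I (Suc i) (R(13 := Suc i)) A) R1 ?A2"
    proof (rule wp_Ph)
      show "inj_on (\<lambda>p. ev ?tix (R1(3 := p)) ?A2) {p. p < R1 5 \<and> ev (Ar 10 (V 3)) (R1(3 := p)) ?A2 \<noteq> 0}"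
        unfolding tx2 gd R1(1)
      proof (rule inj_onI)
        fix x y assume "x \<in> {p. p < N \<and> ld' p \<noteq> 0}" "y \<in> {p. p < N \<and> ld' p \<noteq> 0}" and e: "ix (Suc i) x = ix (Suc i) y"
        then have xy: "x < N" "y < N" "first_in_block v (Suc i) x" "first_in_block v (Suc i) y" using ld' by auto
        have "x div 2 ^ Suc i = y div 2 ^ Suc i \<and> v x = v y"
          using ix_inj[of "x div 2 ^ Suc i" "Suc i" "v x" y] e v(2)[OF xy(1)] xy(2) unfolding ix_def by blast
        \<comment> \<open>Two surviving candidates for the same element in one block would both be
          first in it.\<close>
        then show "x = y" using xy(3,4) unfolding first_in_block_def by (metis linorder_neqE_nat)
      qed
    next
      fix t' assume t': "\<forall>p<R1 5. ev (Ar 10 (V 3)) (R1(3 := p)) ?A2 \<noteq> 0 \<longrightarrow> t' (ev ?tix (R1(3 := p)) ?A2) = ev (Cn 1) (R1(3 := p)) ?A2"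
        "\<forall>a. (\<forall>p<R1 5. ev (Ar 10 (V 3)) (R1(3 := p)) ?A2 \<noteq> 0 \<longrightarrow> ev ?tix (R1(3 := p)) ?A2 \<noteq> a) \<longrightarrow> t' a = ?A2 11 a"
      note t' = t'[unfolded tx2 gd R1(1)]
      have "t' (s * 2 ^ Suc i * 2 ^ X + w) \<noteq> 0 \<longleftrightarrow> (\<exists>q<N. q div 2 ^ Suc i = s \<and> v q = w)" if w: "w < 2 ^ X" for s w
      proof
        assume nz: "t' (s * 2 ^ Suc i * 2 ^ X + w) \<noteq> 0"
        show "\<exists>q<N. q div 2 ^ Suc i = s \<and> v q = w"
        proof (cases "\<exists>p<N. ld' p \<noteq> 0 \<and> ix (Suc i) p = s * 2 ^ Suc i * 2 ^ X + w")
          case True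
          then obtain p where p: "p < N" "s * 2 ^ Suc i * 2 ^ X + w = ix (Suc i) p" by metis
          show ?thesis using ix_inj[OF p(2) w p(1)] p(1) by blast
        next
          case False
          \<comment> \<open>An entry not written in this round stems from the left half, which is
            block \<open>2 s\<close> of the previous level.\<close>
          then have "t' (s * 2 ^ Suc i * 2 ^ X + w) = ?A2 11 (s * 2 ^ Suc i * 2 ^ X + w)" using t'(2) by blast
          then have "t (2 * s * 2 ^ i * 2 ^ X + w) \<noteq> 0" using nz *(2) by (simp add: mult_ac)
          then obtain q where "q < N" "q div 2 ^ i = 2 * s" "v q = w" using *(4)[OF w] by blast
          moreover have "q div 2 ^ Suc i = q div 2 ^ i div 2" by (simp only: power_Suc2 div_mult2_eq)
          ultimately show ?thesis by auto
        qed
      next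
        assume "\<exists>q<N. q div 2 ^ Suc i = s \<and> v q = w"
        then have "\<exists>q. q < N \<and> q div 2 ^ Suc i = s \<and> v q = w" by blast
        then obtain q where q: "q < N \<and> q div 2 ^ Suc i = s \<and> v q = w" and min: "\<And>q'. q' < q \<Longrightarrow> \<not> (q' < N \<and> q' div 2 ^ Suc i = s \<and> v q' = w)"
          using exists_least_iff[of "\<lambda>q. q < N \<and> q div 2 ^ Suc i = s \<and> v q = w"] by blast
        \<comment> \<open>The first occurrence in the block survives the round and therefore writes
          the entry.\<close>
        have "first_in_block v (Suc i) q" unfolding first_in_block_def
        proof (intro allI impI)
          fix q' assume q': "q' < q" "q' div 2 ^ Suc i = q div 2 ^ Suc i"
          have "q' < N" using q q'(1) by linarith
          then show "v q' \<noteq> v q" using min[OF q'(1)] q q'(2) by auto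
        qed
        then have "ld' q \<noteq> 0" using ld' q by blast
        then have "t' (ix (Suc i) q) = 1" using t'(1) q by simp
        moreover have "ix (Suc i) q = s * 2 ^ Suc i * 2 ^ X + w" using q by (simp add: ix_def)
        ultimately show "t' (s * 2 ^ Suc i * 2 ^ X + w) \<noteq> 0" by simp
      qed
      then have "I (Suc i) (R1(13 := Suc i)) (?A2(11 := t'))"
        using ld' *(1,2) by (intro Iw[where f = h and ld = ld' and t = t']) (auto simp: fun_eq_iff)
      then show "R1 13 = i \<and> I (Suc i) (R1(13 := Suc i)) (?A2(11 := t'))" using *(1) by simp
    qed (use R1 in \<open>auto simp: tix_static\<close>)
    have 2: "wp N (Sq (Par 5 10 (Ar 7 (V 3))) ?ph) (\<lambda>R A. R 13 = i \<and> I (Suc i) (R(13 := Suc i)) A) R1 ?A1"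
      by (rule wp_Sq, rule wp_Par, unfold e2) (use R1 3 in auto)
    show ?case
      by (rule wp_Sq, rule wp_Par, unfold e1) (use R1 2 in \<open>auto simp: leadx_static\<close>)
  next
    case (8 R1 A1)
    then obtain ld f t where *: "R1 = R(13 := X)" "A1 = A(7 := f, 10 := ld, 11 := t)" "\<And>p. p < N \<Longrightarrow> ld p \<noteq> 0 \<longleftrightarrow> first_in_block v X p"
      unfolding I_def by blast
    have z: "p div 2 ^ X = 0" if "p < N" for p using that R by simp
    have "ld p \<noteq> 0 \<longleftrightarrow> (\<forall>q<p. v q \<noteq> v p)" if "p < N" for p
      unfolding *(3)[OF that] first_in_block_def using z that by (metis order.strict_trans)
    then show ?case using Q * by simp
  qed (use R0 R in \<open>auto simp: I_def\<close>)
  let ?ld = "\<lambda>p. if p < R 5 then ev (Cn 1) (R(3 := p)) A else A 10 p"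
  let ?A1 = "A(10 := ?ld)"
  have tx0: "ev (tix (Cn 0)) (R(3 := p)) ?A1 = ix 0 p" for p using R by (subst ev_tix) (auto simp: ix_def v(1))
  have 1: "wp N (Sq (Ph 5 11 (Cn 1) (tix (Cn 0)) (Cn 1)) ?loop) Q R ?A1"
  proof (rule wp_Sq, rule wp_Ph)
    show "inj_on (\<lambda>p. ev (tix (Cn 0)) (R(3 := p)) ?A1) {p. p < R 5 \<and> ev (Cn 1) (R(3 := p)) ?A1 \<noteq> 0}"
    proof (rule inj_onI, goal_cases)
      case (1 x y)
      then have "x < N" "y < N" "ix 0 x = ix 0 y" unfolding tx0 using R(1) by auto
      then show "x = y" using ix_inj[of x 0 "v x" y] v(2)[of x] by (simp add: ix_def)
    qed
  next
    fix t assume t: "\<forall>p<R 5. ev (Cn 1) (R(3 := p)) ?A1 \<noteq> 0 \<longrightarrow> t (ev (tix (Cn 0)) (R(3 := p)) ?A1) = ev (Cn 1) (R(3 := p)) ?A1"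
      "\<forall>a. (\<forall>p<R 5. ev (Cn 1) (R(3 := p)) ?A1 \<noteq> 0 \<longrightarrow> ev (tix (Cn 0)) (R(3 := p)) ?A1 \<noteq> a) \<longrightarrow> t a = ?A1 11 a"
    note t = t[unfolded tx0]
    have "t (s * 2 ^ 0 * 2 ^ X + w) \<noteq> 0 \<longleftrightarrow> (\<exists>q<N. q div 2 ^ 0 = s \<and> v q = w)" if w: "w < 2 ^ X" for s w
    proof
      assume nz: "t (s * 2 ^ 0 * 2 ^ X + w) \<noteq> 0"
      have "\<exists>p<N. ix 0 p = s * 2 ^ 0 * 2 ^ X + w"
      proof (rule ccontr)
        assume "\<not> ?thesis"
        then have "t (s * 2 ^ 0 * 2 ^ X + w) = ?A1 11 (s * 2 ^ 0 * 2 ^ X + w)" using t(2) R(1) by blast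
        then show False using nz A by simp
      qed
      then obtain p where p: "p < N" "s * 2 ^ 0 * 2 ^ X + w = ix 0 p" by metis
      show "\<exists>q<N. q div 2 ^ 0 = s \<and> v q = w" using ix_inj[OF p(2) w p(1)] p(1) by blast
    next
      assume "\<exists>q<N. q div 2 ^ 0 = s \<and> v q = w"
      then obtain q where q: "q < N" "q = s" "v q = w" by auto
      then have "t (ix 0 q) = 1" using t(1) R(1) by simp
      moreover have "ix 0 q = s * 2 ^ 0 * 2 ^ X + w" using q by (simp add: ix_def)
      ultimately show "t (s * 2 ^ 0 * 2 ^ X + w) \<noteq> 0" by simp
    qed
    then have "I 0 (R(13 := 0)) (?A1(11 := t))"
      using R(1) by (intro Iw[where f = "A 7" and ld = ?ld and t = t]) (auto simp: fun_eq_iff first_in_block_def)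
    then show "wp N ?loop Q R (?A1(11 := t))"
      using R by (intro loop) auto
  qed (use R in \<open>auto simp: tix_static\<close>)
  show ?thesis unfolding dedup_def by (rule wp_Sq, rule wp_Par) (use R 1 in auto)
qed

section \<open>The whole computation\<close>

definition main :: "nat \<Rightarrow> prog" where
  "main c = Sq (setup_regs c) (Sq setup_arrays (Sq mainloop dedup))"

lemma Inv_balanced:
  assumes I: "Inv N g L ident ok T Y W" and L: "0 < L" "g = 3200 * L\<^sup>2" "T = 16 * L\<^sup>2" and N: "6400 * ln (2 * real N) \<le> L"
    and p: "ok p" "p + L \<le> N"
  shows "L \<le> 4 * card {u \<in> {p..<p+L}. Y u = 2 * L}" "L \<le> 4 * card {u \<in> {p..<p+L}. Y u = 0}"
proof -
  obtain \<tau> where *: "\<And>q. Y q \<le> 2 * L"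
    "real (\<Sum>p<N. \<Sum>k<2. W k p) \<le> 2 * real N * (real g ^ 2 + 100 * real L ^ 3) ^ T"
    "\<And>q. q < N \<Longrightarrow> Y q \<noteq> 0 \<Longrightarrow> Y q \<noteq> 2 * L \<Longrightarrow> \<tau> q = T"
    "\<And>k p. ok p \<Longrightarrow> k < 2 \<Longrightarrow> real g ^ (2 * T) * exp (energy L k \<tau> Y {p..<p+L} / g) \<le> real (W k p)"
    using I unfolding Inv_def by blast
  have pN: "p < N" "1 \<le> real N" using p L by auto
  have W: "real g ^ (2 * T) * exp (energy L k \<tau> Y {p..<p+L} / g) \<le> 2 * real N * (real g ^ 2 + 100 * real L ^ 3) ^ T" if k: "k < 2" for k
  proof -
    have "W k p \<le> (\<Sum>k<2. W k p)" using k by (intro member_le_sum) auto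
    also have "\<dots> \<le> (\<Sum>p<N. \<Sum>k<2. W k p)" using pN by (intro member_le_sum[of p "{..<N}" "\<lambda>p. \<Sum>k<2. W k p"]) auto
    finally have "real (W k p) \<le> real (\<Sum>p<N. \<Sum>k<2. W k p)" by (simp only: of_nat_le_iff)
    then show ?thesis using *(2) *(4)[OF p(1) k] by linarith
  qed
  have t: "\<tau> u = T" if "u \<in> {p..<p+L}" "Y u \<noteq> 0" "Y u \<noteq> 2 * L" for u using *(3) that p by auto
  have "finite {p..<p+L}" "card {p..<p+L} = L" by auto
  note b = window_balanced[OF L pN(2) N this *(1) t W]
  show "L \<le> 4 * card {u \<in> {p..<p+L}. Y u = 2 * L}" "L \<le> 4 * card {u \<in> {p..<p+L}. Y u = 0}"
    using b by auto
qed

definition walks_done :: "nat \<Rightarrow> nat \<Rightarrow> nat \<Rightarrow> (nat \<Rightarrow> nat) \<Rightarrow> (nat \<Rightarrow> bool) \<Rightarrow> (nat \<Rightarrow> nat) \<Rightarrow> store \<Rightarrow> arrays \<Rightarrow> bool" where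
  "walks_done N L m v good inp R' A' \<longleftrightarrow> R' 4 = m + 3 \<and> R' 5 = N \<and> R' 6 = L \<and> A' 0 = inp \<and>
      (\<forall>p<N. A' 10 p \<noteq> 0 \<longleftrightarrow> (\<forall>q<p. v q \<noteq> v p)) \<and> consistent N v (A' 5) \<and>
      (\<forall>p. good p \<longrightarrow> L \<le> 4 * card {u \<in> {p..<p+L}. A' 5 u = 2 * L} \<and> L \<le> 4 * card {u \<in> {p..<p+L}. A' 5 u = 0})"

lemma wp_main:
  assumes R: "R 0 = X" "R 1 = m + 3 + N" "R 1 \<le> R 2" "R 16 = b" and L: "L = c * b" "1 \<le> L" "2 * (3200 * L\<^sup>2)\<^sup>2 \<le> X"
    and N: "N \<le> 2 ^ X" "m \<le> N" "6400 * ln (2 * real N) \<le> L"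
    and A: "A 0 1 = m" "\<And>j. 0 < j \<Longrightarrow> j < 16 \<Longrightarrow> A j = (\<lambda>_. 0)"
    and v: "\<And>q. v q = A 0 (m + 3 + q)" "\<And>q. q < N \<Longrightarrow> v q < 2 ^ (X - 1)"
    and a: "\<And>i. i < m \<Longrightarrow> A 0 (i + 2) = m + 3 + off i" "inj_on off {..<m}"
    and good: "\<And>p. good p \<longleftrightarrow> p + L \<le> N \<and> (\<forall>i<L. i \<noteq> 0 \<longrightarrow> p + i \<notin> off ` {..<m})"
    and dist: "\<And>p. good p \<Longrightarrow> inj_on v {p..<p+L}"
  shows "wp N (main c) (walks_done N L m v good (A 0)) R A"
    (is "wp N _ ?Q R A")
proof -
  define g where "g = 3200 * L\<^sup>2" define T where "T = 16 * L\<^sup>2"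
  have LL: "L \<le> L\<^sup>2" using L(2) by (simp add: power2_eq_square)
  have gX: "2 * g\<^sup>2 \<le> X" using L(3) by (simp add: g_def)
  have "g * 1 \<le> g * g" using LL L(2) by (intro mult_left_mono) (auto simp: g_def)
  then have g1: "g \<le> X" using gX unfolding power2_eq_square by linarith
  have TX: "T \<le> X" "L \<le> X" using g1 LL unfolding g_def T_def by linarith+
  have LX: "c * b \<le> R 0" using TX L R by simp
  define ident where "ident q = v q + 2 ^ (X - 1)" for q
  have X1: "Suc (X - 1) = X" using TX(2) L(2) by linarith
  let ?R1 = "R(9 := m, 4 := m + 3, 5 := N, 6 := L, 7 := g, 8 := T)"
  show ?thesis unfolding main_def
  proof (rule wp_Sq, rule wp_setup_regs[where R = R and A = A, OF A(1) R(4,2) LX L(1)], fold g_def T_def, rule wp_Sq, rule wp_setup_arrays[where R = ?R1 and m = m and N = N and L = L and A = A])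
    fix mk :: "nat \<Rightarrow> nat" assume mk: "\<And>q. mk q \<noteq> 0 \<longleftrightarrow> (\<exists>i<m. A 0 (i + 2) = m + 3 + q)"
    define Y where "Y = (\<lambda>p. if p < N then L else 0)"
    define W where "W = (\<lambda>(k::nat) p. if p < N \<and> okw N L mk p then 1 else (0::nat))"
    let ?A1 = "A(2 := mk, 3 := (\<lambda>p. if p < N \<and> okw N L mk p then 1 else 0), 4 := (\<lambda>p. if p < N \<and> okw N L mk p then 1 else 0), 5 := (\<lambda>p. if p < N then L else 0))"
    have mk': "mk q = 0 \<longleftrightarrow> q \<notin> off ` {..<m}" for q
      using mk[of q] a(1) by auto
    have ok: "good p \<longleftrightarrow> p < N \<and> okw N L mk p" for p unfolding good okw_def mk' using L(2) by auto
    have idf: "idf ?R1 ?A1 = ident" using v R by (auto simp: idf_def ident_def fun_eq_iff)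
    have c: "ctx N X g L ident Y W ?R1 ?A1" unfolding ctx_def idf
      using R A N gX L(2) by (auto simp: Y_def W_def g_def power2_eq_square)
    have I: "Inv N g L ident good 0 Y W" unfolding Y_def W_def using L(2) by (intro Inv_0[OF _ ok]) simp
    have okw: "ok_windows N L ident good"
      unfolding ok_windows_def
    proof (intro allI impI conjI)
      fix p assume p: "good p"
      show "p + L \<le> N" using p unfolding good by blast
      show "inj_on ident {p..<p+L}"
        by (rule inj_onI, rule inj_onD[OF dist[OF p]]) (simp_all add: ident_def)
    qed
    \<comment> \<open>Elements are below \<open>2^(X - 1)\<close>, so the added power is exactly the
      top bit.\<close>
    have idt: "ident q div 2 ^ (X - 1) = 1" if "q < N" for q
      using v(2)[OF that] by (simp add: ident_def)
    show "wp N (Sq mainloop dedup) ?Q ?R1 ?A1"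
    proof (rule wp_Sq, rule wp_mainloop[OF c _ I okw idt, of T])
      fix W' :: "nat \<Rightarrow> nat \<Rightarrow> nat" and Y' s f h :: "nat \<Rightarrow> nat" and a1 b1 c1 d1 e1 :: nat
      assume I': "Inv N g L ident good T Y' W'"
      let ?R2 = "?R1(10 := T, 11 := a1, 12 := b1, 13 := c1, 14 := d1, 15 := e1)"
      let ?A2 = "?A1(3 := W' 0, 4 := W' 1, 5 := Y', 6 := s, 7 := h, 8 := f)"
      show "wp N dedup ?Q ?R2 ?A2"
      proof (rule wp_dedup[where X = X and v = v])
        fix ld f t :: "nat \<Rightarrow> nat" assume ld: "\<And>p. p < N \<Longrightarrow> ld p \<noteq> 0 \<longleftrightarrow> (\<forall>q<p. v q \<noteq> v p)"
        have "consistent N ident Y'" using I' by (simp add: Inv_def)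
        then have 1: "consistent N v Y'" unfolding consistent_def ident_def by (simp only: add_right_cancel)
        have 2: "L \<le> 4 * card {u \<in> {p..<p+L}. Y' u = 2 * L} \<and> L \<le> 4 * card {u \<in> {p..<p+L}. Y' u = 0}" if "good p" for p
        proof -
          have "0 < L" "p + L \<le> N" using L(2) that unfolding good by auto
          from Inv_balanced[OF I' this(1) g_def T_def N(3) that this(2)] show ?thesis by blast
        qed
        let ?R3 = "?R2(13 := X)" and ?A3 = "?A2(7 := f, 10 := ld, 11 := t)"
        have e: "?R3 4 = m + 3" "?R3 5 = N" "?R3 6 = L" "?A3 0 = A 0" "?A3 10 = ld" "?A3 5 = Y'" by simp_all
        show "?Q ?R3 ?A3" unfolding walks_done_def e using ld 1 2 by blast
      next
        fix q assume "q < N"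
        then show "v q < 2 ^ X" using v(2)[of q] X1 by (metis less_trans lessI power_strict_increasing one_less_numeral_iff semiring_norm(76))
      qed (use R N v A in auto)
    qed (use A TX in auto)
  qed (use R N a TX A in \<open>auto simp: inj_on_def\<close>)
qed

section \<open>Input layout and windows inside lists\<close>

definition offset :: "nat list list \<Rightarrow> nat \<Rightarrow> nat" where
  "offset xss i = (\<Sum>k<i. length (xss ! k))"

lemma offset_take: "i \<le> length xss \<Longrightarrow> length (concat (take i xss)) = offset xss i"
proof (induction i)
  case (Suc i)
  then show ?case by (simp add: take_Suc_conv_app_nth offset_def)
qed (simp add: offset_def)

lemma offset_length: "offset xss (length xss) = length (concat xss)"
  using offset_take[of "length xss" xss] by simp

lemma offset_Suc: "offset xss (Suc i) = offset xss i + length (xss ! i)"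
  by (simp add: offset_def)

lemma offset_mono: "i \<le> j \<Longrightarrow> offset xss i \<le> offset xss j"
  unfolding offset_def by (rule sum_mono2) auto

lemma concat_nth_offset:
  assumes "i < length xss" "u < length (xss ! i)"
  shows "concat xss ! (offset xss i + u) = xss ! i ! u"
proof -
  have "xss = take i xss @ xss ! i # drop (Suc i) xss" using assms(1) by (rule id_take_nth_drop)
  then have "concat xss = concat (take i xss) @ xss ! i @ concat (drop (Suc i) xss)"
    by (metis concat.simps(2) concat_append)
  moreover have "length (concat (take i xss)) = offset xss i" using assms(1) by (simp add: offset_take)
  ultimately show ?thesis using assms(2) by (simp add: nth_append)
qed

lemma initial_memory_cells:
  fixes n :: nat and xss :: "nat list list"
  defines "M \<equiv> initial_memory (input_cells n xss)" and "m \<equiv> length xss" and "N \<equiv> length (concat xss)"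
  shows "length (input_cells n xss) = m + 3 + N" "M 0 = n" "M 1 = m" "\<And>i. i \<le> m \<Longrightarrow> M (i + 2) = m + 3 + offset xss i"
    "\<And>q. q < N \<Longrightarrow> M (m + 3 + q) = concat xss ! q" "\<And>a. m + 3 + N \<le> a \<Longrightarrow> M a = 0"
proof -
  let ?h = "map (\<lambda>j. length xss + 3 + (\<Sum>i<j. length (xss ! i))) [0..<length xss + 1]"
  have c: "input_cells n xss = n # m # ?h @ concat xss" by (simp add: input_cells_def m_def)
  show len: "length (input_cells n xss) = m + 3 + N" unfolding c by (simp add: m_def N_def)
  show "M 0 = n" "M 1 = m" unfolding M_def initial_memory_def c by (simp_all add: m_def)
  show "M (i + 2) = m + 3 + offset xss i" if "i \<le> m" for i
  proof -
    have "M (i + 2) = (?h @ concat xss) ! i" using that len unfolding M_def initial_memory_def by (simp add: c)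
    also have "\<dots> = ?h ! i" using that by (simp add: nth_append m_def)
    also have "\<dots> = m + 3 + offset xss i" using that by (simp add: offset_def m_def del: upt_Suc)
    finally show ?thesis .
  qed
  show "M (m + 3 + q) = concat xss ! q" if "q < N" for q
  proof -
    have "M (m + 3 + q) = (?h @ concat xss) ! (m + 1 + q)" using that len unfolding M_def initial_memory_def by (simp add: c eval_nat_numeral)
    also have "\<dots> = concat xss ! q" by (simp add: nth_append m_def)
    finally show ?thesis .
  qed
  show "M a = 0" if "m + 3 + N \<le> a" for a using that len unfolding M_def initial_memory_def by simp
qed

text \<open>Take the first list ending after \<open>p\<close>. If it ended before the window does,
  its end would be the start of a further list strictly inside the window.\<close>

lemma window_in_list:
  assumes "p + L \<le> length (concat xss)" "0 < L" "\<And>i. i < L \<Longrightarrow> i \<noteq> 0 \<Longrightarrow> p + i \<notin> offset xss ` {..<length xss}"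
  obtains i where "i < length xss" "offset xss i \<le> p" "p + L \<le> offset xss (Suc i)"
proof -
  let ?m = "length xss"
  have "offset xss ?m > p" using assms by (simp add: offset_length)
  then have ex: "\<exists>i. offset xss i > p" by blast
  define j where "j = (LEAST i. offset xss i > p)"
  have j: "offset xss j > p" "j \<le> ?m" unfolding j_def using LeastI_ex[OF ex] \<open>offset xss ?m > p\<close> by (auto intro: Least_le)
  have "j \<noteq> 0" using j(1) by (intro notI) (simp add: offset_def)
  then obtain i where i: "j = Suc i" by (cases j) auto
  have "\<not> offset xss i > p" using not_less_Least[of i "\<lambda>i. offset xss i > p"] i j_def by simp
  moreover have "p + L \<le> offset xss (Suc i)"
  proof (rule ccontr)
    assume n: "\<not> p + L \<le> offset xss (Suc i)"
    then have "Suc i \<noteq> ?m" using assms(1) offset_length[of xss] by auto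
    then have "Suc i < ?m" using j i by simp
    moreover have "p + (offset xss (Suc i) - p) = offset xss (Suc i)" using j i by simp
    ultimately have "p + (offset xss (Suc i) - p) \<in> offset xss ` {..<?m}" by auto
    then show False using assms(3)[of "offset xss (Suc i) - p"] n j i by auto
  qed
  ultimately show ?thesis using that[of i] j i by simp
qed

lemma window_distinct:
  assumes d: "\<And>i. i < length xss \<Longrightarrow> distinct (xss ! i)" and i: "i < length xss" "offset xss i \<le> p" "p + L \<le> offset xss (Suc i)"
  shows "inj_on (\<lambda>q. concat xss ! q) {p..<p+L}"
proof (rule inj_onI)
  fix x y assume xy: "x \<in> {p..<p+L}" "y \<in> {p..<p+L}" "concat xss ! x = concat xss ! y"
  let ?o = "offset xss i"
  have b: "x = ?o + (x - ?o)" "y = ?o + (y - ?o)" "x - ?o < length (xss ! i)" "y - ?o < length (xss ! i)"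
    using xy i by (auto simp: offset_Suc)
  have "xss ! i ! (x - ?o) = xss ! i ! (y - ?o)"
    using concat_nth_offset[OF i(1) b(3)] concat_nth_offset[OF i(1) b(4)] b(1,2) xy(3) by metis
  then have "x - ?o = y - ?o" using d[OF i(1)] b(3,4) nth_eq_iff_index_eq by blast
  then show "x = y" using b by linarith
qed

lemma offset_not_inside:
  assumes "offset xss i \<le> p" "0 < k" "p + k < offset xss (Suc i)" shows "p + k \<notin> offset xss ` {..<m}"
proof
  assume "p + k \<in> offset xss ` {..<m}"
  then obtain j where j: "p + k = offset xss j" by auto
  show False
  proof (cases "j \<le> i")
    case True
    then show ?thesis using offset_mono[OF True, of xss] assms j by linarith
  next
    case False
    then show ?thesis using offset_mono[of "Suc i" j xss] assms j by linarith
  qed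
qed

text \<open>At least four full blocks of length \<open>L\<close> fit, so the full blocks cover at
  least 4/5 of the interval; a quarter of that is the required fifth.\<close>

lemma blocks_count:
  fixes P :: "nat \<Rightarrow> bool"
  assumes L: "0 < L" "4 * L \<le> l" and w: "\<And>p. s \<le> p \<Longrightarrow> p + L \<le> s + l \<Longrightarrow> L \<le> 4 * card {u \<in> {p..<p+L}. P u}"
  shows "l \<le> 5 * card {u \<in> {s..<s+l}. P u}"
proof -
  have c: "k * L \<le> 4 * card {u \<in> {s..<s+k*L}. P u}" if "k * L \<le> l" for k
    using that
  proof (induction k)
    case (Suc k)
    have e: "{u \<in> {s..<s+Suc k*L}. P u} = {u \<in> {s..<s+k*L}. P u} \<union> {u \<in> {s+k*L..<s+k*L+L}. P u}" by auto
    have "card {u \<in> {s..<s+Suc k*L}. P u} = card {u \<in> {s..<s+k*L}. P u} + card {u \<in> {s+k*L..<s+k*L+L}. P u}"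
      unfolding e by (rule card_Un_disjoint) auto
    moreover have "L \<le> 4 * card {u \<in> {s+k*L..<s+k*L+L}. P u}" using Suc.prems by (intro w) auto
    moreover have "k * L \<le> 4 * card {u \<in> {s..<s+k*L}. P u}" using Suc by simp
    ultimately show ?case by simp
  qed simp
  define q where "q = l div L"
  have q: "q * L \<le> l" "l < (q + 1) * L" "4 \<le> q"
    using L by (auto simp: q_def dividend_less_div_times less_eq_div_iff_mult_less_eq dividend_less_times_div)
  have "card {u \<in> {s..<s+q*L}. P u} \<le> card {u \<in> {s..<s+l}. P u}" using q by (intro card_mono) auto
  then have 1: "q * L \<le> 4 * card {u \<in> {s..<s+l}. P u}" using c[OF q(1)] by linarith
  have "4 * L \<le> q * L" using q by simp
  then have "4 * l \<le> 5 * (q * L)" using q(2) unfolding add_mult_distrib by linarith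
  then show ?thesis using 1 by linarith
qed

section \<open>Bootstrap and output\<close>

lemma hcost_mono: "X \<le> Y \<Longrightarrow> hcost h X \<le> hcost h Y"
  by (induction h) (auto intro!: add_mono mult_mono)

definition quartic :: "nat \<Rightarrow> hx" where
  "quartic c = tm c (mul 20 21 (V 0) (mul 22 23 (V 0) (mul 24 25 (V 0) (V 0))))"

text \<open>Register 0 caps the loops that compute its own final value, so it first holds the bit
  length \<open>b\<close> of \<open>n\<close>, which already suffices for computing
  \<open>b^4\<close>. The fourth power matches \<open>2 g^2\<close>, of order \<open>L^4\<close>.
  Cell \<open>m + 2\<close> holds the last address, the end of the input.\<close>

definition prologue :: "nat \<Rightarrow> com" where
  "prologue c = Seq (Assign 1 (Load (Add (Load (Const 1)) (Const 2)))) (Seq (Assign 2 (Add (Add (Reg 1) (Load (Const 0))) (Const 1)))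
     (Seq (Assign 3 (Load (Const 0)))
     (Seq (While (Reg 3) (Seq (Assign 3 (Half (Reg 3))) (Assign 0 (Add (Reg 0) (Const 1)))))
     (Seq (Assign 16 (Reg 0)) (Seq (cmp (quartic c) 50) (Assign 0 (Reg 50)))))))"

lemma ev_quartic: "ev (quartic c) R A = c * R 0 ^ 4"
  by (simp add: quartic_def ev_mul power4_eq_xxxx mult_ac)

lemma prologue_runs:
  assumes M: "M 0 = n" "M 1 = m" "M (m + 2) = l" and b: "n < 2 ^ b" "\<And>i. i < b \<Longrightarrow> 2 ^ i \<le> n"
  shows "\<exists>R'. runs (prologue c) M (\<lambda>_. 0) R' UNIV (hcost (quartic c) b + 10 * b + 40) \<and>
    R' 0 = c * b ^ 4 \<and> R' 1 = l \<and> R' 2 = l + n + 1 \<and> R' 16 = b"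
proof -
  let ?R1 = "(\<lambda>_. 0)(1 := l) :: store" let ?R2 = "?R1(2 := l + n + 1)" let ?R3 = "?R2(3 := n)"
  have 1: "runs (Assign 1 (Load (Add (Load (Const 1)) (Const 2)))) M (\<lambda>_. 0) ?R1 UNIV 6"
    "runs (Assign 2 (Add (Add (Reg 1) (Load (Const 0))) (Const 1))) M ?R1 ?R2 UNIV 7"
    "runs (Assign 3 (Load (Const 0))) M ?R2 ?R3 UNIV 3"
    using M by (auto intro!: runs_Assign)
  define I where "I i R \<longleftrightarrow> R 3 = n div 2 ^ i \<and> R 0 = i \<and> R 1 = l \<and> R 2 = l + n + 1" for i and R :: store
  have d: "n div 2 ^ Suc i = n div 2 ^ i div 2" for i by (simp only: power_Suc2 div_mult2_eq)
  let ?w = "Seq (Assign 3 (Half (Reg 3))) (Assign 0 (Add (Reg 0) (Const 1)))"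
  have "\<exists>R'. runs (While (Reg 3) ?w) M ?R3 R' UNIV (b * (7 + cost (Reg 3) + 1) + cost (Reg 3) + 1) \<and> I b R'"
  proof (rule runs_While[where I = I])
    show "I 0 ?R3" by (simp add: I_def)
  next
    fix i R assume "i < b" and I: "I i R"
    let ?R' = "R(3 := R 3 div 2, 0 := R 0 + 1)"
    have "runs ?w M R ?R' UNIV 7"
      by (rule runs_Seq[where W = 3 and W' = 4 and ?R1.0 = "R(3 := R 3 div 2)"]) (auto intro!: runs_Assign)
    moreover have "I (Suc i) ?R'" using I unfolding I_def d by simp
    ultimately show "\<exists>R'. runs ?w M R R' UNIV 7 \<and> I (Suc i) R'" by blast
  next
    fix i R assume i: "i \<le> b" and I: "I i R"
    have "n div 2 ^ i \<noteq> 0 \<longleftrightarrow> i < b"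
    proof (cases "i < b")
      case True
      then show ?thesis using b(2)[OF True] by (simp add: div_greater_zero_iff)
    next
      case False
      then have "i = b" using i by simp
      then show ?thesis using b(1) by simp
    qed
    then show "(val (Reg 3) R M \<noteq> 0 \<longleftrightarrow> i < b) \<and> reads (Reg 3) R M \<subseteq> UNIV" using I by (simp add: I_def)
  qed
  moreover have "b * (7 + cost (Reg 3) + 1) + cost (Reg 3) + 1 = b * 9 + 2" by simp
  ultimately obtain R4 where 4: "runs (While (Reg 3) ?w) M ?R3 R4 UNIV (b * 9 + 2)" "I b R4" by metis
  let ?R5 = "R4(16 := b)"
  have 5: "runs (Assign 16 (Reg 0)) M R4 ?R5 UNIV 2" using 4(2) by (auto intro!: runs_Assign simp: I_def)
  define A :: arrays where "A j i = M (addr l (l + n + 1) j i)" for j i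
  have wf: "wfx (quartic c)" by (simp add: quartic_def)
  have rep: "rep l (l + n + 1) A M" by (simp add: rep_def A_def)
  have R5: "?R5 1 = l" "?R5 2 = l + n + 1" "?R5 0 \<le> b" using 4(2) by (auto simp: I_def)
  obtain R6 where 6: "runs (cmp (quartic c) 50) M ?R5 R6 (region l (l + n + 1) (arrs (quartic c))) (hcost (quartic c) b)"
    "R6 50 = ev (quartic c) ?R5 A" "\<forall>x<50. R6 x = ?R5 x"
    using cmp_runs[OF wf order.refl R5 rep] by blast
  have 7: "runs (Assign 0 (Reg 50)) M R6 (R6(0 := R6 50)) UNIV 2" by (auto intro!: runs_Assign)
  have "runs (prologue c) M (\<lambda>_. 0) (R6(0 := R6 50)) UNIV (hcost (quartic c) b + 10 * b + 40)"
    unfolding prologue_def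
    by (rule runs_Seq[OF 1(1) runs_Seq[OF 1(2) runs_Seq[OF 1(3) runs_Seq[OF 4(1) runs_Seq[OF 5
       runs_Seq[OF runs_mono[OF 6(1) subset_UNIV order.refl] 7 order.refl] order.refl] order.refl] order.refl] order.refl]]) simp
  moreover have "(R6(0 := R6 50)) 0 = c * b ^ 4" using 6(2) 4(2) by (simp add: ev_quartic I_def)
  moreover have "(R6(0 := R6 50)) 1 = l" "(R6(0 := R6 50)) 2 = l + n + 1" "(R6(0 := R6 50)) 16 = b"
    using 6(3) 4(2) by (auto simp: I_def)
  ultimately show ?thesis by blast
qed

definition labx :: hx where
  "labx = Ad (eqx (Ar 5 (V 3)) (Ad (V 6) (V 6))) (tm 2 (eqx (Ar 5 (V 3)) (Cn 0)))"

definition emit :: prog where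
  "emit = Ph 5 0 (Ar 10 (V 3)) (dv (V 3)) labx"

definition lab :: "nat \<Rightarrow> nat \<Rightarrow> label" where
  "lab L y = (if y = 2 * L then YES else if y = 0 then NO else MAYBE)"

lemma labx_props: "wfx labx" "arrs labx \<subseteq> {5}" "0 < R 6 \<Longrightarrow> ev labx R A = label_code (lab (R 6) (A 5 (R 3)))"
  by (auto simp: labx_def lab_def numeral_2_eq_2)

text \<open>This phase writes outside the abstract arrays, so it is treated on the memory itself. It
  is race-free because first occurrences belong to distinct elements and no read reaches an output
  cell.\<close>

lemma emit_exec:
  assumes st: "rst R A S M" and R: "R 5 = N" "0 < R 6" and v: "\<And>q. v q = A 0 (R 4 + q)"
    and vb: "\<And>q. q < N \<Longrightarrow> 1 \<le> v q \<and> R 1 + v q \<le> R 2"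
    and ld: "\<And>p. p < N \<Longrightarrow> A 10 p \<noteq> 0 \<longleftrightarrow> (\<forall>q<p. v q \<noteq> v p)" and cons: "consistent N v (A 5)"
  shows "\<exists>M' Rd Wr w d. exec (pcmp emit) S M S M' Rd Wr w d \<and> (\<forall>q<N. M' (R 1 + v q) = label_code (lab (R 6) (A 5 q))) \<and>
    (\<forall>x. 1 \<le> x \<longrightarrow> R 1 + x \<le> R 2 \<longrightarrow> x \<notin> v ` {..<N} \<longrightarrow> M' (R 1 + x) = 0) \<and>
    w \<le> pcost emit (R 0) * (N + 1) \<and> d \<le> pcost emit (R 0)"
proof -
  have S: "S 1 = R 1" "S 2 = R 2" "S 0 \<le> R 0" "rep (R 1) (R 2) A M" "S 5 = N" "S 6 = R 6" "S 4 = R 4"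
    using st R by (auto simp: rst_def)
  have wf: "wfx (Ar 10 (V 3))" "wfx (dv (V 3))" "wfx labx" by (auto simp: dv_def labx_props)
  let ?G = "{p. p < S 5 \<and> ev (Ar 10 (V 3)) (S(3 := p)) A \<noteq> 0}"
  let ?t = "\<lambda>p. tgt (R 1) (R 2) 0 (ev (dv (V 3)) (S(3 := p)) A)"
  have G: "?G = {p. p < N \<and> (\<forall>q<p. v q \<noteq> v p)}" using S(5) ld by auto
  have t: "?t p = R 1 + v p" for p using S(7) by (simp add: tgt_def v)
  have inj: "inj_on ?t ?G" unfolding G t
  proof (rule inj_onI)
    fix x y assume "x \<in> {p. p < N \<and> (\<forall>q<p. v q \<noteq> v p)}" "y \<in> {p. p < N \<and> (\<forall>q<p. v q \<noteq> v p)}" "R 1 + v x = R 1 + v y"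
    then show "x = y" by (metis (mono_tags, lifting) add_left_cancel linorder_neqE_nat mem_Collect_eq)
  qed
  have dj: "?t ` ?G \<inter> region (R 1) (R 2) (arrs (Ar 10 (V 3)) \<union> arrs (dv (V 3)) \<union> arrs labx) = {}"
  proof -
    have "?t p \<notin> region (R 1) (R 2) (arrs (Ar 10 (V 3)) \<union> arrs (dv (V 3)) \<union> arrs labx)" if "p \<in> ?G" for p
    proof
      assume "?t p \<in> region (R 1) (R 2) (arrs (Ar 10 (V 3)) \<union> arrs (dv (V 3)) \<union> arrs labx)"
      then obtain j i where "R 1 + v p = addr (R 1) (R 2) j i" unfolding region_def t by blast
      moreover have "1 \<le> v p" "R 1 + v p \<le> R 2" using vb[of p] that unfolding G by auto
      ultimately show False by (cases "j = 0") (auto simp: addr_def)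
    qed
    then show ?thesis by blast
  qed
  obtain M' Rd Wr w d where 1: "exec (ParFor 3 (Reg 5) (phase_body 0 (Ar 10 (V 3)) (dv (V 3)) labx)) S M S M' Rd Wr w d"
    "\<forall>p\<in>?G. M' (?t p) = ev labx (S(3 := p)) A" "\<forall>a. a \<notin> ?t ` ?G \<longrightarrow> M' a = M a"
    "w \<le> pcost emit (R 0) * (S 5 + 1)" "d \<le> pcost emit (R 0)"
    using phase_exec[OF wf S(1-4) inj dj] unfolding emit_def pcost.simps by blast
  have "M' (R 1 + v q) = label_code (lab (R 6) (A 5 q))" if "q < N" for q
  proof -
    \<comment> \<open>The first occurrence of the element writes the label;
      \<open>consistent\<close> transfers it to \<open>q\<close>.\<close>
    define p where "p = (LEAST p. v p = v q)"
    have p: "v p = v q" unfolding p_def by (rule LeastI[of _ q]) simp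
    have pq: "p \<le> q" unfolding p_def by (rule Least_le) simp
    have "v q' \<noteq> v p" if "q' < p" for q' using not_less_Least[of q' "\<lambda>p. v p = v q"] that p unfolding p_def by simp
    then have "p \<in> ?G" using pq \<open>q < N\<close> unfolding G by simp
    then have "M' (?t p) = ev labx (S(3 := p)) A" using 1(2) by blast
    moreover have "p < N" using pq \<open>q < N\<close> by simp
    then have "A 5 p = A 5 q" using cons p \<open>q < N\<close> unfolding consistent_def by blast
    ultimately show ?thesis unfolding t p using S(6) R(2) by (simp add: labx_props)
  qed
  moreover have "M' (R 1 + x) = 0" if "1 \<le> x" "R 1 + x \<le> R 2" "x \<notin> v ` {..<N}" for x
  proof -
    have "R 1 + x \<notin> ?t ` ?G" unfolding t G using that(3) by auto
    then show ?thesis using 1(3) st that unfolding rst_def by simp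
  qed
  moreover have "w \<le> pcost emit (R 0) * (N + 1)" using 1(4) S(5) by simp
  moreover have "exec (pcmp emit) S M S M' Rd Wr w d" unfolding emit_def pcmp.simps by (rule 1(1))
  ultimately show ?thesis using 1(5) by blast
qed

text \<open>Chosen for \<open>2 N <= 2^(b (c + 2))\<close>: here \<open>c + 1\<close> comes from
  \<open>N <= n^(c + 1)\<close>, one more \<open>b\<close> absorbs the factor 2, and 6400 is the
  constant in \<open>window_balanced\<close>.\<close>

definition width :: "nat \<Rightarrow> nat" where "width c = 6400 * (c + 2)"

text \<open>Makes the cap \<open>bound c * b^4\<close> equal to \<open>2 g^2\<close> for
  \<open>g = 3200 L^2\<close> and \<open>L = width c * b\<close>.\<close>

definition bound :: "nat \<Rightarrow> nat" where "bound c = 2 * 3200\<^sup>2 * width c ^ 4"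

definition splitter :: "nat \<Rightarrow> com" where
  "splitter c = Seq (prologue (bound c)) (Seq (pcmp (main (width c))) (pcmp emit))"

definition total_cost :: "nat \<Rightarrow> nat \<Rightarrow> nat" where
  "total_cost c X = hcost (quartic (bound c)) X + (X * 10 + 40) + (pcost (main (width c)) X + pcost emit X)"

lemma total_cost_polynomial: "polyb (total_cost c)"
  unfolding total_cost_def[abs_def]
  by (intro polynomial_add polynomial_times polynomial_const hcost_polynomial pcost_polynomial)

lemma card_labelled:
  assumes inj: "inj_on v I" and S: "v ` I = S" and lab: "\<And>u. u \<in> I \<Longrightarrow> \<chi> (v u) = l \<longleftrightarrow> P u"
  shows "card {x \<in> S. \<chi> x = l} = card {u \<in> I. P u}"
proof -
  have "{x \<in> S. \<chi> x = l} = v ` {u \<in> I. P u}" using S lab by auto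
  moreover have "inj_on v {u \<in> I. P u}" using inj by (rule inj_on_subset) auto
  ultimately show ?thesis by (simp add: card_image)
qed

lemma splitter_correct:
  fixes c n m b :: nat and S :: "nat \<Rightarrow> nat set" and xss :: "nat list list"
  assumes n: "2 \<le> n" and m: "m \<le> n ^ c"
    and S: "\<And>i. i \<in> {1..m} \<Longrightarrow> S i \<subseteq> {1..n}" "\<And>i. i \<in> {1..m} \<Longrightarrow> 4 * (width c * b) \<le> card (S i)"
    and fam: "lists_family m S xss" and b: "n < 2 ^ b" "\<And>i. i < b \<Longrightarrow> 2 ^ i \<le> n"
  shows "\<exists>\<chi> w d. computes_labels (splitter c) n xss \<chi> w d \<and>
     w \<le> total_cost c (bound c * b ^ 4) * ((\<Sum>i\<in>{1..m}. card (S i)) + 1) \<and> d \<le> total_cost c (bound c * b ^ 4) \<and>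
     (\<forall>i\<in>{1..m}. card (S i) \<le> 5 * card {v \<in> S i. \<chi> v = YES} \<and> card (S i) \<le> 5 * card {v \<in> S i. \<chi> v = NO})"
proof -
  define L where "L = width c * b" define X where "X = bound c * b ^ 4" define N where "N = length (concat xss)"
  define M where "M = initial_memory (input_cells n xss)" define off where "off = offset xss"
  have len: "length xss = m" using fam unfolding lists_family_def by blast
  have fam': "distinct (xss ! i) \<and> set (xss ! i) = S (Suc i)" if "i < m" for i
  proof -
    have "\<forall>i\<in>{1..m}. distinct (xss ! (i - 1)) \<and> set (xss ! (i - 1)) = S i" using fam unfolding lists_family_def by blast
    moreover have "Suc i \<in> {1..m}" using that by simp
    ultimately have "distinct (xss ! (Suc i - 1)) \<and> set (xss ! (Suc i - 1)) = S (Suc i)" by (rule bspec)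
    then show ?thesis by simp
  qed
  have cS: "card (S (Suc i)) = length (xss ! i)" if "i < m" for i using fam'[OF that] distinct_card[of "xss ! i"] by simp
  note mem = initial_memory_cells[where n = n and xss = xss, folded M_def N_def off_def, unfolded len]
  have N: "N = (\<Sum>i\<in>{1..m}. card (S i))"
  proof -
    have "N = (\<Sum>i<m. length (xss ! i))" using offset_length[of xss] len by (simp add: N_def offset_def)
    also have "\<dots> = (\<Sum>i<m. card (S (Suc i)))" using cS by (intro sum.cong) auto
    also have "\<dots> = (\<Sum>i\<in>{1..m}. card (S i))" by (simp add: sum.atLeast1_atMost_eq)
    finally show ?thesis .
  qed
  have b0: "2 \<le> b" using n b(1) by (cases b; cases "b - 1") auto
  have L1: "1 \<le> L" using b0 by (simp add: L_def width_def)
  have l4: "4 * L \<le> length (xss ! i)" if "i < m" for i using S(2)[of "Suc i"] cS[OF that] that by (simp add: L_def)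
  have "N \<le> m * n"
  proof -
    have "card (S i) \<le> n" if "i \<in> {1..m}" for i using card_mono[OF _ S(1)[OF that]] by simp
    then have "N \<le> of_nat (card {1..m}) * n" unfolding N by (intro sum_bounded_above) auto
    then show ?thesis by simp
  qed
  also have "\<dots> \<le> n ^ c * n" using m by (rule mult_le_mono1)
  also have "\<dots> = n ^ (c + 1)" by simp
  also have "\<dots> \<le> (2 ^ b) ^ (c + 1)" using b(1) by (intro power_mono) auto
  also have "\<dots> = 2 ^ (b * (c + 1))" by (rule power_mult[symmetric])
  finally have Nb: "N \<le> 2 ^ (b * (c + 1))" .
  have w1: "c + 2 \<le> width c" "1 \<le> width c" by (auto simp: width_def)
  have bw: "2 * width c \<le> bound c"
  proof -
    have "width c * 1 \<le> width c * width c ^ 3" using w1 by (intro mult_left_mono) auto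
    also have "\<dots> = width c ^ 4" by (simp add: power_Suc[symmetric] del: power_Suc)
    finally show ?thesis unfolding bound_def by simp
  qed
  have b4: "b \<le> b ^ 4" using b0 by (simp add: self_le_power)
  have X1: "2 * (c + 2) * b \<le> X"
    unfolding X_def using bw w1 b4 by (intro mult_le_mono) auto
  have X2: "b * (c + 1) \<le> X" "b + 1 \<le> X"
  proof -
    have "b * (c + 1) \<le> 2 * (c + 2) * b" by (simp add: algebra_simps)
    then show "b * (c + 1) \<le> X" using X1 by linarith
    have "b + 1 \<le> 2 * 2 * b" using b0 by simp
    also have "\<dots> \<le> 2 * (c + 2) * b" by (intro mult_le_mono1) simp
    finally show "b + 1 \<le> X" using X1 by linarith
  qed
  have NX: "N \<le> 2 ^ X" by (rule order_trans[OF Nb power_increasing[OF X2(1)]]) simp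
  have gX: "2 * (3200 * L\<^sup>2)\<^sup>2 \<le> X" unfolding X_def bound_def L_def by (simp add: power_mult_distrib)
  have lnN: "6400 * ln (2 * real N) \<le> L"
  \<comment> \<open>For \<open>N = 0\<close> the default value \<open>ln 0 = 0\<close> gives the
    claim.\<close>
  proof (cases "N = 0")
    case False
    have "2 * real N \<le> 2 * 2 ^ (b * (c + 1))" using Nb by (metis mult_le_cancel_left_pos of_nat_le_iff of_nat_numeral of_nat_power zero_less_numeral)
    also have "\<dots> \<le> (2::real) ^ b * 2 ^ (b * (c + 1))" using b0 self_le_power[of "2::real" b] by (intro mult_right_mono) auto
    also have "\<dots> = 2 ^ (b * (c + 2))" by (simp add: power_add[symmetric])
    finally have "ln (2 * real N) \<le> ln ((2::real) ^ (b * (c + 2)))" using False by (subst ln_le_cancel_iff) auto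
    also have "\<dots> = real (b * (c + 2)) * ln 2" by (simp add: ln_realpow)
    also have "\<dots> \<le> real (b * (c + 2)) * 1" using ln_2_less_1 by (intro mult_left_mono) auto
    finally have "6400 * ln (2 * real N) \<le> 6400 * real (b * (c + 2))" by simp
    also have "\<dots> = real L" by (simp add: L_def width_def algebra_simps)
    finally show ?thesis .
  qed simp
  have offS: "off (Suc i) = off i + length (xss ! i)" for i by (simp add: off_def offset_Suc)
  \<comment> \<open>Lists are nonempty, so their starts are distinct: the start marks are written
    without races, and \<open>m <= N\<close>.\<close>
  have smono: "off i < off j" if "i < j" "i < m" for i j
    using offset_mono[of "Suc i" j xss] that l4[OF that(2)] L1 offS[of i] unfolding off_def by simp
  have offinj: "inj_on off {..<m}"
    by (rule inj_onI) (metis lessThan_iff linorder_neqE_nat nat_neq_iff smono)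
  have offN: "off m = N" using offset_length[of xss] len by (simp add: off_def N_def)
  have mN: "m \<le> N"
  proof -
    have "i \<le> off i" if "i \<le> m" for i using that
    proof (induction i)
      case (Suc i)
      then show ?case using smono[of i "Suc i"] by simp
    qed simp
    then show ?thesis using offN by fastforce
  qed
  let ?l = "m + 3 + N" let ?B = "?l + n + 1"
  define A :: arrays where "A j i = M (addr ?l ?B j i)" for j i
  have A0: "A 0 i = M i" if "i \<le> ?l" for i using that by (simp add: A_def addr_def min_def)
  define v where "v q = A 0 (m + 3 + q)" for q
  have vq: "v q = concat xss ! q" if "q < N" for q using that A0[of "m + 3 + q"] mem(5)[OF that] by (simp add: v_def)
  have posn: "\<exists>i<m. off i \<le> q \<and> q < off (Suc i)" if q: "q < N" for q
  proof -
    have "q + 1 \<le> length (concat xss)" using q by (simp add: N_def)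
    then obtain i where "i < length xss" "offset xss i \<le> q" "q + 1 \<le> offset xss (Suc i)"
      by (rule window_in_list[of q 1 xss]) auto
    then show ?thesis unfolding off_def len by (intro exI[of _ i]) simp
  qed
  have vi: "v (off i + u) = xss ! i ! u" if "i < m" "u < length (xss ! i)" for i u
  proof -
    have "off i + u < off (Suc i)" using that by (simp add: offS)
    also have "\<dots> \<le> N" using offset_mono[of "Suc i" m xss] that offN unfolding off_def by simp
    finally show ?thesis using vq concat_nth_offset[of i xss u] that len unfolding off_def by simp
  qed
  have vn: "1 \<le> v q \<and> v q \<le> n" if q: "q < N" for q
  proof -
    obtain i where i: "i < m" "off i \<le> q" "q < off (Suc i)" using posn[OF q] by blast
    then have "v q = xss ! i ! (q - off i)" "q - off i < length (xss ! i)" using vi[of i "q - off i"] by (auto simp: offS)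
    then have "v q \<in> set (xss ! i)" by simp
    then show ?thesis using fam'[OF i(1)] S(1)[of "Suc i"] i(1) by auto
  qed
  define good where "good p \<longleftrightarrow> p + L \<le> N \<and> (\<forall>i<L. i \<noteq> 0 \<longrightarrow> p + i \<notin> off ` {..<m})" for p
  have dist: "inj_on v {p..<p+L}" if "good p" for p
  proof -
    have "p + L \<le> length (concat xss)" "\<And>i. i < L \<Longrightarrow> i \<noteq> 0 \<Longrightarrow> p + i \<notin> offset xss ` {..<length xss}"
      using that unfolding good_def N_def off_def len by auto
    then obtain i where i: "i < length xss" "offset xss i \<le> p" "p + L \<le> offset xss (Suc i)"
      using window_in_list[of p L xss] L1 by auto
    have "inj_on (\<lambda>q. concat xss ! q) {p..<p+L}"
      by (rule window_distinct[OF _ i]) (use fam' len in auto)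
    moreover have "\<And>q. q \<in> {p..<p+L} \<Longrightarrow> v q = concat xss ! q" using that vq unfolding good_def by auto
    ultimately show ?thesis by (subst inj_on_cong) auto
  qed
  have M2: "M (m + 2) = ?l" using mem(4)[of m] offN by simp
  obtain R where R: "runs (prologue (bound c)) M (\<lambda>_. 0) R UNIV (hcost (quartic (bound c)) b + 10 * b + 40)"
    "R 0 = X" "R 1 = ?l" "R 2 = ?B" "R 16 = b"
    using prologue_runs[OF mem(2,3) M2 b, of "bound c"] unfolding X_def by blast
  obtain A1 w1 d1 where 1: "exec (prologue (bound c)) (\<lambda>_. 0) M R M A1 {} w1 d1"
    "w1 \<le> hcost (quartic (bound c)) b + 10 * b + 40" "d1 \<le> hcost (quartic (bound c)) b + 10 * b + 40"
    using R(1) unfolding runs_def by blast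
  have bX: "b \<le> X" using X2 by simp
  have c1: "hcost (quartic (bound c)) b + 10 * b + 40 \<le> hcost (quartic (bound c)) X + (X * 10 + 40)"
    using hcost_mono[OF bX, of "quartic (bound c)"] bX by simp
  have rst: "rst R A R M" unfolding rst_def using R mem(6) by (auto simp: rep_def A_def)
  have A1': "A 0 1 = m" using A0[of 1] mem(3) by simp
  have Aj: "A j = (\<lambda>_. 0)" if "0 < j" "j < 16" for j
    using that mem(6) by (auto simp: A_def addr_def fun_eq_iff)
  have vX: "v q < 2 ^ (X - 1)" if "q < N" for q
  proof -
    have "v q < 2 ^ b" using vn[OF that] b(1) by simp
    also have "\<dots> \<le> 2 ^ (X - 1)" using X2(2) by (intro power_increasing) auto
    finally show ?thesis .
  qed
  have a: "A 0 (i + 2) = m + 3 + off i" if "i < m" for i using that mem(4)[of i] A0[of "i + 2"] mN by simp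
  have R12: "R 1 \<le> R 2" using R by simp
  have "wp N (main (width c)) (walks_done N L m v good (A 0)) R A"
    by (rule wp_main[where R = R and A = A and v = v and off = off and good = good,
          OF R(2,3) R12 R(5) L_def L1 gX NX mN lnN A1' Aj v_def vX a offinj good_def dist])
  then obtain S2 M2 Rd2 Wr2 w2 d2 R2 A2 where 2: "exec (pcmp (main (width c))) R M S2 M2 Rd2 Wr2 w2 d2" "rst R2 A2 S2 M2"
    "R2 0 = R 0" "R2 1 = R 1" "R2 2 = R 2" "walks_done N L m v good (A 0) R2 A2"
    "w2 \<le> pcost (main (width c)) (R 0) * (N + 1)" "d2 \<le> pcost (main (width c)) (R 0)"
    using rst unfolding wp_def by blast
  have p: "R2 4 = m + 3" "R2 5 = N" "R2 6 = L" "A2 0 = A 0"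
    "\<forall>p<N. A2 10 p \<noteq> 0 \<longleftrightarrow> (\<forall>q<p. v q \<noteq> v p)" "consistent N v (A2 5)"
    "\<forall>p. good p \<longrightarrow> L \<le> 4 * card {u \<in> {p..<p+L}. A2 5 u = 2 * L} \<and> L \<le> 4 * card {u \<in> {p..<p+L}. A2 5 u = 0}"
    using 2(6) unfolding walks_done_def by auto
  have v2: "v q = A2 0 (R2 4 + q)" for q using p(1,4) by (simp add: v_def)
  have vb: "1 \<le> v q \<and> R2 1 + v q \<le> R2 2" if "q < N" for q using vn[OF that] 2(4,5) R by simp
  have L6: "0 < R2 6" using p(3) L1 by simp
  obtain M3 Rd3 Wr3 w3 d3 where 3: "exec (pcmp emit) S2 M2 S2 M3 Rd3 Wr3 w3 d3"
    "\<forall>q<N. M3 (R2 1 + v q) = label_code (lab (R2 6) (A2 5 q))"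
    "\<forall>x. 1 \<le> x \<longrightarrow> R2 1 + x \<le> R2 2 \<longrightarrow> x \<notin> v ` {..<N} \<longrightarrow> M3 (R2 1 + x) = 0"
    "w3 \<le> pcost emit (R2 0) * (N + 1)" "d3 \<le> pcost emit (R2 0)"
    using emit_exec[OF 2(2) p(2) L6 v2 vb] p(5,6) by blast
  define Y where "Y = A2 5"
  \<comment> \<open>Elements in no set get MAYBE, the code of a blank cell. For the others any
    occurrence may be chosen, by consistency.\<close>
  define \<chi> where "\<chi> x = (if x \<in> v ` {..<N} then lab L (Y (SOME q. q < N \<and> v q = x)) else MAYBE)" for x
  have chi: "\<chi> (v q) = lab L (Y q)" if "q < N" for q
  proof -
    let ?q = "SOME q'. q' < N \<and> v q' = v q"
    have "?q < N \<and> v ?q = v q" by (rule someI[of _ q]) (use that in simp)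
    then have "Y ?q = Y q" using p(6) that unfolding consistent_def Y_def by blast
    moreover have "v q \<in> v ` {..<N}" using that by simp
    ultimately show ?thesis by (simp add: \<chi>_def)
  qed
  have out: "M3 (?l + x) = label_code (\<chi> x)" if "x \<in> {1..n}" for x
  proof (cases "x \<in> v ` {..<N}")
    case True
    then obtain q where "q < N" "x = v q" by auto
    then show ?thesis using 3(2) chi 2(4) p(3) R(3) by (simp add: Y_def)
  next
    case False
    then show ?thesis using 3(3) that 2(4,5) R(3,4) by (simp add: \<chi>_def)
  qed
  have ex: "exec (splitter c) (\<lambda>_. 0) M S2 M3 (A1 \<union> (Rd2 \<union> Rd3)) ({} \<union> (Wr2 \<union> Wr3)) (w1 + (w2 + w3)) (d1 + (d2 + d3))"
    unfolding splitter_def by (rule exec.Seq[OF 1(1) exec.Seq[OF 2(1) 3(1)]])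
  have comp: "computes_labels (splitter c) n xss \<chi> (w1 + (w2 + w3)) (d1 + (d2 + d3))"
    unfolding computes_labels_def M_def[symmetric] mem(1) using ex out by blast
  have d: "d1 + (d2 + d3) \<le> total_cost c X" unfolding total_cost_def using 1(3) c1 2(3,8) 3(5) R(2) by simp
  have w: "w1 + (w2 + w3) \<le> total_cost c X * (N + 1)"
  proof -
    have "w1 \<le> (hcost (quartic (bound c)) X + (X * 10 + 40)) * (N + 1)" using 1(2) c1 by simp
    then show ?thesis unfolding total_cost_def using 2(3,7) 3(4) R(2) by (simp add: algebra_simps)
  qed
  have bal: "card (S i) \<le> 5 * card {x \<in> S i. \<chi> x = YES} \<and> card (S i) \<le> 5 * card {x \<in> S i. \<chi> x = NO}" if i: "i \<in> {1..m}" for i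
  proof -
    obtain i' where i': "i = Suc i'" "i' < m" using i by (cases i) auto
    let ?s = "off i'" and ?n = "length (xss ! i')" let ?I = "{?s..<?s+?n}"
    have sN: "?s + ?n \<le> N" using offset_mono[of "Suc i'" m xss] i' offN offS[of i'] unfolding off_def by simp
    have im: "v ` ?I = S i"
    proof -
      have "v ` ?I = (\<lambda>u. v (?s + u)) ` {0..<?n}" unfolding image_image[symmetric, of v "\<lambda>u. ?s + u"] image_add_atLeastLessThan by (simp add: add.commute)
      also have "\<dots> = (\<lambda>u. xss ! i' ! u) ` {0..<?n}" using vi[OF i'(2)] by (intro image_cong) auto
      also have "\<dots> = set (xss ! i')" by (auto simp: set_conv_nth)
      finally show ?thesis using fam'[OF i'(2)] i'(1) by simp
    qed
    have "card (v ` ?I) = card ?I" using im cS[OF i'(2)] i'(1) by simp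
    then have inj: "inj_on v ?I" by (intro eq_card_imp_inj_on) auto
    have g: "good p" if "?s \<le> p" "p + L \<le> ?s + ?n" for p
    proof -
      have "p + k \<notin> off ` {..<m}" if "k < L" "k \<noteq> 0" for k
        unfolding off_def using that \<open>?s \<le> p\<close> \<open>p + L \<le> ?s + ?n\<close> offS[of i']
        by (intro offset_not_inside[of xss i']) (auto simp: off_def)
      then show ?thesis using that sN by (simp add: good_def)
    qed
    have L0: "0 < L" using L1 by simp
    have w: "L \<le> 4 * card {u \<in> {p..<p+L}. Y u = 2 * L}" "L \<le> 4 * card {u \<in> {p..<p+L}. Y u = 0}"
      if "?s \<le> p" "p + L \<le> ?s + ?n" for p using p(7) g[OF that] unfolding Y_def by blast+
    have "card {x \<in> S i. \<chi> x = YES} = card {u \<in> ?I. Y u = 2 * L}"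
      using sN chi L1 by (intro card_labelled[OF inj im]) (auto simp: lab_def)
    moreover have "card {x \<in> S i. \<chi> x = NO} = card {u \<in> ?I. Y u = 0}"
      using sN chi L1 by (intro card_labelled[OF inj im]) (auto simp: lab_def)
    moreover have "?n \<le> 5 * card {u \<in> ?I. Y u = 2 * L}" by (rule blocks_count[OF L0 l4[OF i'(2)] w(1)])
    moreover have "?n \<le> 5 * card {u \<in> ?I. Y u = 0}" by (rule blocks_count[OF L0 l4[OF i'(2)] w(2)])
    ultimately show ?thesis using cS[OF i'(2)] i'(1) by simp
  qed
  show ?thesis unfolding N[symmetric] X_def[symmetric] using comp d w bal by blast
qed

theorem theorem5:
  "\<forall>c::nat. \<exists>C>0::real. \<exists>P::com. \<exists>K>0::real. \<exists>k::nat.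
     \<forall>(n::nat) (m::nat) (S :: nat \<Rightarrow> nat set) (xss :: nat list list).
       n \<ge> 2 \<longrightarrow> m \<le> n ^ c \<longrightarrow>
       (\<forall>i\<in>{1..m}. S i \<subseteq> {1..n} \<and> real (card (S i)) \<ge> C * log 2 (real n)) \<longrightarrow>
       lists_family m S xss \<longrightarrow>
       (\<exists>(\<chi> :: nat \<Rightarrow> label) (w::nat) (d::nat).
          computes_labels P n xss \<chi> w d \<and>
          real w \<le> K * real (max 1 (\<Sum>i\<in>{1..m}. card (S i))) * log 2 (real n) ^ k \<and>
          real d \<le> K * log 2 (real n) ^ k \<and>
          (\<forall>i\<in>{1..m}.
             real (card {v \<in> S i. \<chi> v = YES}) \<ge> real (card (S i)) / 5 \<and>
             real (card {v \<in> S i. \<chi> v = NO}) \<ge> real (card (S i)) / 5))"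
proof (rule allI, goal_cases)
  case (1 c)
  obtain K k where Kk: "\<And>X. X \<ge> 1 \<Longrightarrow> total_cost c X \<le> K * X ^ k"
    using total_cost_polynomial[of c] unfolding polyb_def by blast
  \<comment> \<open>Sets need \<open>4 * width c * b\<close> elements, and \<open>b\<close> is at
    most twice the logarithm of \<open>n\<close>.\<close>
  define C where "C = 8 * real (width c)"
  \<comment> \<open>The factor 2 covers \<open>N + 1 <= 2 max 1 N\<close>; 16 is \<open>2^4\<close>,
    from replacing \<open>b\<close> by twice the logarithm in \<open>b^4\<close>; the summand 1
    makes the constant positive.\<close>
  define KK where "KK = 2 * (real K * (16 * real (bound c)) ^ k) + 1"
  have pos: "0 < C" "0 < KK" by (auto simp: C_def width_def KK_def intro!: add_nonneg_pos)
  show ?case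
  proof (rule exI[of _ C], rule conjI[OF pos(1)], rule exI[of _ "splitter c"], rule exI[of _ KK], rule conjI[OF pos(2)],
      rule exI[of _ "4 * k"], intro allI impI, goal_cases)
    case (1 n m S xss)
    note n = 1(1) and m = 1(2) and S = 1(3) and fam = 1(4)
    let ?N = "\<Sum>i\<in>{1..m}. card (S i)"
    define lg where "lg = log 2 (real n)"
    define b where "b = (LEAST i. n < 2 ^ i)"
    have b1: "n < 2 ^ b" unfolding b_def by (rule LeastI[of _ n]) (rule less_exp)
    have b2: "2 ^ i \<le> n" if "i < b" for i using not_less_Least[of i "\<lambda>i. n < 2 ^ i"] that unfolding b_def by simp
    have b0: "0 < b" using b1 n by (cases b) auto
    \<comment> \<open>This holds by minimality of \<open>b\<close>; with \<open>1 <= lg\<close>,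
      from \<open>2 <= n\<close>, it yields \<open>b <= 2 lg\<close>.\<close>
    have "real (b - 1) \<le> lg" unfolding lg_def
      using b2[of "b - 1"] b0 by (intro le_log_of_power) (simp_all flip: of_nat_le_iff)
    moreover have "real 1 \<le> lg" unfolding lg_def using n by (intro le_log_of_power) auto
    ultimately have lg: "real b \<le> 2 * lg" "1 \<le> lg" using b0 by (auto simp: of_nat_diff)
    have S1: "S i \<subseteq> {1..n}" "4 * (width c * b) \<le> card (S i)" if "i \<in> {1..m}" for i
    proof -
      show "S i \<subseteq> {1..n}" using S that by blast
      have "real (4 * (width c * b)) \<le> 4 * real (width c) * (2 * lg)" using mult_left_mono[OF lg(1), of "4 * real (width c)"] by simp
      also have "\<dots> \<le> real (card (S i))" using bspec[OF S that] by (simp add: C_def lg_def mult.assoc)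
      finally show "4 * (width c * b) \<le> card (S i)" by (simp only: of_nat_le_iff)
    qed
    define X where "X = bound c * b ^ 4"
    have X1: "1 \<le> X" using b0 by (simp add: X_def bound_def width_def)
    obtain \<chi> w d where r: "computes_labels (splitter c) n xss \<chi> w d" "w \<le> total_cost c X * (?N + 1)" "d \<le> total_cost c X"
      "\<forall>i\<in>{1..m}. card (S i) \<le> 5 * card {v \<in> S i. \<chi> v = YES} \<and> card (S i) \<le> 5 * card {v \<in> S i. \<chi> v = NO}"
      using splitter_correct[OF n m S1 fam b1 b2] unfolding X_def by blast
    have "real b ^ 4 \<le> (2 * lg) ^ 4" using lg by (intro power_mono) auto
    then have "real X \<le> real (bound c) * (2 * lg) ^ 4" unfolding X_def by (simp add: mult_left_mono)
    also have "\<dots> = 16 * real (bound c) * lg ^ 4" by (simp add: power_mult_distrib)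
    finally have Xb: "real X \<le> 16 * real (bound c) * lg ^ 4" .
    have "real (total_cost c X) \<le> real (K * X ^ k)" using Kk[OF X1] by (simp only: of_nat_le_iff)
    also have "\<dots> = real K * real X ^ k" by simp
    also have "\<dots> \<le> real K * (16 * real (bound c) * lg ^ 4) ^ k" using Xb by (intro mult_left_mono power_mono) auto
    also have "\<dots> = real K * (16 * real (bound c)) ^ k * lg ^ (4 * k)" by (simp add: power_mult_distrib power_mult)
    finally have tc: "real (total_cost c X) \<le> real K * (16 * real (bound c)) ^ k * lg ^ (4 * k)" .
    have K2: "2 * (real K * (16 * real (bound c)) ^ k) \<le> KK" "0 \<le> real K * (16 * real (bound c)) ^ k" by (simp_all add: KK_def)
    have lk: "0 \<le> lg ^ (4 * k)" using lg by simp
    have "2 * real (total_cost c X) \<le> 2 * (real K * (16 * real (bound c)) ^ k) * lg ^ (4 * k)" using tc by simp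
    also have "\<dots> \<le> KK * lg ^ (4 * k)" using K2 lk by (intro mult_right_mono) auto
    finally have tc2: "2 * real (total_cost c X) \<le> KK * lg ^ (4 * k)" .
    have "real d \<le> KK * lg ^ (4 * k)" using r(3) tc2 by linarith
    moreover have "real w \<le> KK * real (max 1 ?N) * lg ^ (4 * k)"
    proof -
      have "w \<le> total_cost c X * (2 * max 1 ?N)" by (rule order_trans[OF r(2)], rule mult_left_mono) auto
      then have "real w \<le> real (total_cost c X * (2 * max 1 ?N))" by (simp only: of_nat_le_iff)
      also have "\<dots> = 2 * real (total_cost c X) * real (max 1 ?N)" by simp
      also have "\<dots> \<le> KK * lg ^ (4 * k) * real (max 1 ?N)" using tc2 by (intro mult_right_mono) auto
      finally show ?thesis by (simp only: mult_ac)
    qed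
    moreover have "real (card {v \<in> S i. \<chi> v = YES}) \<ge> real (card (S i)) / 5 \<and>
             real (card {v \<in> S i. \<chi> v = NO}) \<ge> real (card (S i)) / 5" if "i \<in> {1..m}" for i
      using bspec[OF r(4) that] by linarith
    ultimately show ?case using r(1) unfolding lg_def by blast
  qed
qed

end
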